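(* Let $s=(s_i)_{i\in FN}$ be an approximating sequence of a Borel semiset having an additive cut, and let $B\in\mathscr{B}_s$ be such that $|B|=\bigcup_{i\in FN}\bigcap_{j\ge i}s_j$ is an additive cut. Then (i) for each real $r$ with $0\le r\le\infty$ (the value $\infty$ included) there exists a Borel approximating function $F$ such that $B\in\mathscr{O}(s,F)$ and $m_{s,F}(B)=r$; (ii) there exists a Borel approximating function $G$ such that $B\notin\mathscr{O}(s,G)$.
   Context: Setting: Vopěnka's Alternative Set Theory (AST). Objects are classes; sets are the classes that are members of classes; $V$ is the class of all sets. Sets satisfy ZF with the axiom of infinity replaced by its negation (in particular induction for set-formulas); classes satisfy extensionality and full comprehension; a semiset is a subclass of a set (it need not be a set); prolongation axiom: every function with domain $FN$ is a subclass of a set function; the axiom of choice (extensional coding) is assumed; any two uncountable classes are equinumerous. $N$ is the class of (von Neumann) natural numbers and $FN=\{n\in N:\text{every subclass of }n\text{ is a set}\}$ the class of finite natural numbers; $Q$ is the class of rationals built from $N$, $Q^+$ the nonnegative ones, $FQ\subseteq Q$ the rationals $\pm x/y$ with $x,y\in FN$, and $BQ=\{x\in Q:(\exists i\in FN)\,|x|\le i\}$. Indices $i,j,k$ range over $FN$. Borel classes: $X$ is a $\sigma_0$-class iff it is a $\pi_0$-class iff it is set-theoretically definable (definable by a formula quantifying only over sets, with set parameters). For $a\in FN$, $a>0$, $X$ is a $\sigma_a$-class ($\pi_a$-class) iff $X=\bigcup_{i\in FN}X_i$ ($X=\bigcap_{i\in FN} X_i$) with each $X_i$ a $\pi_b$-class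 ($\sigma_b$-class) for some $b<a$. $X$ is Borel if it is a $\sigma_a$- or $\pi_a$-class for some $a\in FN$. $\mathscr{B}_s$ is the system of Borel semisets. Cuts: $A\subseteq Q^+$ is a cut if it is downward closed in $Q^+$ and has no greatest element; cuts are ordered by inclusion. For $q\in Q^+$, $Q\langle q\rangle=\{x\in Q^+:x<q\}$, often written simply $q$; it is a cut of a natural number if $q\in N$. $\frac{FN}{1}=\bigcup_{n\in FN}Q\langle n\rangle$ and $\frac1{FN}=\bigcap_{0<n\in FN}Q\langle 1/n\rangle$. External sum: $\{x\in Q^+:\forall a\notin A\,\forall b\notin B\ (x<a+b)\}$; internal sum: $\{x\in Q^+:\exists a\in A\,\exists b\in B\ (x<a+b)\}$ (with $a,b\in Q^+$). $A$ is additive if $A+A=A$ (for both sums), otherwise nonadditive. Internal difference: $A\ominus B=\{x\in Q^+:(\forall b\in B')\,x+b\in A\}$, where $B'=B\cup\{\min(Q^+\setminus B)\}$ ($B'=B$ if there is no minimum). Lower/upper cuts of a class $X$: for $n\in N$ and a set $u$, $n\,\widehat\prec\, u$ means there is an injective set function with domain $n$ and range a proper subset of $u$. $\underline X=\{q\in Q^+:(\exists n\in N)(\exists u)(u\subseteq X\wedge n\widehat\prec u\wedge q<n)\}$, $\overline X=\{q\in Q^+:(\exists n\in N)((\forall u)(u\supseteq X\Rightarrow n\widehat\prec u)\wedge q<n)\}$ ($u$ ranging over sets). $|X|$ denotes the common value if they agree. (For a Borel class, if one of $\underline X,\overline X$ is additive then they are equal.) An approximating sequence of a class $X$ is a sequence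 $(s_i)_{i\in FN}$ of cuts of natural numbers with $\bigcup_i\bigcap_{j\ge i}s_j=\underline X$ and $\bigcap_i\bigcup_{j\ge i}s_j=\overline X$. A Borel approximating function (BAF) is a map $F$ assigning to each $A\in\mathscr{B}_s$ an approximating sequence of $A$. Ratios: cuts $Q\langle q\rangle$ of rationals are added, multiplied and divided as the rationals $q$ themselves. For sequences of such cuts, $\varliminf \frac{b_i}{s_i}=\bigcup_i\bigcap_{j\ge i}\frac{b_j}{s_j}$ and $\varlimsup\frac{b_i}{s_i}=\bigcap_i\bigcup_{j\ge i}\frac{b_j}{s_j}$. For cuts, $A\doteq B$ means $(A\ominus B)\cup(B\ominus A)\subseteq\frac1{FN}$ or $A\cap B\supseteq\frac{FN}{1}$. A semiset $B\in\mathscr{B}_s$ with $F(B)=(b_i)$ is $\langle s,F\rangle$-observable if $\varliminf\frac{b_i}{s_i}\doteq\varlimsup\frac{b_i}{s_i}$; $\mathscr{O}(s,F)$ is the system of all $\langle s,F\rangle$-observable semisets. Reals: for $p,q\in Q$, $p\doteq q$ iff ($p,q\in BQ$ and $|p-q|<1/i$ for all $0<i\in FN$), or $p,q$ are both greater than every $k\in FN$, or both less than $-k$ for every $k\in FN$. $\mathrm{mon}(q)=\{s\in Q:s\doteq q\}$, $R=BQ/\doteq$, and $\infty=\{q\in Q:(\forall i)\,q>i\}$. $\lim_{i}\mathrm{mon}(a_i)=\mathrm{mon}(x)$ means: for each nonzero $q\in FQ$ there is $i$ with $|a_j-x|<|q|$ for all $j>i$; or $x>q$ for all $q\in FQ$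 and for each $q\in FQ$, eventually $a_j>q$; or the same with $<$. The Kalina measure $m_{s,F}:\mathscr{O}(s,F)\to R\cup\{\infty\}$ is $m_{s,F}(B)=\lim_{i\in FN}\mathrm{mon}\left(\frac{b_i}{s_i}\right)$, where $F(B)=(b_i)$. *)

theory Defs
  imports Complex_Main
begin

text \<open>
  A model of Alternative Set Theory is rendered by a type \<open>'v\<close> (the universe \<open>V\<close> of sets)
  carrying a membership relation.  Classes are the HOL sets over \<open>'v\<close>, so that extensionality and
  full comprehension for classes, as well as the axiom of choice, are those of HOL.  Systems of
  classes and maps between them are HOL objects of higher type.
\<close>

class membership =
  fixes mem :: "'a \<Rightarrow> 'a \<Rightarrow> bool"  (infix "\<epsilon>" 50)

definition elts :: "'v::membership \<Rightarrow> 'v set" where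
  "elts a = {x. x \<epsilon> a}"

definition is_set :: "'v::membership set \<Rightarrow> bool" where
  "is_set X \<longleftrightarrow> (\<exists>a. X = elts a)"

definition semiset :: "'v::membership set \<Rightarrow> bool" where
  "semiset X \<longleftrightarrow> (\<exists>a. X \<subseteq> elts a)"


section \<open>Set-theoretical definability\<close>

text \<open>Set-formulas: all quantifiers range over sets.  Variables are natural numbers.\<close>

datatype fm = FEq nat nat | FMem nat nat | FNot fm | FAnd fm fm | FAll nat fm

primrec sat :: "fm \<Rightarrow> (nat \<Rightarrow> 'v::membership) \<Rightarrow> bool" where
  "sat (FEq i j) e \<longleftrightarrow> e i = e j"
| "sat (FMem i j) e \<longleftrightarrow> e i \<epsilon> e j"
| "sat (FNot p) e \<longleftrightarrow> \<not> sat p e"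
| "sat (FAnd p q) e \<longleftrightarrow> sat p e \<and> sat q e"
| "sat (FAll i p) e \<longleftrightarrow> (\<forall>x. sat p (e(i := x)))"

text \<open>The assignment \<open>e\<close> supplies the set parameters.\<close>

definition set_definable :: "'v::membership set \<Rightarrow> bool" where
  "set_definable X \<longleftrightarrow> (\<exists>p e. X = {x. sat p (e(0 := x))})"

definition set_definable_rel :: "('v::membership \<times> 'v) set \<Rightarrow> bool" where
  "set_definable_rel R \<longleftrightarrow> (\<exists>p e. R = {(x, y). sat p (e(0 := x, 1 := y))})"


section \<open>Pairs, set functions and natural numbers\<close>

definition empty_v :: "'v::membership" where
  "empty_v = (THE z. elts z = {})"

definition upair :: "'v::membership \<Rightarrow> 'v \<Rightarrow> 'v" where
  "upair x y = (THE z. elts z = {x, y})"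

definition kpair :: "'v::membership \<Rightarrow> 'v \<Rightarrow> 'v" where
  "kpair x y = upair (upair x x) (upair x y)"

definition set_fun :: "'v::membership \<Rightarrow> bool" where
  "set_fun f \<longleftrightarrow> (\<forall>z\<in>elts f. \<exists>x y. z = kpair x y) \<and>
     (\<forall>x y y'. kpair x y \<epsilon> f \<and> kpair x y' \<epsilon> f \<longrightarrow> y = y')"

definition dom_v :: "'v::membership \<Rightarrow> 'v set" where
  "dom_v f = {x. \<exists>y. kpair x y \<epsilon> f}"

definition ran_v :: "'v::membership \<Rightarrow> 'v set" where
  "ran_v f = {y. \<exists>x. kpair x y \<epsilon> f}"

definition set_inj :: "'v::membership \<Rightarrow> bool" where
  "set_inj f \<longleftrightarrow> set_fun f \<and> (\<forall>x x' y. kpair x y \<epsilon> f \<and> kpair x' y \<epsilon> f \<longrightarrow> x = x')"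

definition NN :: "'v::membership set" where
  "NN = {n. (\<forall>x\<in>elts n. elts x \<subseteq> elts n) \<and> (\<forall>x\<in>elts n. \<forall>y\<in>elts n. x \<epsilon> y \<or> x = y \<or> y \<epsilon> x)}"

definition FN :: "'v::membership set" where
  "FN = {n \<in> NN. \<forall>X. X \<subseteq> elts n \<longrightarrow> is_set X}"

text \<open>Addition and multiplication on \<open>N\<close>: the number of elements of a disjoint union and of a
  Cartesian product.  The ordering of \<open>N\<close> is \<open>\<epsilon>\<close>, its reflexive version is inclusion.\<close>

definition set_equinumerous :: "'v::membership set \<Rightarrow> 'v set \<Rightarrow> bool" where
  "set_equinumerous X Y \<longleftrightarrow> (\<exists>f. set_inj f \<and> dom_v f = X \<and> ran_v f = Y)"

definition nat_add :: "'v::membership \<Rightarrow> 'v \<Rightarrow> 'v" where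
  "nat_add m n = (THE k. k \<in> NN \<and> set_equinumerous (elts k)
     (kpair empty_v ` elts m \<union> kpair (upair empty_v empty_v) ` elts n))"

definition nat_mult :: "'v::membership \<Rightarrow> 'v \<Rightarrow> 'v" where
  "nat_mult m n = (THE k. k \<in> NN \<and> set_equinumerous (elts k)
     {kpair x y | x y. x \<in> elts m \<and> y \<in> elts n})"


section \<open>The axioms\<close>

text \<open>
  The first group is ZF with infinity replaced by its negation, including the (redundant) schema of
  induction for set-formulas.  In the last axiom a class is uncountable iff it has no injection
  into \<open>FN\<close>.
\<close>

class ast = membership +
  assumes set_ext: "(\<And>x. x \<epsilon> a \<longleftrightarrow> x \<epsilon> b) \<Longrightarrow> a = b"
    and pairing: "\<exists>c. elts c = {a, b}"
    and union: "\<exists>c. elts c = (\<Union>x\<in>elts a. elts x)"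
    and powerset: "\<exists>c. elts c = {x. elts x \<subseteq> elts a}"
    and separation: "set_definable X \<Longrightarrow> \<exists>c. elts c = elts a \<inter> X"
    and replacement: "set_definable_rel R \<Longrightarrow>
      (\<And>x y y'. x \<epsilon> a \<Longrightarrow> (x, y) \<in> R \<Longrightarrow> (x, y') \<in> R \<Longrightarrow> y = y') \<Longrightarrow>
      \<exists>c. elts c = R `` elts a"
    and foundation: "elts a \<noteq> {} \<Longrightarrow> \<exists>x\<in>elts a. elts x \<inter> elts a = {}"
    and no_infinite_set: "\<not> (\<exists>a. (\<exists>z\<in>elts a. elts z = {}) \<and>
      (\<forall>x\<in>elts a. \<exists>y\<in>elts a. elts y = insert x (elts x)))"
    and set_induction: "set_definable X \<Longrightarrow> (\<And>z. elts z = {} \<Longrightarrow> z \<in> X) \<Longrightarrow>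
      (\<And>x y z. x \<in> X \<Longrightarrow> elts z = insert y (elts x) \<Longrightarrow> z \<in> X) \<Longrightarrow> a \<in> X"
    and prolongation: "\<exists>f. set_fun f \<and> (\<forall>n\<in>FN. kpair n (F n) \<epsilon> f)"
    and two_cardinalities:
      "\<not> (\<exists>f. inj_on f X \<and> f ` X \<subseteq> FN) \<Longrightarrow> \<not> (\<exists>f. inj_on f Y \<and> f ` Y \<subseteq> FN) \<Longrightarrow>
       \<exists>f. bij_betw f X Y"

text \<open>The axiom of extensional coding need not be assumed.\<close>

lemma extensional_coding:
  fixes R :: "('v::ast \<times> 'v) set"
  shows "\<exists>S \<subseteq> Domain R. \<forall>x\<in>Domain R. \<exists>!y. y \<in> S \<and> R `` {y} = R `` {x}"
proof -
  define c where "c x = (SOME y. R `` {y} = R `` {x})" for x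
  have c: "R `` {c x} = R `` {x}" for x
    unfolding c_def by (rule someI [where x = x]) (rule refl)
  have dom: "x \<in> Domain R \<longleftrightarrow> R `` {x} \<noteq> {}" for x
    by blast
  have eq: "c x = c y" if "R `` {x} = R `` {y}" for x y
    unfolding c_def by (simp only: that)
  show ?thesis
  proof (intro exI conjI ballI)
    show "c ` Domain R \<subseteq> Domain R"
      by (rule image_subsetI) (simp only: dom c not_False_eq_True)
  next
    fix x assume "x \<in> Domain R"
    then show "\<exists>!y. y \<in> c ` Domain R \<and> R `` {y} = R `` {x}"
    proof (intro ex1I conjI)
      fix y assume "y \<in> c ` Domain R \<and> R `` {y} = R `` {x}"
      then obtain z where y: "y = c z" and "R `` {c z} = R `` {x}" by auto
      then have "R `` {z} = R `` {x}" by (simp only: c)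
      then show "y = c x" unfolding y by (rule eq)
    qed (rule imageI, assumption, rule c)
  qed
qed


section \<open>Borel classes\<close>

inductive sigma_class :: "'v::membership \<Rightarrow> 'v set \<Rightarrow> bool"
  and pi_class :: "'v::membership \<Rightarrow> 'v set \<Rightarrow> bool" where
  sigma_0: "set_definable X \<Longrightarrow> sigma_class empty_v X"
| pi_0: "set_definable X \<Longrightarrow> pi_class empty_v X"
| sigma_pos: "(a::'v) \<in> FN \<Longrightarrow> a \<noteq> empty_v \<Longrightarrow> (\<forall>i\<in>(FN::'v set). \<exists>b. b \<epsilon> a \<and> pi_class b (Y i)) \<Longrightarrow>
    sigma_class a (\<Union>i\<in>(FN::'v set). Y i)"
| pi_pos: "(a::'v) \<in> FN \<Longrightarrow> a \<noteq> empty_v \<Longrightarrow> (\<forall>i\<in>(FN::'v set). \<exists>b. b \<epsilon> a \<and> sigma_class b (Y i)) \<Longrightarrow>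
    pi_class a (\<Inter>i\<in>(FN::'v set). Y i)"

definition Borel :: "'v::membership set \<Rightarrow> bool" where
  "Borel X \<longleftrightarrow> (\<exists>a\<in>FN. sigma_class a X \<or> pi_class a X)"

definition Borel_semisets :: "'v::membership set set" where
  "Borel_semisets = {X. Borel X \<and> semiset X}"


section \<open>Rationals\<close>

text \<open>
  The class \<open>Q\<close> of rationals is the type \<open>'q\<close>: an ordered field together with a map \<open>\<iota>\<close> embedding
  the ordered semiring \<open>N\<close> such that each element is a fraction of elements of \<open>N\<close>, up to sign.
  This determines \<open>('q, \<iota>)\<close> up to a unique isomorphism.
\<close>

definition rationals :: "('v::membership \<Rightarrow> 'q::linordered_field) \<Rightarrow> bool" where
  "rationals \<iota> \<longleftrightarrow>
     (\<forall>m\<in>NN. \<forall>n\<in>NN. \<iota> (nat_add m n) = \<iota> m + \<iota> n \<and> \<iota> (nat_mult m n) = \<iota> m * \<iota> n \<and>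
        (\<iota> m < \<iota> n \<longleftrightarrow> m \<epsilon> n)) \<and>
     (\<forall>q. \<exists>x\<in>NN. \<exists>y\<in>NN. \<iota> y \<noteq> 0 \<and> (q = \<iota> x / \<iota> y \<or> q = - (\<iota> x / \<iota> y)))"

definition FQ :: "('v::membership \<Rightarrow> 'q::linordered_field) \<Rightarrow> 'q set" where
  "FQ \<iota> = {q. \<exists>x\<in>FN. \<exists>y\<in>FN. \<iota> y \<noteq> 0 \<and> (q = \<iota> x / \<iota> y \<or> q = - (\<iota> x / \<iota> y))}"

definition BQ :: "('v::membership \<Rightarrow> 'q::linordered_field) \<Rightarrow> 'q set" where
  "BQ \<iota> = {x. \<exists>i\<in>FN. \<bar>x\<bar> \<le> \<iota> i}"


section \<open>Cuts\<close>

text \<open>\<open>Q\<langle>q\<rangle>\<close> is \<open>{0..<q}\<close>.\<close>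

definition is_cut :: "'q::linordered_field set \<Rightarrow> bool" where
  "is_cut A \<longleftrightarrow> A \<subseteq> {0..} \<and> (\<forall>x\<in>A. {0..x} \<subseteq> A) \<and> (\<forall>x\<in>A. \<exists>y\<in>A. x < y)"

definition FN_cut :: "('v::membership \<Rightarrow> 'q::linordered_field) \<Rightarrow> 'q set" where
  "FN_cut \<iota> = (\<Union>n\<in>FN. {0..<\<iota> n})"

definition inv_FN_cut :: "('v::membership \<Rightarrow> 'q::linordered_field) \<Rightarrow> 'q set" where
  "inv_FN_cut \<iota> = (\<Inter>n\<in>{n\<in>FN. 0 < \<iota> n}. {0..<1 / \<iota> n})"

definition external_sum :: "'q::linordered_field set \<Rightarrow> 'q set \<Rightarrow> 'q set" where
  "external_sum A B = {x\<in>{0..}. \<forall>a\<in>{0..} - A. \<forall>b\<in>{0..} - B. x < a + b}"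

definition internal_sum :: "'q::linordered_field set \<Rightarrow> 'q set \<Rightarrow> 'q set" where
  "internal_sum A B = {x\<in>{0..}. \<exists>a\<in>A \<inter> {0..}. \<exists>b\<in>B \<inter> {0..}. x < a + b}"

definition additive_cut :: "'q::linordered_field set \<Rightarrow> bool" where
  "additive_cut A \<longleftrightarrow> is_cut A \<and> external_sum A A = A \<and> internal_sum A A = A"

definition internal_diff :: "'q::linordered_field set \<Rightarrow> 'q set \<Rightarrow> 'q set"  (infixl "\<ominus>" 65) where
  "A \<ominus> B = {x\<in>{0..}. \<forall>b \<in> B \<union> {m\<in>{0..} - B. \<forall>y\<in>{0..} - B. m \<le> y}. x + b \<in> A}"

definition cut_doteq :: "('v::membership \<Rightarrow> 'q::linordered_field) \<Rightarrow> 'q set \<Rightarrow> 'q set \<Rightarrow> bool" where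
  "cut_doteq \<iota> A B \<longleftrightarrow> (A \<ominus> B) \<union> (B \<ominus> A) \<subseteq> inv_FN_cut \<iota> \<or> FN_cut \<iota> \<subseteq> A \<inter> B"

definition strictly_subvalent :: "'v::membership \<Rightarrow> 'v \<Rightarrow> bool" where
  "strictly_subvalent n u \<longleftrightarrow> (\<exists>f. set_inj f \<and> dom_v f = elts n \<and> ran_v f \<subset> elts u)"

definition lower_cut :: "('v::membership \<Rightarrow> 'q::linordered_field) \<Rightarrow> 'v set \<Rightarrow> 'q set" where
  "lower_cut \<iota> X =
     {q\<in>{0..}. \<exists>n\<in>NN. \<exists>u. elts u \<subseteq> X \<and> strictly_subvalent n u \<and> q < \<iota> n}"

definition upper_cut :: "('v::membership \<Rightarrow> 'q::linordered_field) \<Rightarrow> 'v set \<Rightarrow> 'q set" where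
  "upper_cut \<iota> X =
     {q\<in>{0..}. \<exists>n\<in>NN. (\<forall>u. X \<subseteq> elts u \<longrightarrow> strictly_subvalent n u) \<and> q < \<iota> n}"

text \<open>\<open>|X| = C\<close>.\<close>

definition has_cut :: "('v::membership \<Rightarrow> 'q::linordered_field) \<Rightarrow> 'v set \<Rightarrow> 'q set \<Rightarrow> bool" where
  "has_cut \<iota> X C \<longleftrightarrow> lower_cut \<iota> X = C \<and> upper_cut \<iota> X = C"


section \<open>Approximating sequences and observability\<close>

text \<open>
  Sequences indexed by \<open>FN\<close> are functions on \<open>'v\<close> of which only the values on \<open>FN\<close> matter.  A
  sequence of cuts of the form \<open>Q\<langle>q\<rangle>\<close> is given by the sequence of the rationals \<open>q\<close>, so that
  ratios are formed in the field \<open>'q\<close>.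
\<close>

definition liminf_cut :: "('v::membership \<Rightarrow> 'q::linordered_field) \<Rightarrow> 'q set" where
  "liminf_cut c = (\<Union>i\<in>FN. \<Inter>j\<in>{j\<in>FN. elts i \<subseteq> elts j}. {0..<c j})"

definition limsup_cut :: "('v::membership \<Rightarrow> 'q::linordered_field) \<Rightarrow> 'q set" where
  "limsup_cut c = (\<Inter>i\<in>FN. \<Union>j\<in>{j\<in>FN. elts i \<subseteq> elts j}. {0..<c j})"

definition approximating_sequence ::
    "('v::membership \<Rightarrow> 'q::linordered_field) \<Rightarrow> ('v \<Rightarrow> 'q) \<Rightarrow> 'v set \<Rightarrow> bool" where
  "approximating_sequence \<iota> s X \<longleftrightarrow> (\<forall>i\<in>FN. s i \<in> \<iota> ` NN) \<and>
     liminf_cut s = lower_cut \<iota> X \<and> limsup_cut s = upper_cut \<iota> X"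

definition BAF :: "('v::membership \<Rightarrow> 'q::linordered_field) \<Rightarrow> ('v set \<Rightarrow> 'v \<Rightarrow> 'q) \<Rightarrow> bool" where
  "BAF \<iota> F \<longleftrightarrow> (\<forall>A\<in>Borel_semisets. approximating_sequence \<iota> (F A) A)"

definition observable ::
    "('v::membership \<Rightarrow> 'q::linordered_field) \<Rightarrow> ('v \<Rightarrow> 'q) \<Rightarrow> ('v set \<Rightarrow> 'v \<Rightarrow> 'q) \<Rightarrow> 'v set set" where
  "observable \<iota> s F = {B\<in>Borel_semisets.
     cut_doteq \<iota> (liminf_cut (\<lambda>i. F B i / s i)) (limsup_cut (\<lambda>i. F B i / s i))}"


section \<open>Reals and the Kalina measure\<close>

definition rat_doteq :: "('v::membership \<Rightarrow> 'q::linordered_field) \<Rightarrow> 'q \<Rightarrow> 'q \<Rightarrow> bool" where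
  "rat_doteq \<iota> p q \<longleftrightarrow>
     (p \<in> BQ \<iota> \<and> q \<in> BQ \<iota> \<and> (\<forall>i\<in>FN. 0 < \<iota> i \<longrightarrow> \<bar>p - q\<bar> < 1 / \<iota> i)) \<or>
     (\<forall>k\<in>FN. \<iota> k < p \<and> \<iota> k < q) \<or>
     (\<forall>k\<in>FN. p < - \<iota> k \<and> q < - \<iota> k)"

definition mon :: "('v::membership \<Rightarrow> 'q::linordered_field) \<Rightarrow> 'q \<Rightarrow> 'q set" where
  "mon \<iota> q = {s. rat_doteq \<iota> s q}"

definition ast_reals :: "('v::membership \<Rightarrow> 'q::linordered_field) \<Rightarrow> 'q set set" where
  "ast_reals \<iota> = mon \<iota> ` BQ \<iota>"

definition ast_infinity :: "('v::membership \<Rightarrow> 'q::linordered_field) \<Rightarrow> 'q set" where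
  "ast_infinity \<iota> = {q. \<forall>i\<in>FN. \<iota> i < q}"

text \<open>The ordering of \<open>R \<union> {\<infinity>}\<close> induced by the ordering of representatives.\<close>

definition mon_le :: "'q::linordered_field set \<Rightarrow> 'q set \<Rightarrow> bool" where
  "mon_le r t \<longleftrightarrow> (\<exists>p\<in>r. \<exists>q\<in>t. p \<le> q)"

text \<open>\<open>lim mon(a\<^sub>i) = mon(x)\<close>.\<close>

definition lim_mon :: "('v::membership \<Rightarrow> 'q::linordered_field) \<Rightarrow> ('v \<Rightarrow> 'q) \<Rightarrow> 'q \<Rightarrow> bool" where
  "lim_mon \<iota> a x \<longleftrightarrow>
     (\<forall>q\<in>FQ \<iota>. q \<noteq> 0 \<longrightarrow> (\<exists>i\<in>FN. \<forall>j\<in>FN. i \<epsilon> j \<longrightarrow> \<bar>a j - x\<bar> < \<bar>q\<bar>)) \<or>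
     ((\<forall>q\<in>FQ \<iota>. q < x) \<and> (\<forall>q\<in>FQ \<iota>. \<exists>i\<in>FN. \<forall>j\<in>FN. i \<epsilon> j \<longrightarrow> q < a j)) \<or>
     ((\<forall>q\<in>FQ \<iota>. x < q) \<and> (\<forall>q\<in>FQ \<iota>. \<exists>i\<in>FN. \<forall>j\<in>FN. i \<epsilon> j \<longrightarrow> a j < q))"

text \<open>Meaningful for \<open>B \<in> observable \<iota> s F\<close>, where the limit exists and is unique.\<close>

definition kalina_measure ::
    "('v::membership \<Rightarrow> 'q::linordered_field) \<Rightarrow> ('v \<Rightarrow> 'q) \<Rightarrow> ('v set \<Rightarrow> 'v \<Rightarrow> 'q) \<Rightarrow> 'v set \<Rightarrow> 'q set"
  where
  "kalina_measure \<iota> s F B = (THE r. \<exists>x. r = mon \<iota> x \<and> lim_mon \<iota> (\<lambda>i. F B i / s i) x)"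

end

theory Submission
  imports Defs "HOL-Library.Nat_Bijection"
begin

text \<open>
  A Borel approximating function chooses the approximating sequences of the Borel semisets
  independently of each other.  As soon as one such function exists, its value at \<open>B\<close> may be
  replaced by any sequence \<open>b\<close> of natural numbers converging to the cut \<open>C = |B|\<close>
  (\<open>ex_BAF_prescribed\<close>).  The sequence \<open>s\<close> converges to the same cut.  An additive cut is closed
  under multiplication by finite numbers, so that \<open>x * s i\<close> still converges to \<open>C\<close> for every finite
  \<open>x\<close> that is not infinitesimal (\<open>converges_scale\<close>); rounding down changes the ratio to \<open>s i\<close> by at
  most \<open>1 / s i\<close>, which is eventually below every positive standard fraction since \<open>C\<close> contains all
  finite numbers.  This realises the finite positive values.  The values \<open>0\<close> and \<open>\<infinity>\<close> are obtained
  by dividing or multiplying \<open>s i\<close> by finite numbers which grow beyond all finite bounds, but so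
  slowly that the limit cut is not disturbed (\<open>converges_divide_slowly\<close>,
  \<open>converges_multiply_slowly\<close>).  Alternating between \<open>s i\<close> and \<open>2 * s i\<close> makes the ratio oscillate
  between \<open>1\<close> and \<open>2\<close>, so that \<open>B\<close> is not observable.

  The harder half is that Borel approximating functions exist at all.  A segment of the natural
  numbers is a limit of a sequence indexed by \<open>FN\<close> only if it is a union or an intersection of
  countably many numbers, and the lower cut of \<open>X\<close> is defined by a quantification over sets, which
  leads out of the Borel classes.  The remedy is to use the countably determined classes, those
  for which membership depends only on the membership in countably many set-theoretically
  definable classes.  Every Borel class is countably determined, and by saturation the projections
  of a countably determined semiset are countably determined, even by the projections of
  countably many sets (\<open>projection_determined\<close>).  For the segments in question these projections
  or their complements in \<open>N\<close> are natural numbers.  So the segment \<open>I\<close> is determined by countably many numbers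
  \<open>g m\<close>.  If \<open>I\<close> were neither the union of the \<open>g m\<close> below it nor the intersection of the \<open>g m\<close> above
  it, there would be a number in \<open>I\<close> and a number outside \<open>I\<close> separated by no \<open>g m\<close>
  (\<open>countable_segmentI\<close>).
\<close>

section \<open>Set-theoretical definability\<close>

text \<open>
  Definability of a condition on assignments.  Proving closure properties of this notion
  avoids writing down formulas; a relation is expressed by a condition on the values
  \<open>e i\<close> of the variables.
\<close>

definition fdef :: "((nat \<Rightarrow> 'v::membership) \<Rightarrow> bool) \<Rightarrow> bool" where
  "fdef P \<longleftrightarrow> (\<exists>p. \<forall>e. sat p e \<longleftrightarrow> P e)"

lemma fdef_eq: "fdef (\<lambda>e. e i = e j)"
  unfolding fdef_def by (rule exI[of _ "FEq i j"]) simp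

lemma fdef_mem: "fdef (\<lambda>e. e i \<epsilon> e j)"
  unfolding fdef_def by (rule exI[of _ "FMem i j"]) simp

lemma fdef_not: "fdef P \<Longrightarrow> fdef (\<lambda>e. \<not> P e)"
  unfolding fdef_def by (metis sat.simps(3))

lemma fdef_conj: "fdef P \<Longrightarrow> fdef Q \<Longrightarrow> fdef (\<lambda>e. P e \<and> Q e)"
  unfolding fdef_def by (metis sat.simps(4))

lemma fdef_disj: "fdef P \<Longrightarrow> fdef Q \<Longrightarrow> fdef (\<lambda>e. P e \<or> Q e)"
  using fdef_not[OF fdef_conj[OF fdef_not fdef_not], of P Q] by simp

lemma fdef_imp: "fdef P \<Longrightarrow> fdef Q \<Longrightarrow> fdef (\<lambda>e. P e \<longrightarrow> Q e)"
  using fdef_disj[OF fdef_not, of P Q] by (simp only: imp_conv_disj)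

lemma fdef_iff: "fdef P \<Longrightarrow> fdef Q \<Longrightarrow> fdef (\<lambda>e. P e \<longleftrightarrow> Q e)"
  using fdef_conj[OF fdef_imp fdef_imp, of P Q Q P] by (simp only: iff_conv_conj_imp)

text \<open>
  The first premise says that the variable \<open>n\<close> is fresh: the condition on the bound element
  does not look at the value \<open>e n\<close>.
\<close>

lemma fdef_all:
  assumes "\<And>e x y. Q (e(n := x)) y = Q e y" and "fdef (\<lambda>e. Q e (e n))"
  shows "fdef (\<lambda>e. \<forall>x. Q e x)"
proof -
  obtain p where "\<And>e. sat p e \<longleftrightarrow> Q e (e n)"
    using assms(2) unfolding fdef_def by blast
  then have "sat (FAll n p) e \<longleftrightarrow> (\<forall>x. Q e x)" for e
    by (simp add: assms(1))
  then show ?thesis unfolding fdef_def by blast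
qed

lemma fdef_ex:
  assumes "\<And>e x y. Q (e(n := x)) y = Q e y" and "fdef (\<lambda>e. Q e (e n))"
  shows "fdef (\<lambda>e. \<exists>x. Q e x)"
  using fdef_not[OF fdef_all[of "\<lambda>e x. \<not> Q e x" n, OF _ fdef_not[OF assms(2)]]] assms(1) by simp

lemmas fdef_prop = fdef_eq fdef_mem fdef_not fdef_conj fdef_disj fdef_imp fdef_iff

text \<open>
  The class variable has index \<open>0\<close>; all other values of \<open>e\<close> are set parameters.
\<close>

lemma set_definable_fdef:
  assumes "fdef P"
  shows "set_definable {x. P (e(0 := x))}"
proof -
  obtain p where "\<And>e. sat p e \<longleftrightarrow> P e" using assms unfolding fdef_def by blast
  then have "{x. P (e(0 := x))} = {x. sat p (e(0 := x))}" by simp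
  then show ?thesis unfolding set_definable_def by blast
qed

lemma set_definable1: "fdef (\<lambda>e. P (e 0) (e 1)) \<Longrightarrow> set_definable {x. P x a}"
  using set_definable_fdef[of "\<lambda>e. P (e 0) (e 1)" "\<lambda>_. a"] by simp

lemma set_definable2: "fdef (\<lambda>e. P (e 0) (e 1) (e 2)) \<Longrightarrow> set_definable {x. P x a b}"
  using set_definable_fdef[of "\<lambda>e. P (e 0) (e 1) (e 2)" "(\<lambda>_. a)(2 := b)"] by simp

lemma set_definable0: "fdef (\<lambda>e. P (e 0)) \<Longrightarrow> set_definable {x. P x}"
  using set_definable_fdef[of "\<lambda>e. P (e 0)"] by simp

lemma set_definable_Compl:
  assumes "set_definable X"
  shows "set_definable (- X)"
proof -
  obtain p e where "X = {x. sat p (e(0 := x))}" using assms unfolding set_definable_def by blast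
  then have "- X = {x. sat (FNot p) (e(0 := x))}" by auto
  then show ?thesis unfolding set_definable_def by blast
qed

section \<open>Sets\<close>

lemma mem_elts: "x \<in> elts a \<longleftrightarrow> x \<epsilon> a"
  by (simp add: elts_def)

lemma elts_inject: "elts a = elts b \<longleftrightarrow> a = (b::'v::ast)"
  by (metis mem_elts set_ext)

lemma is_set_elts: "is_set (elts a)"
  unfolding is_set_def by blast

lemma is_set_Int: "is_set A \<Longrightarrow> set_definable X \<Longrightarrow> is_set (A \<inter> (X::'v::ast set))"
  unfolding is_set_def by (metis separation)

lemma is_set_definable_subset:
  "set_definable X \<Longrightarrow> X \<subseteq> A \<Longrightarrow> is_set A \<Longrightarrow> is_set (X::'v::ast set)"
  by (metis inf.absorb_iff2 is_set_Int)

lemma is_set_empty: "is_set ({}::'v::ast set)"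
proof -
  have "set_definable {x::'v. x \<noteq> x}"
    by (rule set_definable0) (intro fdef_prop)
  from is_set_Int[OF is_set_elts this] show ?thesis by simp
qed

lemma is_set_pair: "is_set {a, b::'v::ast}"
  unfolding is_set_def by (metis pairing)

lemma is_set_Union_elts: "is_set (\<Union>x\<in>elts a. elts (x::'v::ast))"
  unfolding is_set_def by (metis union)

lemma is_set_Un:
  assumes "is_set A" and "is_set (B::'v::ast set)"
  shows "is_set (A \<union> B)"
proof -
  obtain a b where ab: "A = elts a" "B = elts b" using assms is_set_def by metis
  obtain c where "elts c = {a, b}" using pairing by blast
  then show ?thesis using is_set_Union_elts[of c] ab by simp
qed

lemma is_set_insert: "is_set A \<Longrightarrow> is_set (insert (a::'v::ast) A)"
  using is_set_Un[OF is_set_pair[of a a]] by simp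

lemma is_set_finite: "finite A \<Longrightarrow> is_set (A::'v::ast set)"
  by (induction A rule: finite_induct) (auto intro: is_set_empty is_set_insert)

lemma set_definable_elts: "set_definable (elts a)"
proof -
  have "set_definable {x. x \<epsilon> a}" by (rule set_definable1) (intro fdef_prop)
  then show ?thesis by (simp add: elts_def)
qed

lemma set_definable_is_set: "is_set A \<Longrightarrow> set_definable A"
  using set_definable_elts is_set_def by metis

lemma is_set_Diff: "is_set A \<Longrightarrow> is_set B \<Longrightarrow> is_set (A - (B::'v::ast set))"
  unfolding Diff_eq by (intro is_set_Int set_definable_Compl set_definable_is_set)

lemma is_set_Pow: "is_set A \<Longrightarrow> is_set {x::'v::ast. elts x \<subseteq> A}"
  unfolding is_set_def by (metis powerset)

lemma ex_set: "is_set A \<Longrightarrow> \<exists>a. elts a = A"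
  unfolding is_set_def by blast

lemma elts_empty: "elts (empty_v::'v::ast) = {}"
  unfolding empty_v_def by (rule theI') (metis ex_set is_set_empty elts_inject)

lemma elts_upair: "elts (upair x y) = {x, y::'v::ast}"
  unfolding upair_def by (rule theI') (metis ex_set is_set_pair elts_inject)

lemma upair_inject: "upair x y = upair x' y' \<longleftrightarrow> x = x' \<and> y = y' \<or> x = y' \<and> y = (x'::'v::ast)"
  by (simp add: elts_inject[symmetric] elts_upair doubleton_eq_iff)

lemma kpair_inject: "kpair x y = kpair x' y' \<longleftrightarrow> x = x' \<and> y = (y'::'v::ast)"
  unfolding kpair_def upair_inject by auto

lemma fdef_upair: "fdef (\<lambda>e. e i = upair (e j) (e k :: 'v::ast))"
proof -
  have "e i = upair (e j) (e k) \<longleftrightarrow> (\<forall>x. x \<epsilon> e i \<longleftrightarrow> x = e j \<or> x = e k)" for e :: "nat \<Rightarrow> 'v"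
    by (subst elts_inject[symmetric]) (auto simp: elts_upair mem_elts set_eq_iff)
  moreover have "fdef (\<lambda>e::nat \<Rightarrow> 'v. \<forall>x. x \<epsilon> e i \<longleftrightarrow> x = e j \<or> x = e k)"
    by (rule fdef_all[where n = "Suc (i + j + k)"], simp) (intro fdef_prop)
  ultimately show ?thesis by simp
qed

lemma fdef_kpair: "fdef (\<lambda>e. e i = kpair (e j) (e k :: 'v::ast))"
proof -
  have "e i = kpair (e j) (e k) \<longleftrightarrow>
      (\<exists>a b. a = upair (e j) (e j) \<and> b = upair (e j) (e k) \<and> e i = upair a b)"
      for e :: "nat \<Rightarrow> 'v"
    by (simp add: kpair_def)
  moreover have "fdef (\<lambda>e::nat \<Rightarrow> 'v. \<exists>a b. a = upair (e j) (e j) \<and> b = upair (e j) (e k) \<and> e i = upair a b)"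
    by (rule fdef_ex[where n = "Suc (i + j + k)"], simp)
      (rule fdef_ex[where n = "Suc (Suc (i + j + k))"], simp, intro fdef_prop fdef_upair)
  ultimately show ?thesis by simp
qed

lemma fdef_kpair_mem: "fdef (\<lambda>e. kpair (e i) (e j :: 'v::ast) \<epsilon> e k)"
proof -
  have "kpair (e i) (e j) \<epsilon> e k \<longleftrightarrow> (\<exists>z. z = kpair (e i) (e j) \<and> z \<epsilon> e k)"
      for e :: "nat \<Rightarrow> 'v"
    by simp
  moreover have "fdef (\<lambda>e::nat \<Rightarrow> 'v. \<exists>z. z = kpair (e i) (e j) \<and> z \<epsilon> e k)"
    by (rule fdef_ex[where n = "Suc (i + j + k)"], simp) (intro fdef_prop fdef_kpair)
  ultimately show ?thesis by simp
qed

lemma fdef_subset: "fdef (\<lambda>e. elts (e i :: 'v::ast) \<subseteq> elts (e j))"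
proof -
  have "elts (e i) \<subseteq> elts (e j) \<longleftrightarrow> (\<forall>x. x \<epsilon> e i \<longrightarrow> x \<epsilon> e j)" for e :: "nat \<Rightarrow> 'v"
    by (auto simp: mem_elts)
  moreover have "fdef (\<lambda>e::nat \<Rightarrow> 'v. \<forall>x. x \<epsilon> e i \<longrightarrow> x \<epsilon> e j)"
    by (rule fdef_all[where n = "Suc (i + j)"], simp) (intro fdef_prop)
  ultimately show ?thesis by simp
qed

lemma fdef_NN: "fdef (\<lambda>e. (e i :: 'v::ast) \<in> NN)"
proof -
  have "e i \<in> NN \<longleftrightarrow> (\<forall>x. x \<epsilon> e i \<longrightarrow> elts x \<subseteq> elts (e i)) \<and>
      (\<forall>x y. x \<epsilon> e i \<longrightarrow> y \<epsilon> e i \<longrightarrow> x \<epsilon> y \<or> x = y \<or> y \<epsilon> x)" for e :: "nat \<Rightarrow> 'v"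
    unfolding NN_def mem_Collect_eq Ball_def mem_elts by blast
  moreover have "fdef (\<lambda>e::nat \<Rightarrow> 'v. (\<forall>x. x \<epsilon> e i \<longrightarrow> elts x \<subseteq> elts (e i)) \<and>
      (\<forall>x y. x \<epsilon> e i \<longrightarrow> y \<epsilon> e i \<longrightarrow> x \<epsilon> y \<or> x = y \<or> y \<epsilon> x))"
    by (intro fdef_conj, rule fdef_all[where n = "Suc i"], simp, intro fdef_prop fdef_subset,
      rule fdef_all[where n = "Suc i"], simp, rule fdef_all[where n = "Suc (Suc i)"], simp,
      intro fdef_prop)
  ultimately show ?thesis by simp
qed

section \<open>Set relations\<close>

text \<open>
  A relation whose graph, coded by ordered pairs, is a set.  Set functions are handled as such
  relations, so that converse, composition and restriction are those of HOL.
\<close>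

definition irel :: "('v::ast \<times> 'v) set \<Rightarrow> bool" where
  "irel R \<longleftrightarrow> is_set ((\<lambda>(x, y). kpair x y) ` R)"

lemma inj_kpair: "inj (\<lambda>(x, y). kpair x (y::'v::ast))"
  by (auto simp: inj_def kpair_inject)

lemma irel_coded:
  assumes "irel R"
  obtains f where "elts f = (\<lambda>(x, y). kpair x y) ` R" and "\<And>x y. kpair x y \<epsilon> f \<longleftrightarrow> (x, y) \<in> R"
proof -
  obtain f where f: "elts f = (\<lambda>(x, y). kpair x y) ` R"
    using assms ex_set unfolding irel_def by blast
  moreover have "kpair x y \<epsilon> f \<longleftrightarrow> (x, y) \<in> R" for x y
    unfolding mem_elts[symmetric] f by (auto simp: kpair_inject)
  ultimately show ?thesis using that by blast
qed

text \<open>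
  Ordered pairs of elements of \<open>A \<union> B\<close> are elements of the double power set, from which the
  relation is separated.
\<close>

lemma irel_definable:
  assumes "is_set A" and "is_set B" and "R \<subseteq> A \<times> B"
    and "set_definable {z. \<exists>x y. z = kpair x y \<and> (x, y) \<in> R}"
  shows "irel R"
proof -
  have "is_set {z. elts z \<subseteq> {z. elts z \<subseteq> A \<union> B}}"
    using assms by (intro is_set_Pow is_set_Un)
  moreover have "{z. \<exists>x y. z = kpair x y \<and> (x, y) \<in> R} \<subseteq> {z. elts z \<subseteq> {z. elts z \<subseteq> A \<union> B}}"
    by (auto simp: kpair_def elts_upair dest!: subsetD[OF assms(3)])
  moreover have "(\<lambda>(x, y). kpair x y) ` R = {z. \<exists>x y. z = kpair x y \<and> (x, y) \<in> R}"
    by auto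
  ultimately show ?thesis
    unfolding irel_def using is_set_definable_subset[OF assms(4)] by metis
qed

lemma set_definable_kpair_class:
  assumes "fdef (\<lambda>e. Q (e 0) (e 1) (e 2) (e 3))"
  shows "set_definable {z::'v::ast. \<exists>x y. z = kpair x y \<and> Q x y a b}"
proof -
  let ?P = "\<lambda>e :: nat \<Rightarrow> 'v. \<exists>z. z = e 0 \<and> (\<exists>x y. z = kpair x y \<and> Q x y (e 2) (e 3))"
  have *: "fdef (\<lambda>e. \<exists>x y. e 4 = kpair x y \<and> Q x y (e 2) (e 3))"
    by (rule fdef_ex[where n = 0], simp, rule fdef_ex[where n = 1], simp)
      (intro fdef_conj fdef_kpair assms)
  \<comment> \<open>the class variable \<open>0\<close> is copied to \<open>4\<close>, since \<open>Q\<close> needs the variables \<open>0\<close> and \<open>1\<close>\<close>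
  have "fdef ?P"
    by (rule fdef_ex[where n = 4], simp, rule fdef_conj[OF fdef_eq *])
  from set_definable_fdef[OF this, of "(\<lambda>_. a)(3 := b)"] show ?thesis by simp
qed

lemma irel_Field: "irel R \<Longrightarrow> is_set (Field R)"
proof -
  assume "irel R"
  then obtain f where f: "elts f = (\<lambda>(x, y). kpair x y) ` R" by (rule irel_coded)
  obtain g where g: "elts g = (\<Union>x\<in>elts f. elts x)" using union by blast
  have "(\<Union>x\<in>elts g. elts x) = Field R"
    unfolding g f by (force simp: kpair_def elts_upair Field_def)
  with is_set_Union_elts[of g] show ?thesis by simp
qed

lemma irel_converse: "irel R \<Longrightarrow> irel (R\<inverse>)"
proof -
  assume R: "irel R"
  then obtain f where f: "\<And>x y. kpair x y \<epsilon> f \<longleftrightarrow> (x, y) \<in> R" using irel_coded by metis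
  have "set_definable {z. \<exists>x y. z = kpair x y \<and> kpair y x \<epsilon> f}"
    by (rule set_definable_kpair_class[of "\<lambda>x y f _. kpair y x \<epsilon> f"]) (rule fdef_kpair_mem)
  then show ?thesis
    by (intro irel_definable[OF irel_Field[OF R] irel_Field[OF R]]) (auto simp: f Field_def)
qed

lemma irel_comp: "irel R \<Longrightarrow> irel S \<Longrightarrow> irel (R O S)"
proof -
  assume R: "irel R" and S: "irel S"
  obtain f where f: "\<And>x y. kpair x y \<epsilon> f \<longleftrightarrow> (x, y) \<in> R" using R irel_coded by metis
  obtain g where g: "\<And>x y. kpair x y \<epsilon> g \<longleftrightarrow> (x, y) \<in> S" using S irel_coded by metis
  have "set_definable {z. \<exists>x y. z = kpair x y \<and> (\<exists>w. kpair x w \<epsilon> f \<and> kpair w y \<epsilon> g)}"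
    by (rule set_definable_kpair_class[of "\<lambda>x y f g. \<exists>w. kpair x w \<epsilon> f \<and> kpair w y \<epsilon> g"])
      (rule fdef_ex[where n = 4], simp, intro fdef_prop fdef_kpair_mem)
  then show ?thesis
    by (intro irel_definable[OF irel_Field[OF R] irel_Field[OF S]])
      (auto simp: f g Field_def relcomp_unfold)
qed

lemma irel_Times: "is_set A \<Longrightarrow> is_set B \<Longrightarrow> irel (A \<times> B)"
proof -
  assume A: "is_set A" and B: "is_set B"
  obtain a b where ab: "A = elts a" "B = elts b" using A B is_set_def by metis
  have "set_definable {z. \<exists>x y. z = kpair x y \<and> (x \<epsilon> a \<and> y \<epsilon> b)}"
    by (rule set_definable_kpair_class[of "\<lambda>x y a b. x \<epsilon> a \<and> y \<epsilon> b"]) (intro fdef_prop)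
  then show ?thesis
    by (intro irel_definable[OF A B]) (auto simp: ab mem_elts)
qed

lemma irel_Id_on: "is_set A \<Longrightarrow> irel (Id_on A)"
proof -
  assume A: "is_set A"
  obtain a where a: "A = elts a" using A is_set_def by metis
  have "set_definable {z. \<exists>x y. z = kpair x y \<and> (x \<epsilon> a \<and> x = y)}"
    by (rule set_definable_kpair_class[of "\<lambda>x y a b. x \<epsilon> a \<and> x = y"]) (intro fdef_prop)
  then show ?thesis
    by (intro irel_definable[OF A A]) (auto simp: a mem_elts Id_on_def cong: conj_cong)
qed

lemma irel_Un: "irel R \<Longrightarrow> irel S \<Longrightarrow> irel (R \<union> S)"
  unfolding irel_def image_Un by (rule is_set_Un)

lemma irel_finite: "finite R \<Longrightarrow> irel R"
  unfolding irel_def by (intro is_set_finite finite_imageI)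

lemma irel_insert: "irel R \<Longrightarrow> irel (insert p R)"
  using irel_Un[OF irel_finite[of "{p}"]] by simp

lemma irel_Diff: "irel R \<Longrightarrow> irel S \<Longrightarrow> irel (R - S)"
  unfolding irel_def image_set_diff[OF inj_kpair] by (rule is_set_Diff)

lemma irel_restrict: "irel R \<Longrightarrow> is_set A \<Longrightarrow> irel (R \<inter> A \<times> UNIV)"
proof -
  assume "irel R" "is_set A"
  then have "irel (Id_on A O R)" by (intro irel_comp irel_Id_on)
  moreover have "Id_on A O R = R \<inter> A \<times> UNIV" by auto
  ultimately show ?thesis by simp
qed

section \<open>Natural numbers\<close>

lemma mem_irrefl: "\<not> x \<epsilon> (x::'v::ast)"
proof
  assume x: "x \<epsilon> x"
  have "elts (upair x x) \<noteq> {}" by (simp add: elts_upair)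
  from foundation[OF this] show False using x by (auto simp: elts_upair mem_elts)
qed

lemma mem_asym: "x \<epsilon> y \<Longrightarrow> \<not> y \<epsilon> (x::'v::ast)"
proof
  assume xy: "x \<epsilon> y" "y \<epsilon> x"
  have "elts (upair x y) \<noteq> {}" by (simp add: elts_upair)
  from foundation[OF this] show False using xy by (auto simp: elts_upair mem_elts)
qed

lemma mem_no_3_cycle: "x \<epsilon> y \<Longrightarrow> y \<epsilon> z \<Longrightarrow> \<not> z \<epsilon> (x::'v::ast)"
proof
  assume xyz: "x \<epsilon> y" "y \<epsilon> z" "z \<epsilon> x"
  have "is_set {x, y, z}" by (rule is_set_finite) simp
  then obtain a where a: "elts a = {x, y, z}" using ex_set by blast
  then have "elts a \<noteq> {}" by simp
  from foundation[OF this] show False using xyz a by (auto simp: mem_elts)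
qed

lemma NN_trans: "n \<in> NN \<Longrightarrow> m \<epsilon> n \<Longrightarrow> k \<epsilon> m \<Longrightarrow> k \<epsilon> n"
  unfolding NN_def mem_Collect_eq Ball_def subset_iff mem_elts by blast

lemma NN_total: "n \<in> NN \<Longrightarrow> x \<epsilon> n \<Longrightarrow> y \<epsilon> n \<Longrightarrow> x \<epsilon> y \<or> x = y \<or> y \<epsilon> x"
  unfolding NN_def mem_Collect_eq Ball_def subset_iff mem_elts by blast

lemma NN_I:
  assumes "\<And>x y. x \<epsilon> n \<Longrightarrow> y \<epsilon> x \<Longrightarrow> y \<epsilon> n"
    and "\<And>x y. x \<epsilon> n \<Longrightarrow> y \<epsilon> n \<Longrightarrow> x \<epsilon> y \<or> x = y \<or> y \<epsilon> x"
  shows "n \<in> NN"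
  using assms unfolding NN_def mem_Collect_eq Ball_def subset_iff mem_elts by blast

lemma NN_mem: "(n::'v::ast) \<in> NN \<Longrightarrow> x \<epsilon> n \<Longrightarrow> x \<in> NN"
proof (rule NN_I)
  assume n: "n \<in> NN" and x: "x \<epsilon> n"
  show "z \<epsilon> x" if "y \<epsilon> x" "z \<epsilon> y" for y z
    using NN_total[OF n x] NN_trans[OF n] that x mem_asym mem_no_3_cycle by metis
  show "y \<epsilon> z \<or> y = z \<or> z \<epsilon> y" if "y \<epsilon> x" "z \<epsilon> x" for y z
    using NN_total[OF n] NN_trans[OF n] that x by metis
qed

text \<open>
  The least element of \<open>n - m\<close> has exactly the elements of \<open>m\<close>.
\<close>

lemma NN_psubset_mem:
  assumes m: "(m::'v::ast) \<in> NN" and n: "n \<in> NN" and sub: "elts m \<subseteq> elts n" "m \<noteq> n"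
  shows "m \<epsilon> n"
proof -
  have "is_set (elts n - elts m)" by (intro is_set_Diff is_set_elts)
  then obtain d where d: "elts d = elts n - elts m" using ex_set by blast
  have "elts d \<noteq> {}" using sub d by (metis elts_inject Diff_eq_empty_iff subset_antisym)
  then obtain x where x: "x \<in> elts d" "elts x \<inter> elts d = {}" using foundation by blast
  have xn: "x \<epsilon> n" "\<not> x \<epsilon> m" using x d by (auto simp: mem_elts)
  have "elts x \<subseteq> elts m"
    using x(2) d NN_trans[OF n xn(1)] by (auto simp: mem_elts set_eq_iff)
  moreover have "elts m \<subseteq> elts x"
    using NN_total[OF n xn(1)] NN_trans[OF m] sub(1) xn(2) by (force simp: mem_elts)
  ultimately have "m = x" by (metis elts_inject subset_antisym)
  then show ?thesis using xn by simp
qed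

text \<open>
  The intersection of \<open>m\<close> and \<open>n\<close> is a natural number.  If it differed from both, it would be an
  element of both and hence of itself.
\<close>

lemma NN_linear: "(m::'v::ast) \<in> NN \<Longrightarrow> n \<in> NN \<Longrightarrow> m \<epsilon> n \<or> m = n \<or> n \<epsilon> m"
proof -
  assume m: "m \<in> NN" and n: "n \<in> NN"
  have "is_set (elts m \<inter> elts n)" by (intro is_set_Int is_set_elts set_definable_elts)
  then obtain k where "elts k = elts m \<inter> elts n" using ex_set by blast
  then have k: "x \<epsilon> k \<longleftrightarrow> x \<epsilon> m \<and> x \<epsilon> n" for x by (auto simp: mem_elts set_eq_iff)
  have kN: "k \<in> NN"
    by (rule NN_I) (use NN_trans[OF m] NN_trans[OF n] NN_total[OF m] k in blast)+
  have "k = m \<or> k \<epsilon> m" "k = n \<or> k \<epsilon> n"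
    using NN_psubset_mem[OF kN] m n k by (auto simp: mem_elts subset_iff)
  then show ?thesis using k mem_irrefl by metis
qed

lemma NN_subset_iff:
  "(m::'v::ast) \<in> NN \<Longrightarrow> n \<in> NN \<Longrightarrow> elts m \<subseteq> elts n \<longleftrightarrow> m = n \<or> m \<epsilon> n"
  using NN_psubset_mem NN_trans by (auto simp: mem_elts subset_iff)

lemma NN_not_mem: "(m::'v::ast) \<in> NN \<Longrightarrow> n \<in> NN \<Longrightarrow> \<not> m \<epsilon> n \<longleftrightarrow> elts n \<subseteq> elts m"
  using NN_linear[of m n] NN_subset_iff[of n m] mem_asym mem_irrefl by metis

lemma NN_least:
  assumes P: "set_definable {x. P x}" and n: "(n::'v::ast) \<in> NN" "P n"
  obtains m where "m \<in> NN" "P m" "\<And>k. k \<epsilon> m \<Longrightarrow> \<not> P k"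
proof -
  have "is_set (insert n (elts n) \<inter> {x. P x})"
    by (intro is_set_Int is_set_insert is_set_elts P)
  then obtain d where d: "elts d = insert n (elts n) \<inter> {x. P x}" using ex_set by blast
  then have "elts d \<noteq> {}" using n by blast
  then obtain m where m: "m \<in> elts d" "elts m \<inter> elts d = {}" using foundation by blast
  show ?thesis
  proof (rule that)
    show "m \<in> NN" "P m" using m d n NN_mem by (auto simp: mem_elts)
    show "\<not> P k" if "k \<epsilon> m" for k
      using that m d NN_trans[OF n(1)] by (auto simp: mem_elts set_eq_iff)
  qed
qed

definition succ :: "'v::ast \<Rightarrow> 'v" where
  "succ n = (THE m. elts m = insert n (elts n))"

lemma elts_succ: "elts (succ n) = insert n (elts n)"
  unfolding succ_def by (rule theI') (metis ex_set is_set_insert is_set_elts elts_inject)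

lemma mem_succ: "x \<epsilon> succ n \<longleftrightarrow> x = n \<or> x \<epsilon> n"
  unfolding mem_elts[symmetric] elts_succ by simp

lemma not_mem_empty: "\<not> x \<epsilon> (empty_v::'v::ast)"
  unfolding mem_elts[symmetric] elts_empty by simp

lemma empty_NN: "(empty_v::'v::ast) \<in> NN"
  by (rule NN_I) (simp_all add: not_mem_empty)

lemma succ_NN: "n \<in> NN \<Longrightarrow> succ n \<in> NN"
  by (rule NN_I; unfold mem_succ; use NN_trans NN_total in blast)

text \<open>
  A nonzero limit number would be an inductive set, contrary to the negated axiom of infinity.
\<close>

lemma NN_cases:
  assumes n: "(n::'v::ast) \<in> NN"
  obtains "n = empty_v" | m where "m \<in> NN" "n = succ m"
proof (rule ccontr)
  assume *: "\<not> thesis"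
  have "succ x \<epsilon> n" if "x \<epsilon> n" for x
    using NN_linear[OF succ_NN[OF NN_mem[OF n that]] n] * that NN_mem[OF n that] mem_asym[OF that]
      mem_irrefl that(1) mem_succ \<open>\<And>m. \<lbrakk>m \<in> NN; n = succ m\<rbrakk> \<Longrightarrow> thesis\<close> by metis
  moreover have "empty_v \<epsilon> n"
    using NN_linear[OF empty_NN n] * not_mem_empty that(1) by metis
  ultimately show False
    using no_infinite_set elts_empty elts_succ mem_elts by metis
qed

section \<open>Set injections\<close>

definition injr :: "('v::ast \<times> 'v) set \<Rightarrow> bool" where
  "injr R \<longleftrightarrow> irel R \<and> single_valued R \<and> single_valued (R\<inverse>)"

text \<open>
  The condition \<open>\<Phi>\<close> on domain and range is left open in order to cover both equinumerosity and
  strict subvalence.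
\<close>

lemma ex_set_inj:
  "(\<exists>f::'v::ast. set_inj f \<and> \<Phi> (dom_v f) (ran_v f)) \<longleftrightarrow>
   (\<exists>R::('v \<times> 'v) set. injr R \<and> \<Phi> (Domain R) (Range R))"
proof (intro iffI; elim exE conjE)
  fix f :: 'v assume f: "set_inj f" "\<Phi> (dom_v f) (ran_v f)"
  let ?R = "{(x, y). kpair x y \<epsilon> f}"
  have "(\<lambda>(x, y). kpair x y) ` ?R = elts f"
    using f(1) unfolding set_inj_def set_fun_def by (force simp: mem_elts)
  then have "irel ?R" unfolding irel_def using is_set_elts by metis
  moreover have "single_valued ?R" "single_valued (?R\<inverse>)"
    using f(1) unfolding set_inj_def set_fun_def single_valued_def by blast+
  ultimately have "injr ?R" unfolding injr_def by blast
  moreover have "Domain ?R = dom_v f" "Range ?R = ran_v f"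
    by (auto simp: dom_v_def ran_v_def)
  ultimately show "\<exists>R::('v \<times> 'v) set. injr R \<and> \<Phi> (Domain R) (Range R)" using f(2) by metis
next
  fix R :: "('v \<times> 'v) set" assume R: "injr R" "\<Phi> (Domain R) (Range R)"
  then obtain f where f: "elts f = (\<lambda>(x, y). kpair x y) ` R"
    and m: "\<And>x y. kpair x y \<epsilon> f \<longleftrightarrow> (x, y) \<in> R"
    unfolding injr_def using irel_coded by metis
  have "set_inj f"
    using R(1) unfolding injr_def set_inj_def set_fun_def single_valued_def m f
    by (intro conjI) (force, blast, blast)
  moreover have "Domain R = dom_v f" "Range R = ran_v f"
    by (auto simp: dom_v_def ran_v_def m)
  ultimately show "\<exists>f::'v. set_inj f \<and> \<Phi> (dom_v f) (ran_v f)" using R(2) by metis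
qed

lemma set_equinumerous_iff:
  "set_equinumerous A B \<longleftrightarrow> (\<exists>R::('v::ast \<times> 'v) set. injr R \<and> Domain R = A \<and> Range R = B)"
  unfolding set_equinumerous_def using ex_set_inj[of "\<lambda>X Y. X = A \<and> Y = B"] by simp

lemma strictly_subvalent_iff:
  "strictly_subvalent n u \<longleftrightarrow> (\<exists>R::('v::ast \<times> 'v) set. injr R \<and> Domain R = elts n \<and> Range R \<subset> elts u)"
  unfolding strictly_subvalent_def using ex_set_inj[of "\<lambda>X Y. X = elts n \<and> Y \<subset> elts u"] by simp

lemma injr_comp: "injr R \<Longrightarrow> injr S \<Longrightarrow> injr (R O S)"
  unfolding injr_def converse_relcomp by (simp add: irel_comp single_valued_relcomp)

lemma injr_converse: "injr R \<Longrightarrow> injr (R\<inverse>)"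
  unfolding injr_def by (simp add: irel_converse)

lemma injr_restrict: "injr R \<Longrightarrow> is_set A \<Longrightarrow> injr (R \<inter> A \<times> UNIV)"
  unfolding injr_def single_valued_def by (simp add: irel_restrict) blast

lemma injr_insert: "injr R \<Longrightarrow> a \<notin> Domain R \<Longrightarrow> b \<notin> Range R \<Longrightarrow> injr (insert (a, b) R)"
  unfolding injr_def single_valued_def by (simp add: irel_insert) blast

lemma injr_Diff_finite: "injr R \<Longrightarrow> finite S \<Longrightarrow> injr (R - S)"
  unfolding injr_def single_valued_def by (simp add: irel_Diff irel_finite) blast

lemma set_equinumerous_refl: "is_set A \<Longrightarrow> set_equinumerous A (A::'v::ast set)"
  unfolding set_equinumerous_iff injr_def
  by (intro exI[of _ "Id_on A"]) (auto simp: irel_Id_on single_valued_def)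

lemma set_equinumerous_sym: "set_equinumerous A B \<Longrightarrow> set_equinumerous B (A::'v::ast set)"
  unfolding set_equinumerous_iff using injr_converse by (metis Domain_converse Range_converse)

lemma set_equinumerous_trans:
  assumes "set_equinumerous A B" and "set_equinumerous B (C::'v::ast set)"
  shows "set_equinumerous A C"
proof -
  obtain R S where R: "injr R" "Domain R = A" "Range R = B"
    and S: "injr S" "Domain S = B" "Range S = C"
    using assms unfolding set_equinumerous_iff by blast
  have "Domain (R O S) = A" "Range (R O S) = C" using R S by blast+
  then show ?thesis unfolding set_equinumerous_iff using injr_comp R S by blast
qed

lemma strictly_subvalent_mono:
  assumes "strictly_subvalent n u" and "elts m \<subseteq> elts n" and "elts u \<subseteq> elts (v::'v::ast)"
  shows "strictly_subvalent m v"
proof -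
  obtain R where R: "injr R" "Domain R = elts n" "Range R \<subset> elts u"
    using assms unfolding strictly_subvalent_iff by blast
  have "injr (R \<inter> elts m \<times> UNIV)" by (rule injr_restrict[OF R(1) is_set_elts])
  moreover have "Domain (R \<inter> elts m \<times> UNIV) = elts m" using R assms by blast
  moreover have "Range (R \<inter> elts m \<times> UNIV) \<subset> elts v" using R assms by blast
  ultimately show ?thesis unfolding strictly_subvalent_iff by blast
qed

lemma fdef_set_inj: "fdef (\<lambda>e. set_inj (e i :: 'v::ast))"
proof -
  have "set_inj (e i) \<longleftrightarrow> (\<forall>z. z \<epsilon> e i \<longrightarrow> (\<exists>x y. z = kpair x y)) \<and>
      (\<forall>x y y'. kpair x y \<epsilon> e i \<and> kpair x y' \<epsilon> e i \<longrightarrow> y = y') \<and>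
      (\<forall>x y y'. kpair y x \<epsilon> e i \<and> kpair y' x \<epsilon> e i \<longrightarrow> y = y')" for e :: "nat \<Rightarrow> 'v"
    unfolding set_inj_def set_fun_def mem_elts Ball_def by blast
  moreover have "fdef (\<lambda>e::nat \<Rightarrow> 'v. (\<forall>z. z \<epsilon> e i \<longrightarrow> (\<exists>x y. z = kpair x y)))"
    by (rule fdef_all[where n = "Suc i"], simp, intro fdef_prop)
      (rule fdef_ex[where n = "i+2"], simp, rule fdef_ex[where n = "i+3"], simp, rule fdef_kpair)
  moreover have "fdef (\<lambda>e::nat \<Rightarrow> 'v. \<forall>x y y'. kpair x y \<epsilon> e i \<and> kpair x y' \<epsilon> e i \<longrightarrow> y = y')"
    by (rule fdef_all[where n = "Suc i"], simp, rule fdef_all[where n = "i+2"], simp,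
       rule fdef_all[where n = "i+3"], simp) (intro fdef_prop fdef_kpair_mem)
  moreover have "fdef (\<lambda>e::nat \<Rightarrow> 'v. \<forall>x y y'. kpair y x \<epsilon> e i \<and> kpair y' x \<epsilon> e i \<longrightarrow> y = y')"
    by (rule fdef_all[where n = "Suc i"], simp, rule fdef_all[where n = "i+2"], simp,
       rule fdef_all[where n = "i+3"], simp) (intro fdef_prop fdef_kpair_mem)
  ultimately show ?thesis by (simp add: fdef_conj)
qed

lemma fdef_dom: "fdef (\<lambda>e. dom_v (e i :: 'v::ast) = elts (e j))"
proof -
  have "dom_v (e i) = elts (e j) \<longleftrightarrow> (\<forall>x. (\<exists>y. kpair x y \<epsilon> e i) \<longleftrightarrow> x \<epsilon> e j)" for e :: "nat \<Rightarrow> 'v"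
    by (auto simp: dom_v_def mem_elts set_eq_iff)
  moreover have "fdef (\<lambda>e::nat \<Rightarrow> 'v. \<forall>x. (\<exists>y. kpair x y \<epsilon> e i) \<longleftrightarrow> x \<epsilon> e j)"
    by (rule fdef_all[where n = "Suc (i+j)"], simp, intro fdef_prop)
      (rule fdef_ex[where n = "Suc (Suc (i+j))"], simp, rule fdef_kpair_mem)
  ultimately show ?thesis by simp
qed

lemma fdef_mem_ran: "fdef (\<lambda>e. e j \<in> ran_v (e i :: 'v::ast))"
  unfolding ran_v_def mem_Collect_eq
  by (rule fdef_ex[where n = "Suc (i+j)"], simp, rule fdef_kpair_mem)

lemma fdef_ran: "fdef (\<lambda>e. ran_v (e i :: 'v::ast) = elts (e j))"
proof -
  have "ran_v (e i) = elts (e j) \<longleftrightarrow> (\<forall>y. y \<in> ran_v (e i) \<longleftrightarrow> y \<epsilon> e j)" for e :: "nat \<Rightarrow> 'v"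
    by (auto simp: mem_elts set_eq_iff)
  moreover have "fdef (\<lambda>e::nat \<Rightarrow> 'v. \<forall>y. y \<in> ran_v (e i) \<longleftrightarrow> y \<epsilon> e j)"
    by (rule fdef_all[where n = "Suc (i+j)"], simp, intro fdef_prop fdef_mem_ran)
  ultimately show ?thesis by simp
qed

lemma fdef_ran_psubset: "fdef (\<lambda>e. ran_v (e i :: 'v::ast) \<subset> elts (e j))"
proof -
  have "ran_v (e i) \<subset> elts (e j) \<longleftrightarrow> (\<forall>y. y \<in> ran_v (e i) \<longrightarrow> y \<epsilon> e j) \<and> \<not> ran_v (e i) = elts (e j)"
    for e :: "nat \<Rightarrow> 'v"
    by (auto simp: mem_elts set_eq_iff)
  moreover have "fdef (\<lambda>e::nat \<Rightarrow> 'v. \<forall>y. y \<in> ran_v (e i) \<longrightarrow> y \<epsilon> e j)"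
    by (rule fdef_all[where n = "Suc (i+j)"], simp, intro fdef_prop fdef_mem_ran)
  ultimately show ?thesis by (simp add: fdef_conj fdef_not fdef_ran)
qed

lemma fdef_strictly_subvalent: "fdef (\<lambda>e. strictly_subvalent (e i) (e j :: 'v::ast))"
  unfolding strictly_subvalent_def
  by (rule fdef_ex[where n = "Suc (i+j)"], simp)
    (intro fdef_conj fdef_set_inj fdef_dom fdef_ran_psubset)

lemma fdef_set_equinumerous: "fdef (\<lambda>e. set_equinumerous (elts (e i)) (elts (e j :: 'v::ast)))"
  unfolding set_equinumerous_def
  by (rule fdef_ex[where n = "Suc (i+j)"], simp)
    (intro fdef_conj fdef_set_inj fdef_dom fdef_ran)

text \<open>
  Every set is Dedekind finite.  In the step of the set induction, an injection of
  \<open>insert y x\<close> into a proper part is turned into one for \<open>x\<close>: the value at \<open>y\<close> is dropped, and the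
  element \<open>u\<close> that was mapped to \<open>y\<close>, if there is any, is mapped to the value at \<open>y\<close> instead.
\<close>

lemma not_strictly_subvalent_self: "\<not> strictly_subvalent a (a::'v::ast)"
proof -
  have "a \<in> {a. \<not> strictly_subvalent a a}"
  proof (rule set_induction)
    show "set_definable {a::'v. \<not> strictly_subvalent a a}"
      by (rule set_definable0) (intro fdef_not fdef_strictly_subvalent)
    show "z \<in> {a. \<not> strictly_subvalent a a}" if "elts z = {}" for z :: 'v
      using that by (simp add: strictly_subvalent_iff)
    fix x y z :: 'v
    assume x: "x \<in> {a. \<not> strictly_subvalent a a}" and z: "elts z = insert y (elts x)"
    show "z \<in> {a. \<not> strictly_subvalent a a}"
    proof (cases "y \<in> elts x")
      case True
      then have "z = x" using z elts_inject insert_absorb by metis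
      then show ?thesis using x by simp
    next
      case False
      have no: "\<not> (injr R \<and> Domain R = elts x \<and> Range R \<subset> elts x)" for R
        using x by (auto simp: strictly_subvalent_iff)
      have False if R: "injr R" "Domain R = insert y (elts x)" "Range R \<subset> insert y (elts x)" for R
      proof -
        have sv: "\<And>a b c. (a, b) \<in> R \<Longrightarrow> (a, c) \<in> R \<Longrightarrow> b = c"
          "\<And>a b c. (b, a) \<in> R \<Longrightarrow> (c, a) \<in> R \<Longrightarrow> b = c"
          using R(1) unfolding injr_def single_valued_def by auto
        obtain v where v: "(y, v) \<in> R" using R(2) by blast
        obtain w where w: "w \<in> insert y (elts x)" "w \<notin> Range R" using R(3) by blast
        let ?R = "R \<inter> elts x \<times> UNIV"
        have inj: "injr ?R" by (rule injr_restrict[OF R(1) is_set_elts])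
        have dom: "Domain ?R = elts x" using R(2) by blast
        show False
        proof (cases "y \<in> Range R")
          case y: False
          have "v \<in> elts x" "v \<notin> Range ?R" using v y R(3) sv(2) False by blast+
          moreover have "Range ?R \<subseteq> elts x" using R(3) y by blast
          ultimately show False using no[of ?R] inj dom by blast
        next
          case True
          then obtain u where u: "(u, y) \<in> R" by blast
          have wx: "w \<in> elts x" "w \<noteq> v" using w True v by blast+
          show False
          proof (cases "u = y")
            case uy: True
            have "Range ?R \<subseteq> elts x" using R(3) sv(2) u uy False by blast
            moreover have "w \<notin> Range ?R" using w by blast
            ultimately show False using no[of ?R] inj dom wx by blast
          next
            case uy: False
            let ?S = "R - {(u, y), (y, v)}"
            have nd: "u \<notin> Domain ?S" "v \<notin> Range ?S" using sv u v uy by blast+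
            have "injr (insert (u, v) ?S)"
              using nd by (intro injr_insert injr_Diff_finite R(1)) simp_all
            moreover have "Domain (insert (u, v) ?S) = elts x"
            proof -
              have D: "a = y \<or> a \<in> elts x" if "(a, b) \<in> R" for a b using that R(2) by blast
              have "Domain ?S = elts x - {u}"
              proof (intro equalityI subsetI)
                show "a \<in> elts x - {u}" if "a \<in> Domain ?S" for a
                  using that D sv(1)[OF u] sv(1)[OF v] by blast
                show "a \<in> Domain ?S" if "a \<in> elts x - {u}" for a
                  using that R(2) False by blast
              qed
              moreover have "u \<in> elts x" using u R(2) uy by blast
              ultimately show ?thesis by auto
            qed
            moreover have "Range (insert (u, v) ?S) \<subseteq> elts x"
            proof -
              have "v \<noteq> y" using sv(2)[OF u] v uy by blast
              moreover have "y \<notin> Range ?S" using sv(2)[OF u] by blast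
              ultimately show ?thesis using R(3) v by auto
            qed
            moreover have "w \<notin> Range (insert (u, v) ?S)" using wx w by blast
            ultimately show False
              using no[of "insert (u, v) ?S"] wx(1) by (metis psubsetI)
          qed
        qed
      qed
      then show ?thesis unfolding mem_Collect_eq strictly_subvalent_iff z by blast
    qed
  qed
  then show ?thesis by simp
qed

lemma ex_NN_equinumerous: "\<exists>n\<in>NN. set_equinumerous (elts n) (elts (a::'v::ast))"
proof -
  have "a \<in> {a. \<exists>n. n \<in> NN \<and> set_equinumerous (elts n) (elts a)}"
  proof (rule set_induction)
    show "set_definable {a::'v. \<exists>n. n \<in> NN \<and> set_equinumerous (elts n) (elts a)}"
      by (rule set_definable0, rule fdef_ex[where n = 1], simp)
        (intro fdef_conj fdef_NN fdef_set_equinumerous)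
    show "z \<in> {a. \<exists>n. n \<in> NN \<and> set_equinumerous (elts n) (elts a)}" if "elts z = {}" for z :: 'v
      using that empty_NN set_equinumerous_refl[OF is_set_elts] elts_empty
      by (metis (no_types, lifting) mem_Collect_eq)
    fix x y z :: 'v
    assume x: "x \<in> {a. \<exists>n. n \<in> NN \<and> set_equinumerous (elts n) (elts a)}"
      and z: "elts z = insert y (elts x)"
    show "z \<in> {a. \<exists>n. n \<in> NN \<and> set_equinumerous (elts n) (elts a)}"
    proof (cases "y \<in> elts x")
      case True
      then have "z = x" using z elts_inject insert_absorb by metis
      then show ?thesis using x by simp
    next
      case False
      obtain n R where n: "n \<in> NN" and R: "injr R" "Domain R = elts n" "Range R = elts x"
        using x by (auto simp: set_equinumerous_iff)
      have "injr (insert (n, y) R)"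
        using R False mem_irrefl[of n] by (intro injr_insert) (auto simp: mem_elts)
      moreover have "Domain (insert (n, y) R) = elts (succ n)" "Range (insert (n, y) R) = elts z"
        using R z by (auto simp: elts_succ)
      ultimately show ?thesis
        using succ_NN[OF n] unfolding mem_Collect_eq set_equinumerous_iff by blast
    qed
  qed
  then show ?thesis by auto
qed

lemma equinumerous_not_strictly_subvalent:
  assumes "set_equinumerous (elts n) (elts (a::'v::ast))"
  shows "\<not> strictly_subvalent n a"
proof
  assume "strictly_subvalent n a"
  then obtain R where R: "injr R" "Domain R = elts n" "Range R \<subset> elts a"
    unfolding strictly_subvalent_iff by blast
  obtain S where S: "injr S" "Domain S = elts n" "Range S = elts a"
    using assms unfolding set_equinumerous_iff by blast
  have "single_valued (S\<inverse>)" "single_valued S" using S unfolding injr_def by simp_all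
  then have sv: "\<And>a b c. (b, a) \<in> S \<Longrightarrow> (c, a) \<in> S \<Longrightarrow> b = c"
      "\<And>a b c. (a, b) \<in> S \<Longrightarrow> (a, c) \<in> S \<Longrightarrow> b = c"
    unfolding single_valued_def by auto
  obtain w where w: "w \<in> elts a" "w \<notin> Range R" using R by blast
  then obtain u where u: "(u, w) \<in> S" using S by blast
  have "injr (R O S\<inverse>)" by (intro injr_comp injr_converse R S)
  moreover have "Domain (R O S\<inverse>) = elts n" using R S by blast
  moreover have "Range (R O S\<inverse>) \<subseteq> elts n" using S by blast
  moreover have "u \<in> elts n" "u \<notin> Range (R O S\<inverse>)" using u S w sv by blast+
  ultimately have "strictly_subvalent n n" unfolding strictly_subvalent_iff by blast
  then show False using not_strictly_subvalent_self by blast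
qed

lemma NN_equinumerous_unique:
  assumes "m \<in> NN" and "n \<in> NN" and "set_equinumerous (elts m) (elts (n::'v::ast))"
  shows "m = n"
proof -
  have *: False if "set_equinumerous (elts m) (elts n)" "m \<epsilon> n" "n \<in> NN" for m n :: 'v
  proof -
    have "elts m \<subset> elts n"
      using that NN_trans mem_irrefl by (metis mem_elts psubsetI subsetI)
    then have "strictly_subvalent n n"
      using set_equinumerous_sym[OF that(1)] unfolding set_equinumerous_iff strictly_subvalent_iff
      by metis
    then show False using not_strictly_subvalent_self by blast
  qed
  show ?thesis using NN_linear[OF assms(1,2)] * assms set_equinumerous_sym by metis
qed

section \<open>Finite natural numbers and saturation\<close>

text \<open>
  The embedding of the HOL natural numbers, whose range is \<open>FN\<close>.
\<close>

primrec std :: "nat \<Rightarrow> 'v::ast" where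
  "std 0 = empty_v"
| "std (Suc k) = succ (std k)"

lemma elts_std: "elts (std k) = std ` {..<k}"
  by (induction k) (simp_all add: elts_empty elts_succ lessThan_Suc)

lemma std_NN: "std k \<in> NN"
  by (induction k) (simp_all add: empty_NN succ_NN)

lemma std_mem_iff: "std j \<epsilon> (std k::'v::ast) \<longleftrightarrow> j < k"
proof -
  have *: "std j \<epsilon> (std k::'v)" if "j < k" for j k
    using that elts_std[of k] mem_elts by blast
  show ?thesis
    using *[of j k] *[of k j] mem_asym mem_irrefl by (metis linorder_neqE_nat)
qed

lemma std_eq_iff: "std j = (std k::'v::ast) \<longleftrightarrow> j = k"
  by (metis std_mem_iff less_irrefl linorder_neqE_nat)

lemma std_subset_iff: "elts (std j) \<subseteq> elts (std k::'v::ast) \<longleftrightarrow> j \<le> k"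
  using NN_subset_iff[OF std_NN std_NN, of j k] by (auto simp: std_eq_iff std_mem_iff)

text \<open>
  Subclasses of a finite number are sets, so the elements of \<open>n\<close> outside the range of \<open>std\<close> form
  a set.  Its least element would be neither zero nor a successor.
\<close>

lemma FN_eq_range_std: "(FN::'v::ast set) = range std"
proof (intro equalityI subsetI)
  fix n :: 'v assume "n \<in> range std"
  then obtain k where n: "n = std k" by blast
  have "is_set X" if "X \<subseteq> elts n" for X
    using that finite_subset[OF that] by (intro is_set_finite) (simp add: n elts_std)
  then show "n \<in> FN" by (simp add: FN_def n std_NN)
next
  fix n :: 'v assume n: "n \<in> FN"
  then have nN: "n \<in> NN" by (simp add: FN_def)
  show "n \<in> range std"
  proof (rule ccontr)
    assume nstd: "n \<notin> range std"
    have "is_set (insert n (elts n - range std))"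
      using n by (intro is_set_insert) (auto simp: FN_def)
    then obtain d where d: "elts d = insert n (elts n - range std)" using ex_set by blast
    then have "elts d \<noteq> {}" by simp
    then obtain m where m: "m \<in> elts d" "elts m \<inter> elts d = {}" using foundation by blast
    have mN: "m \<in> NN" using m(1) d nN NN_mem by (auto simp: mem_elts)
    have mnstd: "m \<notin> range std" using m(1) d nstd by auto
    have "k \<in> range std" if "k \<epsilon> m" for k
      using that m d NN_trans[OF nN, of m k] by (auto simp: mem_elts)
    note pred = this
    from mN show False
    proof (cases rule: NN_cases)
      case 1
      then show False using mnstd std.simps(1) by (metis rangeI)
    next
      case (2 k)
      then obtain j where "k = std j" using pred mem_succ by blast
      then show False using 2 mnstd std.simps(2) by (metis rangeI)
    qed
  qed
qed

lemma FN_not_set: "\<not> is_set (FN::'v::ast set)"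
proof
  assume "is_set (FN::'v set)"
  then obtain c :: 'v where c: "elts c = range std" using ex_set FN_eq_range_std by metis
  have "\<exists>z\<in>elts c. elts z = {}" using c elts_empty std.simps(1) by (metis rangeI)
  moreover have "\<forall>x\<in>elts c. \<exists>y\<in>elts c. elts y = insert x (elts x)"
    using c elts_succ std.simps(2) by (metis rangeE rangeI)
  ultimately show False using no_infinite_set by blast
qed

lemma not_FN_greater:
  assumes "n \<in> NN" "n \<notin> FN"
  shows "std k \<epsilon> (n::'v::ast)"
proof (rule ccontr)
  assume "\<not> std k \<epsilon> n"
  then have "n = std k \<or> n \<epsilon> std k" using NN_linear[OF std_NN assms(1)] by metis
  then show False
    using assms(2) elts_std[of k] unfolding FN_eq_range_std mem_elts[symmetric] by auto
qed

lemma is_set_dom: "is_set {x::'v::ast. \<exists>y. kpair x y \<epsilon> f}"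
proof -
  obtain g where g: "elts g = (\<Union>x\<in>elts f. elts x)" using union by blast
  have "set_definable {x. \<exists>y. kpair x y \<epsilon> f}"
    by (rule set_definable1, rule fdef_ex[where n = 2], simp, rule fdef_kpair_mem)
  moreover have "{x. \<exists>y. kpair x y \<epsilon> f} \<subseteq> (\<Union>x\<in>elts g. elts x)"
  proof
    fix x assume "x \<in> {x. \<exists>y. kpair x y \<epsilon> f}"
    then obtain y where y: "kpair x y \<in> elts f" by (auto simp: mem_elts)
    have "upair x x \<in> elts (kpair x y)" by (simp add: kpair_def elts_upair)
    then have "upair x x \<in> elts g" using y g by blast
    moreover have "x \<in> elts (upair x x)" by (simp add: elts_upair)
    ultimately show "x \<in> (\<Union>x\<in>elts g. elts x)" by blast
  qed
  ultimately show ?thesis using is_set_definable_subset is_set_Union_elts by blast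
qed

text \<open>
  A definable property cut down to the domain of a set function gives a set, whereas \<open>FN\<close> is
  not a set.
\<close>

lemma overspill:
  assumes P: "set_definable {m. P m f}" and FN: "\<And>k. P (std k) f"
    and dom: "\<And>k. \<exists>y. kpair (std k) y \<epsilon> f"
  obtains m y where "m \<in> NN" "m \<notin> FN" "P m f" "kpair m y \<epsilon> (f::'v::ast)"
proof -
  let ?D = "{m. \<exists>y. kpair m y \<epsilon> f} \<inter> {m. P m f} \<inter> NN"
  have "set_definable (NN::'v set)" using set_definable0[OF fdef_NN] by simp
  then have "is_set ?D" by (intro is_set_Int is_set_dom P)
  moreover have "FN \<subseteq> ?D" unfolding FN_eq_range_std using FN dom std_NN by blast
  ultimately have "\<exists>m\<in>?D. m \<notin> FN" using FN_not_set by (metis subsetI subset_antisym)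
  then show ?thesis using that by blast
qed

text \<open>
  The sequence is prolonged to a set function \<open>f\<close>.  The conditions of being nonempty and contained
  in the earlier values spill over to some infinite \<open>m\<close>, and all elements of \<open>f m\<close> belong to every
  \<open>d k\<close>.
\<close>

lemma saturation:
  fixes d :: "nat \<Rightarrow> 'v::ast"
  assumes "\<And>k. elts (d k) \<noteq> {}" and "\<And>k. elts (d (Suc k)) \<subseteq> elts (d k)"
  obtains x where "\<And>k. x \<in> elts (d k)"
proof -
  have anti: "elts (d k) \<subseteq> elts (d j)" if "j \<le> k" for j k
    using lift_Suc_antimono_le[of "\<lambda>k. elts (d k)"] assms(2) that by blast
  obtain f where f: "set_fun f" "\<forall>n\<in>FN. kpair n (d (inv std n)) \<epsilon> f"
    using prolongation[of "\<lambda>n. d (inv std n)"] by blast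
  have "inv std (std k :: 'v) = k" for k
    by (rule inv_f_eq) (simp_all add: inj_def std_eq_iff)
  then have fd: "kpair (std k) (d k) \<epsilon> f" for k
    using f(2) by (metis FN_eq_range_std rangeI)
  have uniq: "y = d k" if "kpair (std k) y \<epsilon> f" for k y
    using f(1) fd that unfolding set_fun_def by blast
  define P where "P m f \<longleftrightarrow> (\<exists>y. kpair m y \<epsilon> f \<and> (\<exists>x. x \<epsilon> y) \<and>
    (\<forall>i z. i \<epsilon> m \<and> kpair i z \<epsilon> f \<longrightarrow> elts y \<subseteq> elts z))" for m f :: 'v
  have "fdef (\<lambda>e::nat \<Rightarrow> 'v. P (e 0) (e 1))"
    unfolding P_def
    by (rule fdef_ex[where n = 2], simp, intro fdef_conj fdef_kpair_mem,
        rule fdef_ex[where n = 3], simp, rule fdef_mem,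
        rule fdef_all[where n = 3], simp, rule fdef_all[where n = 4], simp,
        intro fdef_prop fdef_kpair_mem fdef_subset)
  then have "set_definable {m. P m f}" by (rule set_definable1)
  moreover have "P (std k) f" for k
  proof -
    have "\<exists>x. x \<epsilon> d k" using assms(1) mem_elts by blast
    moreover have "elts (d k) \<subseteq> elts z" if i: "i \<epsilon> std k" "kpair i z \<epsilon> f" for i z
    proof -
      have "i \<in> std ` {..<k}" using i(1) by (simp add: mem_elts[symmetric] elts_std)
      then obtain j where "j < k" "i = std j" by blast
      then show ?thesis using anti[of j k] uniq i(2) by auto
    qed
    ultimately show ?thesis unfolding P_def using fd by blast
  qed
  ultimately obtain m where m: "m \<in> NN" "m \<notin> FN" "P m f"
    using overspill[of P f] fd by blast
  then obtain y x where y: "x \<epsilon> y" "\<And>i z. i \<epsilon> m \<Longrightarrow> kpair i z \<epsilon> f \<Longrightarrow> elts y \<subseteq> elts z"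
    unfolding P_def by blast
  have "x \<in> elts (d k)" for k
    using y(1) y(2)[OF not_FN_greater[OF m(1,2)] fd] unfolding mem_elts[symmetric] by blast
  then show ?thesis using that by blast
qed

lemma ex_NN_not_FN: "\<exists>m::'v::ast. m \<in> NN \<and> m \<notin> FN"
proof -
  obtain f :: 'v where f: "\<forall>n\<in>FN. kpair n n \<epsilon> f"
    using prolongation[of "\<lambda>n. n"] by blast
  have "set_definable {m. m = m}" by (rule set_definable0) (rule fdef_eq)
  then show ?thesis
    using overspill[of "\<lambda>m _. m = m" f] f by (metis FN_eq_range_std rangeI)
qed

section \<open>Countably determined classes\<close>

text \<open>
  Elements with the same pattern of membership in the classes \<open>A i\<close> are not separated by \<open>X\<close>.
  An arbitrary set of patterns is allowed, so that this is much more general than being Borel, and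
  the projections of semisets stay within this notion.
\<close>

definition countably_determined :: "'v::membership set \<Rightarrow> bool" where
  "countably_determined X \<longleftrightarrow> (\<exists>A::nat \<Rightarrow> 'v set. (\<forall>i. set_definable (A i)) \<and>
     (\<forall>x y. (\<forall>i. x \<in> A i \<longleftrightarrow> y \<in> A i) \<longrightarrow> x \<in> X \<longrightarrow> y \<in> X))"

lemma countably_determined_definable: "set_definable X \<Longrightarrow> countably_determined X"
  unfolding countably_determined_def by (intro exI[of _ "\<lambda>_. X"]) simp

lemma countably_determined_Compl: "countably_determined X \<Longrightarrow> countably_determined (- X)"
  unfolding countably_determined_def by blast

lemma countably_determined_UN:
  assumes "\<And>k::nat. countably_determined (Y k)"
  shows "countably_determined (\<Union>k. Y k)"
proof -
  obtain A :: "nat \<Rightarrow> nat \<Rightarrow> 'a set" where A: "\<And>k i. set_definable (A k i)"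
    "\<And>k x y. (\<forall>i. x \<in> A k i \<longleftrightarrow> y \<in> A k i) \<Longrightarrow> x \<in> Y k \<Longrightarrow> y \<in> Y k"
    using assms unfolding countably_determined_def by metis
  let ?A = "\<lambda>m. case prod_decode m of (k, i) \<Rightarrow> A k i"
  have "y \<in> (\<Union>k. Y k)" if eq: "\<forall>m. x \<in> ?A m \<longleftrightarrow> y \<in> ?A m" and x: "x \<in> (\<Union>k. Y k)" for x y
  proof -
    obtain k where k: "x \<in> Y k" using x by blast
    have "x \<in> A k i \<longleftrightarrow> y \<in> A k i" for i
      using eq[rule_format, of "prod_encode (k, i)"] by simp
    then show ?thesis using A(2) k by blast
  qed
  moreover have "set_definable (?A m)" for m by (simp add: A(1) split: prod.split)
  ultimately show ?thesis unfolding countably_determined_def by (intro exI[of _ ?A]) blast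
qed

lemma countably_determined_INT:
  assumes "\<And>k::nat. countably_determined (Y k)"
  shows "countably_determined (\<Inter>k. Y k)"
  using countably_determined_Compl[OF countably_determined_UN[of "\<lambda>k. - Y k"]]
    countably_determined_Compl[OF assms] by simp

lemma countably_determined_Int:
  assumes "countably_determined X" and "countably_determined Y"
  shows "countably_determined (X \<inter> Y)"
proof -
  have "X \<inter> Y = (\<Inter>k::nat. if k = 0 then X else Y)" by (auto split: if_splits)
  then show ?thesis using countably_determined_INT[of "\<lambda>k. if k = 0 then X else Y"] assms by simp
qed

lemma sigma_pi_countably_determined:
  shows "sigma_class a X \<Longrightarrow> countably_determined (X::'v::ast set)"
    and "pi_class a X \<Longrightarrow> countably_determined (X::'v::ast set)"
proof (induction rule: sigma_class_pi_class.inducts)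
  case (sigma_pos a Y)
  then have "countably_determined (Y (std k))" for k using FN_eq_range_std by blast
  from countably_determined_UN[OF this] show ?case by (simp add: FN_eq_range_std)
next
  case (pi_pos a Y)
  then have "countably_determined (Y (std k))" for k using FN_eq_range_std by blast
  from countably_determined_INT[OF this] show ?case by (simp add: FN_eq_range_std)
qed (rule countably_determined_definable, assumption)+

text \<open>
  The sets \<open>p m\<close> enumerate the sets \<open>P S k\<close> of all elements of \<open>a\<close> whose pattern agrees with \<open>S\<close>
  below \<open>k\<close>; there are only countably many, because \<open>P S k\<close> depends only on \<open>S \<inter> {..<k}\<close>.
  If \<open>x \<in> X\<close> is related to \<open>y\<close> and \<open>S\<close> is the pattern of \<open>x\<close>, then every \<open>P S k\<close> contains an
  element related to \<open>y'\<close>.  By saturation one element serves for all \<open>k\<close>; it has the same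
  pattern as \<open>x\<close>, hence it belongs to \<open>X\<close>.
\<close>

lemma projection_determined:
  fixes X :: "'v::ast set"
  assumes X: "countably_determined X" "X \<subseteq> elts a" and R: "\<And>y. set_definable {x. R y x}"
  shows "\<exists>p::nat \<Rightarrow> 'v. (\<forall>m. elts (p m) \<subseteq> elts a) \<and>
    (\<forall>y y'. (\<forall>m. (\<exists>x\<in>elts (p m). R y x) \<longrightarrow> (\<exists>x\<in>elts (p m). R y' x)) \<longrightarrow>
       (\<exists>x\<in>X. R y x) \<longrightarrow> (\<exists>x\<in>X. R y' x))"
proof -
  obtain A :: "nat \<Rightarrow> 'v set" where A: "\<And>i. set_definable (A i)"
    and det: "\<And>x y. (\<And>i. x \<in> A i \<longleftrightarrow> y \<in> A i) \<Longrightarrow> x \<in> X \<Longrightarrow> y \<in> X"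
    using X(1) unfolding countably_determined_def by metis
  define P where "P S k = {x \<in> elts a. \<forall>i<k. x \<in> A i \<longleftrightarrow> i \<in> S}" for S k
  have set: "is_set (P S k)" for S k
  proof (induction k)
    case 0
    then show ?case by (simp add: P_def is_set_elts)
  next
    case (Suc k)
    have "P S (Suc k) = P S k \<inter> (if k \<in> S then A k else - A k)"
      by (auto simp: P_def less_Suc_eq)
    then show ?case using is_set_Int[OF Suc A] is_set_Int[OF Suc set_definable_Compl[OF A]] by simp
  qed
  have "\<exists>c. elts c = P S k" for S k using ex_set[OF set] .
  then obtain c where c: "\<And>S k. elts (c S k) = P S k" by metis
  define p where "p m = c (set_decode (fst (prod_decode m))) (snd (prod_decode m))" for m
  have p: "\<exists>m. elts (p m) = P S k" for S k
  proof -
    have "P (S \<inter> {..<k}) k = P S k" by (auto simp: P_def)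
    moreover have "elts (p (prod_encode (set_encode (S \<inter> {..<k}), k))) = P (S \<inter> {..<k}) k"
      by (simp add: p_def c set_encode_inverse)
    ultimately show ?thesis by metis
  qed
  show ?thesis
  proof (intro exI[of _ p] conjI allI impI)
    show "elts (p m) \<subseteq> elts a" for m by (auto simp: p_def c P_def)
    fix y y'
    assume yy': "\<forall>m. (\<exists>x\<in>elts (p m). R y x) \<longrightarrow> (\<exists>x\<in>elts (p m). R y' x)"
      and "\<exists>x\<in>X. R y x"
    then obtain x where x: "x \<in> X" "R y x" by blast
    let ?S = "{i. x \<in> A i}"
    have "is_set (P ?S k \<inter> {x. R y' x})" for k by (intro is_set_Int set R)
    then have "\<exists>d. elts d = P ?S k \<inter> {x. R y' x}" for k using ex_set by blast
    then obtain d where d: "\<And>k. elts (d k) = P ?S k \<inter> {x. R y' x}" by metis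
    have "elts (d k) \<noteq> {}" for k
    proof -
      obtain m where m: "elts (p m) = P ?S k" using p by blast
      have "x \<in> P ?S k" using x X(2) by (auto simp: P_def)
      then have "\<exists>x\<in>elts (p m). R y' x" using yy' m x(2) by blast
      then show ?thesis using m d by auto
    qed
    moreover have "elts (d (Suc k)) \<subseteq> elts (d k)" for k by (auto simp: d P_def)
    ultimately obtain z where z: "\<And>k. z \<in> elts (d k)" using saturation by blast
    have "z \<in> P ?S k" "R y' z" for k using z d by auto
    then have "x \<in> A i \<longleftrightarrow> z \<in> A i" for i unfolding P_def by blast
    then have "z \<in> X" using det x(1) by blast
    then show "\<exists>x\<in>X. R y' x" using \<open>R y' z\<close> by blast
  qed
qed

lemma countably_determined_projection:
  fixes X :: "'v::ast set"
  assumes X: "countably_determined X" "X \<subseteq> elts a" and R: "\<And>y. set_definable {x. R y x}"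
    and R': "\<And>c. set_definable {y. \<exists>x\<in>elts c. R y x}"
  shows "countably_determined {y. \<exists>x\<in>X. R y x}"
proof -
  obtain p :: "nat \<Rightarrow> 'v" where
    p: "\<And>y y'. \<forall>m. (\<exists>x\<in>elts (p m). R y x) \<longrightarrow> (\<exists>x\<in>elts (p m). R y' x) \<Longrightarrow>
          \<exists>x\<in>X. R y x \<Longrightarrow> \<exists>x\<in>X. R y' x"
    using projection_determined[where R = R, OF X R] by blast
  show ?thesis
    unfolding countably_determined_def
  proof (intro exI[of _ "\<lambda>m. {y. \<exists>x\<in>elts (p m). R y x}"] conjI allI impI R')
    fix y y'
    assume *: "\<forall>m. y \<in> {y. \<exists>x\<in>elts (p m). R y x} \<longleftrightarrow> y' \<in> {y. \<exists>x\<in>elts (p m). R y x}"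
      and "y \<in> {y. \<exists>x\<in>X. R y x}"
    then have "\<exists>x\<in>X. R y x" by simp
    from p[OF _ this, of y'] * show "y' \<in> {y. \<exists>x\<in>X. R y x}" by simp
  qed
qed

text \<open>
  A subset of \<open>a\<close> is not included in \<open>X\<close> iff it meets \<open>a - X\<close>, which is a projection.
\<close>

lemma countably_determined_subsets:
  assumes X: "countably_determined X" "X \<subseteq> elts (a::'v::ast)"
  shows "countably_determined {u. elts u \<subseteq> X}"
proof -
  have "countably_determined {u. \<exists>x\<in>elts a - X. x \<epsilon> u}"
  proof (rule countably_determined_projection[where a = a])
    show "countably_determined (elts a - X)"
      unfolding Diff_eq by (rule countably_determined_Int[OF countably_determined_definable
            [OF set_definable_elts] countably_determined_Compl[OF X(1)]])
    show "set_definable {x. x \<epsilon> u}" for u :: 'v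
      by (rule set_definable1) (rule fdef_mem)
    show "set_definable {u. \<exists>x\<in>elts c. x \<epsilon> u}" for c :: 'v
      unfolding Bex_def mem_elts
      by (rule set_definable1, rule fdef_ex[where n = 2], simp) (intro fdef_prop)
  qed simp
  moreover have "set_definable {u. elts u \<subseteq> elts a}"
    by (rule set_definable1) (rule fdef_subset)
  moreover have "{u. elts u \<subseteq> X} = {u. elts u \<subseteq> elts a} \<inter> - {u. \<exists>x\<in>elts a - X. x \<epsilon> u}"
    using X(2) unfolding mem_elts[symmetric] by blast
  ultimately show ?thesis
    by (simp add: countably_determined_Int countably_determined_Compl countably_determined_definable)
qed

text \<open>
  Not to include \<open>X\<close> is a projection as well.  The bound \<open>a\<close> makes the class of the supersets a
  semiset, to which projections can be applied again.
\<close>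

lemma countably_determined_supersets:
  assumes X: "countably_determined X" "X \<subseteq> elts (a::'v::ast)"
  shows "countably_determined {u. X \<subseteq> elts u \<and> elts u \<subseteq> elts a}"
proof -
  have "countably_determined {u. \<exists>x\<in>X. \<not> x \<epsilon> u}"
  proof (rule countably_determined_projection[OF X])
    show "set_definable {x. \<not> x \<epsilon> u}" for u :: 'v
      by (rule set_definable1) (intro fdef_prop)
    show "set_definable {u. \<exists>x\<in>elts c. \<not> x \<epsilon> u}" for c :: 'v
      unfolding Bex_def mem_elts
      by (rule set_definable1, rule fdef_ex[where n = 2], simp) (intro fdef_prop)
  qed
  moreover have "set_definable {u. elts u \<subseteq> elts a}"
    by (rule set_definable1) (rule fdef_subset)
  moreover have "{u. X \<subseteq> elts u \<and> elts u \<subseteq> elts a} = {u. elts u \<subseteq> elts a} \<inter> - {u. \<exists>x\<in>X. \<not> x \<epsilon> u}"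
    unfolding mem_elts[symmetric] by blast
  ultimately show ?thesis
    by (simp add: countably_determined_Int countably_determined_Compl countably_determined_definable)
qed

section \<open>Countable cuts of natural numbers\<close>

definition segment :: "'v::ast set \<Rightarrow> bool" where
  "segment I \<longleftrightarrow> I \<subseteq> NN \<and> (\<forall>n\<in>I. \<forall>m. m \<epsilon> n \<longrightarrow> m \<in> I)"

text \<open>
  The two alternatives say that \<open>I\<close> has at most countable cofinality, or that its complement has
  at most countable coinitiality.
\<close>

definition countable_segment :: "'v::ast set \<Rightarrow> bool" where
  "countable_segment I \<longleftrightarrow> (\<exists>t::nat \<Rightarrow> 'v. (\<forall>k. t k \<in> NN) \<and>
     (I = (\<Union>k. elts (t k)) \<or> I = (\<Inter>k. elts (t k))))"

lemma segment_comparable: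
  assumes "segment I" "(g::'v::ast) \<in> NN"
  shows "elts g \<subseteq> I \<or> I \<subseteq> elts g"
proof (rule ccontr)
  assume "\<not> ?thesis"
  then obtain x y where xy: "x \<epsilon> g" "x \<notin> I" "y \<in> I" "\<not> y \<epsilon> g"
    unfolding subset_iff mem_elts by blast
  then show False
    using NN_linear[of x y] NN_mem[OF assms(2)] NN_trans[OF assms(2)] assms(1)
    unfolding segment_def by blast
qed

text \<open>
  Suppose that \<open>n \<in> I\<close> is in no number \<open>g m \<subseteq> I\<close>, and \<open>n' \<notin> I\<close> is in all numbers \<open>g m \<supseteq> I\<close>.  As
  every \<open>g m\<close> is comparable with \<open>I\<close>, no \<open>g m\<close> separates \<open>n\<close> from \<open>n'\<close>.  The bound \<open>b\<close> keeps the
  intersection from being taken over an empty family.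
\<close>

lemma countable_segmentI:
  fixes I :: "'v::ast set"
  assumes I: "segment I" and b: "b \<in> NN" "I \<subseteq> elts b" and g: "\<And>m::nat. g m \<in> NN"
    and det: "\<And>n n'. n \<in> NN \<Longrightarrow> n' \<in> NN \<Longrightarrow> (\<And>m. n \<epsilon> g m \<longleftrightarrow> n' \<epsilon> g m) \<Longrightarrow> n \<in> I \<Longrightarrow> n' \<in> I"
  shows "countable_segment I"
proof -
  let ?t = "\<lambda>m. if elts (g m) \<subseteq> I then g m else empty_v"
  let ?w = "case_nat b (\<lambda>m. if I \<subseteq> elts (g m) then g m else b)"
  have "I = (\<Union>m. elts (?t m)) \<or> I = (\<Inter>m. elts (?w m))"
  proof (rule ccontr)
    assume *: "\<not> ?thesis"
    have "(\<Union>m. elts (?t m)) \<subseteq> I" by (auto simp: elts_empty split: if_splits)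
    then obtain n where n: "n \<in> I" "n \<notin> (\<Union>m. elts (?t m))" using * by blast
    have "I \<subseteq> (\<Inter>m. elts (?w m))" using b by (auto split: nat.splits)
    then obtain n' where n': "n' \<notin> I" "n' \<in> (\<Inter>m. elts (?w m))" using * by blast
    have "n' \<in> elts (?w 0)" using n'(2) by blast
    then have n'N: "n' \<in> NN" using NN_mem[OF b(1)] by (simp add: mem_elts)
    have "n \<epsilon> g m \<longleftrightarrow> n' \<epsilon> g m" for m
    proof (cases "elts (g m) \<subseteq> I")
      case True
      have "n \<notin> elts (?t m)" using n(2) by blast
      then show ?thesis using True n'(1) by (auto simp: mem_elts)
    next
      case False
      then have "I \<subseteq> elts (g m)" using segment_comparable[OF I g] by blast
      moreover have "n' \<in> elts (?w (Suc m))" using n'(2) by blast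
      ultimately show ?thesis using n(1) by (auto simp: mem_elts)
    qed
    then show False using det[of n n'] n n' n'N I unfolding segment_def by blast
  qed
  moreover have "?t m \<in> NN" "?w m \<in> NN" for m
    using g b empty_NN by (auto split: nat.splits)
  ultimately show ?thesis
    unfolding countable_segment_def by (elim disjE) (rule exI[of _ ?t], simp, rule exI[of _ ?w], simp)
qed

lemma definable_segment_is_number:
  fixes J :: "'v::ast set"
  assumes J: "set_definable J" "segment J"
    and b: "b \<in> NN" "b \<notin> J"
  obtains g where "g \<in> NN" "elts g = J"
proof -
  have "J \<subseteq> elts b"
    using NN_linear[OF b(1)] J(2) b unfolding segment_def by (metis mem_elts subset_iff)
  then obtain g where g: "elts g = J"
    using is_set_definable_subset[OF J(1) _ is_set_elts] ex_set by metis
  have "g \<in> NN"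
    by (rule NN_I; unfold mem_elts[symmetric] g; unfold mem_elts)
      (use J(2) NN_linear in \<open>unfold segment_def, blast\<close>)+
  then show ?thesis using that g by blast
qed

lemma ex_NN_not_subvalent: "\<exists>b\<in>NN. \<forall>u. elts u \<subseteq> elts (a::'v::ast) \<longrightarrow> \<not> strictly_subvalent b u"
  using ex_NN_equinumerous[of a] equinumerous_not_strictly_subvalent strictly_subvalent_mono by blast

text \<open>
  The lower and the upper cut of \<open>X\<close> are generated by these segments of natural numbers.
\<close>

definition lower_segment :: "'v::ast set \<Rightarrow> 'v set" where
  "lower_segment X = {n\<in>NN. \<exists>u. elts u \<subseteq> X \<and> strictly_subvalent n u}"

definition upper_segment :: "'v::ast set \<Rightarrow> 'v set" where
  "upper_segment X = {n\<in>NN. \<forall>u. X \<subseteq> elts u \<longrightarrow> strictly_subvalent n u}"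

lemma subvalent_mem_mono:
  "n \<in> NN \<Longrightarrow> m \<epsilon> n \<Longrightarrow> strictly_subvalent n u \<Longrightarrow> strictly_subvalent m (u::'v::ast)"
  using strictly_subvalent_mono[of n u m u] NN_subset_iff NN_mem by blast

lemma segment_lower_segment: "segment (lower_segment (X::'v::ast set))"
  unfolding segment_def lower_segment_def using NN_mem subvalent_mem_mono by blast

lemma segment_upper_segment: "segment (upper_segment (X::'v::ast set))"
  unfolding segment_def upper_segment_def using NN_mem subvalent_mem_mono by blast

text \<open>
  The segment is the projection of the class of the subsets of \<open>X\<close>.  The determining projections
  of the sets \<open>p m\<close> are definable segments of \<open>N\<close>, bounded by a number \<open>b\<close> of the size of \<open>a\<close>,
  and so they are natural numbers.
\<close>

lemma countable_lower_segment:
  assumes X: "countably_determined X" "X \<subseteq> elts (a::'v::ast)"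
  shows "countable_segment (lower_segment X)"
proof -
  obtain b where b: "b \<in> NN" "\<And>u. elts u \<subseteq> elts a \<Longrightarrow> \<not> strictly_subvalent b u"
    using ex_NN_not_subvalent[of a] by blast
  obtain pa where pa: "elts pa = {u. elts u \<subseteq> elts a}" using powerset by blast
  have sub: "{u. elts u \<subseteq> X} \<subseteq> elts pa" using pa X by blast
  have def: "set_definable {u. strictly_subvalent n u}" for n :: 'v
    by (rule set_definable1) (rule fdef_strictly_subvalent)
  obtain p :: "nat \<Rightarrow> 'v" where p: "\<And>m. elts (p m) \<subseteq> elts pa"
    and det: "\<And>n n'. \<forall>m. (\<exists>u\<in>elts (p m). strictly_subvalent n u) \<longrightarrow>
          (\<exists>u\<in>elts (p m). strictly_subvalent n' u) \<Longrightarrow>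
          \<exists>u\<in>{u. elts u \<subseteq> X}. strictly_subvalent n u \<Longrightarrow>
          \<exists>u\<in>{u. elts u \<subseteq> X}. strictly_subvalent n' u"
    using projection_determined[where R = strictly_subvalent, OF countably_determined_subsets[OF X] sub def] by blast
  let ?J = "\<lambda>m. {n\<in>NN. \<exists>u\<in>elts (p m). strictly_subvalent n u}"
  have "\<exists>g. g \<in> NN \<and> elts g = ?J m" for m
  proof -
    have "set_definable (?J m)"
      unfolding Bex_def mem_elts
      by (rule set_definable1, intro fdef_conj fdef_NN, rule fdef_ex[where n = 2], simp)
        (intro fdef_prop fdef_strictly_subvalent)
    moreover have "b \<notin> ?J m" using b p pa by blast
    moreover have "segment (?J m)"
      unfolding segment_def using NN_mem subvalent_mem_mono by blast
    ultimately obtain g where "g \<in> NN" "elts g = ?J m"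
      using definable_segment_is_number[of "?J m" b] b(1) by blast
    then show ?thesis by blast
  qed
  then obtain g where g: "\<And>m. g m \<in> NN" "\<And>m. elts (g m) = ?J m" by metis
  show ?thesis
  proof (rule countable_segmentI[of _ b g])
    show "segment (lower_segment X)" by (rule segment_lower_segment)
    show "lower_segment X \<subseteq> elts b"
    proof
      fix n assume n: "n \<in> lower_segment X"
      then obtain u where u: "n \<in> NN" "elts u \<subseteq> elts a" "strictly_subvalent n u"
        using X(2) unfolding lower_segment_def by blast
      then have "\<not> elts b \<subseteq> elts n" using b(2) strictly_subvalent_mono by blast
      then show "n \<in> elts b" using NN_not_mem[OF u(1) b(1)] by (simp add: mem_elts)
    qed
    show "b \<in> NN" "g m \<in> NN" for m using b g by blast+
    fix n n' assume n: "n \<in> NN" "n' \<in> NN" "\<And>m. n \<epsilon> g m \<longleftrightarrow> n' \<epsilon> g m" "n \<in> lower_segment X"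
    have "n \<in> ?J m \<longleftrightarrow> n' \<in> ?J m" for m
      using n(3)[of m] unfolding g(2)[symmetric] mem_elts .
    then show "n' \<in> lower_segment X"
      using det[of n n'] n unfolding lower_segment_def by blast
  qed
qed

text \<open>
  Dually, the complement of the segment is a projection of the class of the supersets of \<open>X\<close>.  It
  is enough to consider supersets inside \<open>a\<close>, since intersecting with \<open>a\<close> only makes them smaller.
\<close>

lemma countable_upper_segment:
  assumes X: "countably_determined X" "X \<subseteq> elts (a::'v::ast)"
  shows "countable_segment (upper_segment X)"
proof -
  obtain b where b: "b \<in> NN" "\<And>u. elts u \<subseteq> elts a \<Longrightarrow> \<not> strictly_subvalent b u"
    using ex_NN_not_subvalent[of a] by blast
  obtain pa where pa: "elts pa = {u. elts u \<subseteq> elts a}" using powerset by blast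
  let ?Z = "{u. X \<subseteq> elts u \<and> elts u \<subseteq> elts a}"
  have sub: "?Z \<subseteq> elts pa" using pa by blast
  have def: "set_definable {u. \<not> strictly_subvalent n u}" for n :: 'v
    by (rule set_definable1) (intro fdef_not fdef_strictly_subvalent)
  have seg: "n \<in> upper_segment X \<longleftrightarrow> n \<in> NN \<and> \<not> (\<exists>u\<in>?Z. \<not> strictly_subvalent n u)" for n
  proof -
    have "strictly_subvalent n u" if Z: "\<forall>u\<in>?Z. strictly_subvalent n u" and u: "X \<subseteq> elts u" for u
    proof -
      obtain w where w: "elts w = elts u \<inter> elts a" using separation[OF set_definable_elts] by blast
      then have "w \<in> ?Z" using u X(2) by blast
      then have "strictly_subvalent n w" using Z by blast
      then show ?thesis using strictly_subvalent_mono[of n w n u] w by blast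
    qed
    then show ?thesis unfolding upper_segment_def by blast
  qed
  obtain p :: "nat \<Rightarrow> 'v" where p: "\<And>m. elts (p m) \<subseteq> elts pa"
    and det: "\<And>n n'. \<forall>m. (\<exists>u\<in>elts (p m). \<not> strictly_subvalent n u) \<longrightarrow>
          (\<exists>u\<in>elts (p m). \<not> strictly_subvalent n' u) \<Longrightarrow>
          \<exists>u\<in>?Z. \<not> strictly_subvalent n u \<Longrightarrow> \<exists>u\<in>?Z. \<not> strictly_subvalent n' u"
    using projection_determined[where R = "\<lambda>n u. \<not> strictly_subvalent n u",
        OF countably_determined_supersets[OF X] sub def] by blast
  let ?J = "\<lambda>m. {n\<in>NN. \<forall>u\<in>elts (p m). strictly_subvalent n u}"
  \<comment> \<open>for empty \<open>p m\<close> the class \<open>?J m\<close> is all of \<open>N\<close> and separates nothing\<close>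
  have "\<exists>g. g \<in> NN \<and> (elts (p m) \<noteq> {} \<longrightarrow> elts g = ?J m)" for m
  proof (cases "elts (p m) = {}")
    case False
    have "set_definable (?J m)"
      unfolding Ball_def mem_elts
      by (rule set_definable1, intro fdef_conj fdef_NN, rule fdef_all[where n = 2], simp)
        (intro fdef_prop fdef_strictly_subvalent)
    moreover have "b \<notin> ?J m" using False b p pa by blast
    moreover have "segment (?J m)"
      unfolding segment_def using NN_mem subvalent_mem_mono by blast
    ultimately obtain g where "g \<in> NN" "elts g = ?J m"
      using definable_segment_is_number[of "?J m" b] b(1) by blast
    then show ?thesis by blast
  qed (use b in blast)
  then obtain g where g: "\<And>m. g m \<in> NN" "\<And>m. elts (p m) \<noteq> {} \<Longrightarrow> elts (g m) = ?J m" by metis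
  show ?thesis
  proof (rule countable_segmentI[of _ b g])
    show "segment (upper_segment X)" by (rule segment_upper_segment)
    show "upper_segment X \<subseteq> elts b"
    proof
      fix n assume n: "n \<in> upper_segment X"
      then have u: "n \<in> NN" "strictly_subvalent n a"
        using X(2) unfolding upper_segment_def by blast+
      then have "\<not> elts b \<subseteq> elts n" using b(2)[of a] strictly_subvalent_mono[of n a b a] by blast
      then show "n \<in> elts b" using NN_not_mem[OF u(1) b(1)] by (simp add: mem_elts)
    qed
    show "b \<in> NN" "g m \<in> NN" for m using b g by blast+
    fix n n' assume n: "n \<in> NN" "n' \<in> NN" "\<And>m. n \<epsilon> g m \<longleftrightarrow> n' \<epsilon> g m" "n \<in> upper_segment X"
    have "(\<exists>u\<in>elts (p m). \<not> strictly_subvalent n u)" if "\<exists>u\<in>elts (p m). \<not> strictly_subvalent n' u" for m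
    proof -
      have "elts (g m) = ?J m" using g(2) that by blast
      then have "n \<in> ?J m \<longleftrightarrow> n' \<in> ?J m" using n(3)[of m] mem_elts by metis
      then show ?thesis using n that by blast
    qed
    then show "n' \<in> upper_segment X"
      using det[of n' n] n unfolding seg by blast
  qed
qed

section \<open>The rationals\<close>

lemma set_equinumerous_insert:
  assumes "set_equinumerous A B" "a \<notin> A" "b \<notin> B"
  shows "set_equinumerous (insert a A) (insert b (B::'v::ast set))"
proof -
  obtain R where R: "injr R" "Domain R = A" "Range R = B"
    using assms(1) unfolding set_equinumerous_iff by blast
  then have "injr (insert (a, b) R)" using assms by (intro injr_insert) auto
  moreover have "Domain (insert (a, b) R) = insert a A" "Range (insert (a, b) R) = insert b B"
    using R by auto
  ultimately show ?thesis unfolding set_equinumerous_iff by blast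
qed

lemma is_set_kpair_Times:
  "is_set A \<Longrightarrow> is_set B \<Longrightarrow> is_set {kpair x y | x y. x \<in> A \<and> y \<in> (B::'v::ast set)}"
proof -
  assume "is_set A" "is_set B"
  then have "is_set ((\<lambda>(x, y). kpair x y) ` (A \<times> B))" using irel_Times unfolding irel_def by blast
  moreover have "(\<lambda>(x, y). kpair x y) ` (A \<times> B) = {kpair x y | x y. x \<in> A \<and> y \<in> B}" by auto
  ultimately show ?thesis by simp
qed

lemma is_set_kpair_image: "is_set A \<Longrightarrow> is_set (kpair e ` (A::'v::ast set))"
proof -
  assume "is_set A"
  from is_set_kpair_Times[OF is_set_finite[of "{e}"] this]
  have "is_set {kpair x y | x y. x \<in> {e} \<and> y \<in> A}" by simp
  moreover have "{kpair x y | x y. x \<in> {e} \<and> y \<in> A} = kpair e ` A" by auto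
  ultimately show ?thesis by simp
qed

lemma set_equinumerous_kpair_image: "set_equinumerous (elts n) (kpair e ` elts (n::'v::ast))"
proof -
  let ?R = "{(x, y). x \<epsilon> n \<and> y = kpair e x}"
  have "set_definable {z. \<exists>x y. z = kpair x y \<and> (x \<epsilon> n \<and> y = kpair e x)}"
    by (rule set_definable_kpair_class[of "\<lambda>x y n e. x \<epsilon> n \<and> y = kpair e x"])
      (intro fdef_conj fdef_mem fdef_kpair)
  then have "irel ?R"
    by (intro irel_definable[OF is_set_elts is_set_kpair_image[OF is_set_elts]])
      (auto simp: mem_elts)
  then have "injr ?R" unfolding injr_def by (auto simp: single_valued_def kpair_inject)
  moreover have "Domain ?R = elts n" "Range ?R = kpair e ` elts n" by (auto simp: mem_elts)
  ultimately show ?thesis unfolding set_equinumerous_iff by blast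
qed

lemma the_number_eqI:
  assumes "k \<in> NN" "set_equinumerous (elts k) (A::'v::ast set)"
  shows "(THE k. k \<in> NN \<and> set_equinumerous (elts k) A) = k"
  using assms NN_equinumerous_unique set_equinumerous_trans[OF _ set_equinumerous_sym]
  by (intro the_equality) blast+

lemma ex_number: "is_set A \<Longrightarrow> \<exists>k. k \<in> NN \<and> set_equinumerous (elts k) (A::'v::ast set)"
  using ex_NN_equinumerous ex_set by metis

lemma the_number:
  assumes "is_set (A::'v::ast set)"
  shows "(THE k. k \<in> NN \<and> set_equinumerous (elts k) A) \<in> NN"
    and "set_equinumerous (elts (THE k. k \<in> NN \<and> set_equinumerous (elts k) A)) A"
proof -
  obtain k where k: "k \<in> NN" "set_equinumerous (elts k) A" using ex_number[OF assms] by blast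
  then show "(THE k. k \<in> NN \<and> set_equinumerous (elts k) A) \<in> NN"
    "set_equinumerous (elts (THE k. k \<in> NN \<and> set_equinumerous (elts k) A)) A"
    unfolding the_number_eqI[OF k] by simp_all
qed

lemma nat_mult_NN: "nat_mult m n \<in> NN"
  and equinumerous_nat_mult:
    "set_equinumerous (elts (nat_mult m n)) {kpair x y | x y. x \<in> elts m \<and> y \<in> elts (n::'v::ast)}"
  unfolding nat_mult_def
  by (rule the_number, rule is_set_kpair_Times[OF is_set_elts is_set_elts])+

lemma nat_add_NN: "nat_add m (n::'v::ast) \<in> NN"
  unfolding nat_add_def
  by (rule the_number, rule is_set_Un[OF is_set_kpair_image[OF is_set_elts] is_set_kpair_image[OF is_set_elts]])

lemma elts_std_1: "elts (std 1) = {empty_v::'v::ast}"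
  by (simp add: elts_succ elts_empty)

lemma nat_add_empty: "nat_add empty_v empty_v = (empty_v::'v::ast)"
  unfolding nat_add_def
  by (rule the_number_eqI) (simp_all add: empty_NN elts_empty set_equinumerous_refl is_set_empty)

lemma nat_mult_1: "nat_mult (std 1) (std 1) = (std 1::'v::ast)"
  unfolding nat_mult_def
proof (rule the_number_eqI[OF std_NN])
  have "{kpair x y |x y. x \<in> elts (std 1) \<and> y \<in> elts (std 1)} = {kpair empty_v (empty_v::'v)}"
    unfolding elts_std_1 by auto
  then show "set_equinumerous (elts (std 1)) {kpair x y |x y. x \<in> elts (std 1) \<and> y \<in> elts (std 1 :: 'v)}"
    unfolding elts_std_1 using set_equinumerous_insert[OF set_equinumerous_refl[OF is_set_empty]] by simp
qed

lemma nat_add_succ: "n \<in> NN \<Longrightarrow> nat_add n (std 1) = succ (n::'v::ast)"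
  unfolding nat_add_def
proof (rule the_number_eqI[OF succ_NN])
  have ne: "upair empty_v empty_v \<noteq> (empty_v::'v)"
    using elts_upair[of empty_v empty_v] elts_empty by (metis insert_not_empty)
  have "set_equinumerous (insert n (elts n))
      (insert (kpair (upair empty_v empty_v) empty_v) (kpair empty_v ` elts n))"
    using ne mem_irrefl[of n]
    by (intro set_equinumerous_insert set_equinumerous_kpair_image) (auto simp: kpair_inject mem_elts)
  then show "set_equinumerous (elts (succ n))
     (kpair empty_v ` elts n \<union> kpair (upair empty_v empty_v) ` elts (std 1))"
    unfolding elts_std_1 elts_succ by simp
qed

lemma succ_le_NN:
  "m \<in> NN \<Longrightarrow> n \<epsilon> m \<Longrightarrow> succ n = m \<or> succ n \<epsilon> (m::'v::ast)"
  using NN_linear[OF succ_NN[OF NN_mem], of m n m] mem_asym mem_irrefl mem_succ by metis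

locale ast_rationals =
  fixes \<iota> :: "'v::ast \<Rightarrow> 'q::linordered_field"
  assumes rat: "rationals \<iota>"
begin

lemma iota_add: "m \<in> NN \<Longrightarrow> n \<in> NN \<Longrightarrow> \<iota> (nat_add m n) = \<iota> m + \<iota> n"
  and iota_mult: "m \<in> NN \<Longrightarrow> n \<in> NN \<Longrightarrow> \<iota> (nat_mult m n) = \<iota> m * \<iota> n"
  and iota_less: "m \<in> NN \<Longrightarrow> n \<in> NN \<Longrightarrow> \<iota> m < \<iota> n \<longleftrightarrow> m \<epsilon> n"
  using rat unfolding rationals_def by blast+

lemma iota_le: "m \<in> NN \<Longrightarrow> n \<in> NN \<Longrightarrow> \<iota> m \<le> \<iota> n \<longleftrightarrow> elts m \<subseteq> elts n"
  using iota_less[of n m] NN_not_mem[of n m] by (simp add: linorder_not_less[symmetric])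

lemma iota_0: "\<iota> empty_v = 0"
  using iota_add[OF empty_NN empty_NN] by (simp add: nat_add_empty)

lemma iota_1: "\<iota> (std 1) = 1"
proof -
  have "\<iota> empty_v < \<iota> (std 1)"
    unfolding iota_less[OF empty_NN std_NN] mem_elts[symmetric] elts_std_1 by simp
  then have "\<iota> (std 1) \<noteq> 0" by (simp add: iota_0)
  then show ?thesis using iota_mult[OF std_NN std_NN, of 1 1] by (simp add: nat_mult_1 del: std.simps One_nat_def)
qed

lemma iota_succ: "n \<in> NN \<Longrightarrow> \<iota> (succ n) = \<iota> n + 1"
  using iota_add[OF _ std_NN, of n 1] by (simp add: nat_add_succ iota_1 del: std.simps One_nat_def)

lemma iota_std: "\<iota> (std k) = of_nat k"
  by (induction k) (simp_all add: iota_0 iota_succ std_NN)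

lemma iota_nonneg: "n \<in> NN \<Longrightarrow> 0 \<le> \<iota> n"
  using iota_le[OF empty_NN, of n] by (simp add: iota_0 elts_empty)

text \<open>
  For \<open>q = x / y\<close> the least \<open>k\<close> with \<open>x < k * y\<close> is the successor of the floor.  It exists because
  multiplication of natural numbers is definable, through equinumerosity with a Cartesian product.
\<close>

lemma iota_floor:
  assumes "0 \<le> q"
  obtains n where "n \<in> NN" "\<iota> n \<le> q" "q < \<iota> n + 1"
proof -
  obtain x y where xy: "x \<in> NN" "y \<in> NN" "\<iota> y \<noteq> 0" "q = \<iota> x / \<iota> y \<or> q = - (\<iota> x / \<iota> y)"
    using rat unfolding rationals_def by blast
  have y0: "0 < \<iota> y" using xy iota_nonneg[of y] by simp
  have "0 \<le> \<iota> x / \<iota> y" using xy iota_nonneg[of x] y0 by simp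
  then have q: "q = \<iota> x / \<iota> y" using xy(4) assms by auto
  define P where "P k x y \<longleftrightarrow> (\<exists>z. z \<in> NN \<and> x \<epsilon> z \<and> (\<exists>w. set_equinumerous (elts z) (elts w) \<and>
      (\<forall>t. t \<epsilon> w \<longleftrightarrow> (\<exists>u v. t = kpair u v \<and> u \<epsilon> k \<and> v \<epsilon> y))))" for k x y :: 'v
  have "fdef (\<lambda>e::nat \<Rightarrow> 'v. P (e 0) (e 1) (e 2))"
    unfolding P_def
    by (rule fdef_ex[where n = 3], simp, intro fdef_conj fdef_NN fdef_mem,
        rule fdef_ex[where n = 4], simp, intro fdef_conj fdef_set_equinumerous,
        rule fdef_all[where n = 5], simp, intro fdef_iff fdef_mem,
        rule fdef_ex[where n = 6], simp, rule fdef_ex[where n = 7], simp,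
        intro fdef_conj fdef_mem fdef_kpair)
  then have def: "set_definable {k. P k x y}" by (rule set_definable2)
  have P: "P k x y \<longleftrightarrow> \<iota> x < \<iota> k * \<iota> y" if k: "k \<in> NN" for k
  proof -
    let ?M = "{kpair u v | u v. u \<in> elts k \<and> v \<in> elts y}"
    obtain w where w: "elts w = ?M" using ex_set[OF is_set_kpair_Times[OF is_set_elts is_set_elts]] by blast
    have w': "(\<forall>t. t \<epsilon> w' \<longleftrightarrow> (\<exists>u v. t = kpair u v \<and> u \<epsilon> k \<and> v \<epsilon> y)) \<longleftrightarrow> w' = w" for w'
      unfolding elts_inject[symmetric] w by (auto simp: mem_elts set_eq_iff)
    have eq: "z \<in> NN \<and> set_equinumerous (elts z) (elts w) \<longleftrightarrow> z = nat_mult k y" for z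
    proof -
      have "set_equinumerous (elts (nat_mult k y)) (elts w)" unfolding w by (rule equinumerous_nat_mult)
      then show ?thesis
        using nat_mult_NN NN_equinumerous_unique set_equinumerous_trans[OF _ set_equinumerous_sym]
        by blast
    qed
    then have "P k x y \<longleftrightarrow> x \<epsilon> nat_mult k y"
      unfolding P_def w' using eq by metis
    then show ?thesis
      using iota_less[OF xy(1) nat_mult_NN, of k y] iota_mult[OF k xy(2)] by simp
  qed
  have "\<iota> (succ empty_v) \<le> \<iota> y"
    using y0 iota_less[OF empty_NN xy(2)] unfolding iota_le[OF succ_NN[OF empty_NN] xy(2)]
    by (simp add: elts_succ elts_empty mem_elts iota_0)
  then have "1 \<le> \<iota> y" by (simp add: iota_succ empty_NN iota_0)
  then have "\<iota> x + 1 \<le> (\<iota> x + 1) * \<iota> y"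
    using iota_nonneg[OF xy(1)] mult_left_mono[of 1 "\<iota> y" "\<iota> x + 1"] by simp
  then have "P (succ x) x y" unfolding P[OF succ_NN[OF xy(1)]] iota_succ[OF xy(1)] by simp
  from NN_least[of "\<lambda>k. P k x y", OF def succ_NN[OF xy(1)] this]
  obtain m where m: "m \<in> NN" "P m x y" "\<And>k. k \<epsilon> m \<Longrightarrow> \<not> P k x y" by blast
  from m(1) show ?thesis
  proof (cases rule: NN_cases)
    case 1
    then show ?thesis using m(2) P[OF m(1)] iota_nonneg[OF xy(1)] by (simp add: iota_0)
  next
    case (2 n)
    then have "\<iota> n * \<iota> y \<le> \<iota> x" using m(3)[of n] P[of n] by (simp add: mem_succ)
    moreover have "\<iota> x < (\<iota> n + 1) * \<iota> y" using m(1,2) P[of m] 2 by (simp add: iota_succ)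
    ultimately have "\<iota> n \<le> q" "q < \<iota> n + 1" unfolding q using y0 by (simp_all add: field_simps)
    then show ?thesis using that 2 by blast
  qed
qed

section \<open>Approximating sequences\<close>

text \<open>
  Convergence of the cuts \<open>Q\<langle>t k\<rangle>\<close> to \<open>C\<close>, that is, \<open>C\<close> is both their lower and their upper limit.
\<close>

definition converges :: "(nat \<Rightarrow> 'q) \<Rightarrow> 'q set \<Rightarrow> bool" where
  "converges t C \<longleftrightarrow> (\<forall>y\<in>C. \<forall>\<^sub>F k in sequentially. y < t k) \<and>
     (\<forall>y. 0 \<le> y \<longrightarrow> y \<notin> C \<longrightarrow> (\<forall>\<^sub>F k in sequentially. t k \<le> y))"

lemma ex_FN_above_iff:
  "(\<exists>i\<in>FN. \<forall>j\<in>FN. elts i \<subseteq> elts j \<longrightarrow> P j) \<longleftrightarrow> (\<forall>\<^sub>F k in sequentially. P (std k :: 'v))"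
  by (simp add: FN_eq_range_std eventually_sequentially std_subset_iff)

lemma ex_FN_after_iff:
  "(\<exists>i\<in>FN. \<forall>j\<in>FN. i \<epsilon> j \<longrightarrow> P j) \<longleftrightarrow> (\<forall>\<^sub>F k in sequentially. P (std k :: 'v))"
  by (simp add: FN_eq_range_std eventually_at_top_dense std_mem_iff)

lemma liminf_cut_iff:
  "y \<in> liminf_cut c \<longleftrightarrow> 0 \<le> y \<and> (\<forall>\<^sub>F k in sequentially. y < c (std k :: 'v) )"
proof -
  have "y \<in> liminf_cut c \<longleftrightarrow> (\<exists>i\<in>FN. \<forall>j\<in>FN. elts i \<subseteq> elts j \<longrightarrow> 0 \<le> y \<and> y < c j)"
    unfolding liminf_cut_def by auto
  then show ?thesis unfolding ex_FN_above_iff by (simp add: eventually_conj_iff)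
qed

lemma limsup_cut_iff:
  "y \<in> limsup_cut c \<longleftrightarrow> 0 \<le> y \<and> (\<exists>\<^sub>F k in sequentially. y < c (std k :: 'v))"
proof -
  have "y \<in> limsup_cut c \<longleftrightarrow> \<not> (\<exists>i\<in>FN. \<forall>j\<in>FN. elts i \<subseteq> elts j \<longrightarrow> \<not> (0 \<le> y \<and> y < c j))"
    unfolding limsup_cut_def by auto
  then show ?thesis unfolding ex_FN_above_iff frequently_def by (cases "0 \<le> y") simp_all
qed

text \<open>
  Indexing over \<open>FN\<close> is transferred to the HOL natural numbers through \<open>std\<close>.
\<close>

definition along_std :: "(nat \<Rightarrow> 'a) \<Rightarrow> 'v \<Rightarrow> 'a" where
  "along_std t v = t (inv std v)"

lemma along_std: "along_std t (std k) = t k"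
  unfolding along_std_def by (rule arg_cong[where f = t], rule inv_f_eq) (simp_all add: inj_def std_eq_iff)

lemma converges_cuts:
  fixes c :: "'v \<Rightarrow> 'q"
  assumes "converges (\<lambda>k. c (std k)) C" "C \<subseteq> {0..}"
  shows "liminf_cut c = C" "limsup_cut c = C"
proof -
  have "y \<in> liminf_cut c \<longleftrightarrow> y \<in> C \<and> True" "y \<in> limsup_cut c \<longleftrightarrow> y \<in> C" for y
  proof -
    have "y \<in> liminf_cut c" "y \<in> limsup_cut c" if "y \<in> C"
    proof -
      have *: "\<forall>\<^sub>F k in sequentially. y < c (std k)" using assms(1) that unfolding converges_def by blast
      then show "y \<in> liminf_cut c" "y \<in> limsup_cut c"
        using assms(2) that eventually_frequently[OF trivial_limit_sequentially *]
        by (auto simp: liminf_cut_iff limsup_cut_iff)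
    qed
    moreover have "y \<notin> liminf_cut c \<and> y \<notin> limsup_cut c" if "y \<notin> C"
    proof (cases "0 \<le> y")
      case True
      then have "\<forall>\<^sub>F k in sequentially. \<not> y < c (std k)"
        using assms(1) that unfolding converges_def by (simp add: not_less)
      then have "\<not> (\<exists>\<^sub>F k in sequentially. y < c (std k))" unfolding frequently_def by simp
      then show ?thesis
        using eventually_frequently[OF trivial_limit_sequentially] liminf_cut_iff limsup_cut_iff by blast
    next
      case False
      then show ?thesis by (simp add: liminf_cut_iff limsup_cut_iff)
    qed
    ultimately show "y \<in> liminf_cut c \<longleftrightarrow> y \<in> C \<and> True" "y \<in> limsup_cut c \<longleftrightarrow> y \<in> C" by blast+
  qed
  then show "liminf_cut c = C" "limsup_cut c = C" by blast+
qed

lemma cuts_converges: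
  fixes c :: "'v \<Rightarrow> 'q"
  assumes "liminf_cut c = C" "limsup_cut c = C"
  shows "converges (\<lambda>k. c (std k)) C"
  unfolding converges_def
proof (intro conjI ballI allI impI)
  fix y assume "y \<in> C"
  then show "\<forall>\<^sub>F k in sequentially. y < c (std k)" using liminf_cut_iff[of y c] assms by simp
next
  fix y :: 'q assume "0 \<le> y" "y \<notin> C"
  then have "\<not> (\<exists>\<^sub>F k in sequentially. y < c (std k))" using limsup_cut_iff[of y c] assms by simp
  then show "\<forall>\<^sub>F k in sequentially. c (std k) \<le> y" unfolding frequently_def by (simp add: not_less)
qed

definition cut_of_segment :: "'v set \<Rightarrow> 'q set" where
  "cut_of_segment I = (\<Union>n\<in>I. {0..<\<iota> n})"

lemma lower_cut_eq: "lower_cut \<iota> X = cut_of_segment (lower_segment X)"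
  unfolding lower_cut_def cut_of_segment_def lower_segment_def by (simp add: set_eq_iff) blast

lemma upper_cut_eq: "upper_cut \<iota> X = cut_of_segment (upper_segment X)"
  unfolding upper_cut_def cut_of_segment_def upper_segment_def by (simp add: set_eq_iff) blast

lemma converges_const: "converges (\<lambda>_. q) {0..<q}"
  unfolding converges_def by auto

text \<open>
  Unless the cut is \<open>Q\<langle>n\<rangle>\<close> for a natural number \<open>n\<close>, the segment is closed under successors, so that
  rationals may be replaced by their floors.  Then the partial maxima of the numbers with union \<open>I\<close>,
  or the partial minima of those with intersection \<open>I\<close>, converge to the cut.
\<close>

lemma ex_converges_segment:
  assumes I: "segment I" and c: "countable_segment I"
  obtains t where "range t \<subseteq> \<iota> ` NN" "converges t (cut_of_segment I)"
proof (cases "\<exists>n\<in>NN. cut_of_segment I = {0..<\<iota> n}")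
  case True
  then obtain n where n: "n \<in> NN" "cut_of_segment I = {0..<\<iota> n}" by blast
  show ?thesis by (rule that[of "\<lambda>_. \<iota> n"]) (use n converges_const in auto)
next
  case False
  have IN: "I \<subseteq> NN" using I unfolding segment_def by blast
  have succ: "succ n \<in> I" if "n \<in> I" for n
  proof (rule ccontr)
    assume "succ n \<notin> I"
    have "\<iota> m \<le> \<iota> n" if m: "m \<in> I" for m
    proof -
      have "\<not> n \<epsilon> m"
      proof
        assume "n \<epsilon> m"
        then have "succ n = m \<or> succ n \<epsilon> m"
          using succ_le_NN IN m by blast
        then show False using I m \<open>succ n \<notin> I\<close> unfolding segment_def by blast
      qed
      then show ?thesis using iota_less[of n m] IN m \<open>n \<in> I\<close> by (simp add: subset_iff not_less)
    qed
    then have "cut_of_segment I = {0..<\<iota> n}"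
      unfolding cut_of_segment_def using that by force
    then show False using False IN that by blast
  qed
  have floor_notin: "\<exists>n\<in>NN. n \<notin> I \<and> \<iota> n \<le> y" if y: "0 \<le> y" "y \<notin> cut_of_segment I" for y
  proof -
    obtain n where n: "n \<in> NN" "\<iota> n \<le> y" "y < \<iota> n + 1" using iota_floor[OF y(1)] by blast
    have "n \<notin> I"
    proof
      assume "n \<in> I"
      then have "y < \<iota> (succ n)" "succ n \<in> I" using n iota_succ succ by auto
      then show False using y unfolding cut_of_segment_def by auto
    qed
    then show ?thesis using n by blast
  qed
  obtain t :: "nat \<Rightarrow> 'v" where tN: "\<And>k. t k \<in> NN"
    and t: "I = (\<Union>k. elts (t k)) \<or> I = (\<Inter>k. elts (t k))"
    using c unfolding countable_segment_def by metis
  from t show ?thesis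
  proof
    assume t: "I = (\<Union>k. elts (t k))"
    let ?t = "\<lambda>k. Max ((\<lambda>j. \<iota> (t j)) ` {..k})"
    have "?t k \<in> (\<lambda>j. \<iota> (t j)) ` {..k}" for k by (rule Max_in) auto
    then have "range ?t \<subseteq> \<iota> ` NN" using tN by blast
    moreover have "converges ?t (cut_of_segment I)"
      unfolding converges_def
    proof (intro conjI ballI allI impI)
      fix y assume "y \<in> cut_of_segment I"
      then obtain n j where n: "y < \<iota> n" "n \<epsilon> t j" unfolding cut_of_segment_def t by (auto simp: mem_elts)
      then have "\<iota> n < \<iota> (t j)" using iota_less NN_mem tN by blast
      moreover have "\<iota> (t j) \<le> ?t k" if "j \<le> k" for k using that by (intro Max_ge) auto
      ultimately show "\<forall>\<^sub>F k in sequentially. y < ?t k"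
        unfolding eventually_sequentially using n(1) by (meson less_le_trans less_trans)
    next
      fix y :: 'q assume y: "0 \<le> y" "y \<notin> cut_of_segment I"
      have "\<iota> (t j) \<le> y" for j
      proof -
        obtain n where n: "n \<in> NN" "n \<notin> I" "\<iota> n \<le> y" using floor_notin[OF y] by blast
        then have "\<not> n \<epsilon> t j" using t by (auto simp: mem_elts)
        then show ?thesis using iota_less[of n "t j"] n tN by force
      qed
      then show "\<forall>\<^sub>F k in sequentially. ?t k \<le> y" by (intro always_eventually) auto
    qed
    ultimately show ?thesis using that by blast
  next
    assume t: "I = (\<Inter>k. elts (t k))"
    let ?t = "\<lambda>k. Min ((\<lambda>j. \<iota> (t j)) ` {..k})"
    have "?t k \<in> (\<lambda>j. \<iota> (t j)) ` {..k}" for k by (rule Min_in) auto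
    then have "range ?t \<subseteq> \<iota> ` NN" using tN by blast
    moreover have "converges ?t (cut_of_segment I)"
      unfolding converges_def
    proof (intro conjI ballI allI impI)
      fix y assume "y \<in> cut_of_segment I"
      then obtain n where n: "y < \<iota> n" "n \<in> I" unfolding cut_of_segment_def by auto
      have "y < \<iota> (t j)" for j
      proof -
        have "n \<epsilon> t j" using n(2) t by (auto simp: mem_elts)
        then show ?thesis using iota_less[of n "t j"] NN_mem tN n(1) by force
      qed
      then show "\<forall>\<^sub>F k in sequentially. y < ?t k" by (intro always_eventually) auto
    next
      fix y :: 'q assume y: "0 \<le> y" "y \<notin> cut_of_segment I"
      obtain n where n: "n \<in> NN" "n \<notin> I" "\<iota> n \<le> y" using floor_notin[OF y] by blast
      then obtain j where "\<not> n \<epsilon> t j" using t by (auto simp: mem_elts)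
      then have "\<iota> (t j) \<le> y" using iota_less[of n "t j"] n tN by force
      moreover have "?t k \<le> \<iota> (t j)" if "j \<le> k" for k using that by (intro Min_le) auto
      ultimately show "\<forall>\<^sub>F k in sequentially. ?t k \<le> y"
        unfolding eventually_sequentially by (meson order_trans)
    qed
    ultimately show ?thesis using that by blast
  qed
qed

lemma frequently_parity:
  assumes "\<forall>\<^sub>F k in sequentially. P k"
  shows "\<exists>\<^sub>F k in sequentially. P k \<and> even k" "\<exists>\<^sub>F k in sequentially. P k \<and> odd k"
proof -
  obtain N where N: "\<And>k. N \<le> k \<Longrightarrow> P k" using assms unfolding eventually_sequentially by blast
  show "\<exists>\<^sub>F k in sequentially. P k \<and> even k"
    unfolding frequently_sequentially
  proof
    fix m show "\<exists>n\<ge>m. P n \<and> even n" using N[of "2 * (N + m)"] by (intro exI[of _ "2 * (N + m)"]) auto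
  qed
  show "\<exists>\<^sub>F k in sequentially. P k \<and> odd k"
    unfolding frequently_sequentially
  proof
    fix m show "\<exists>n\<ge>m. P n \<and> odd n" using N[of "2 * (N + m) + 1"] by (intro exI[of _ "2 * (N + m) + 1"]) auto
  qed
qed

text \<open>
  The lower limit of the merged sequence is governed by the terms converging to the smaller cut,
  the upper limit by those converging to the larger one.
\<close>

lemma interleave_cuts:
  fixes w :: "'v \<Rightarrow> 'q"
  assumes t: "converges t L" "converges u U" and sub: "L \<subseteq> U" "U \<subseteq> {0..}"
    and w: "\<And>k. w (std k) = (if even k then t k else u k)"
  shows "liminf_cut w = L" "limsup_cut w = U"
proof -
  have "y \<in> liminf_cut w \<longleftrightarrow> y \<in> L" "y \<in> limsup_cut w \<longleftrightarrow> y \<in> U" if y: "0 \<le> y" for y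
  proof -
    show "y \<in> liminf_cut w \<longleftrightarrow> y \<in> L"
    proof
      assume "y \<in> L"
      then have "\<forall>\<^sub>F k in sequentially. y < t k" "\<forall>\<^sub>F k in sequentially. y < u k"
        using t sub unfolding converges_def by blast+
      then have "\<forall>\<^sub>F k in sequentially. y < w (std k)" by eventually_elim (simp add: w)
      then show "y \<in> liminf_cut w" using y by (simp add: liminf_cut_iff)
    next
      assume "y \<in> liminf_cut w"
      then have *: "\<forall>\<^sub>F k in sequentially. y < w (std k)" by (simp add: liminf_cut_iff)
      show "y \<in> L"
      proof (rule ccontr)
        assume "y \<notin> L"
        then have "\<forall>\<^sub>F k in sequentially. t k \<le> y" using t y unfolding converges_def by blast
        with * have "\<forall>\<^sub>F k in sequentially. y < w (std k) \<and> t k \<le> y" by (rule eventually_conj)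
        from frequently_ex[OF frequently_parity(1)[OF this]] show False by (auto simp: w)
      qed
    qed
    show "y \<in> limsup_cut w \<longleftrightarrow> y \<in> U"
    proof
      assume "y \<in> U"
      then have "\<forall>\<^sub>F k in sequentially. y < u k" using t unfolding converges_def by blast
      from frequently_parity(2)[OF this] have "\<exists>\<^sub>F k in sequentially. y < w (std k)"
        by (rule frequently_elim1) (simp add: w)
      then show "y \<in> limsup_cut w" using y by (simp add: limsup_cut_iff)
    next
      assume "y \<in> limsup_cut w"
      then have *: "\<exists>\<^sub>F k in sequentially. y < w (std k)" by (simp add: limsup_cut_iff)
      show "y \<in> U"
      proof (rule ccontr)
        assume "y \<notin> U"
        then have "\<forall>\<^sub>F k in sequentially. t k \<le> y" "\<forall>\<^sub>F k in sequentially. u k \<le> y"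
          using t y sub unfolding converges_def by blast+
        then have "\<forall>\<^sub>F k in sequentially. \<not> y < w (std k)" by eventually_elim (simp add: w)
        then show False using * unfolding frequently_def by blast
      qed
    qed
  qed
  then show "liminf_cut w = L" "limsup_cut w = U"
    using sub unfolding set_eq_iff by (metis (full_types) atLeast_iff liminf_cut_iff limsup_cut_iff subsetD)+
qed

lemma ex_approximating_sequence:
  assumes "A \<in> Borel_semisets"
  shows "\<exists>c. approximating_sequence \<iota> c A"
proof -
  obtain a where A: "countably_determined A" "A \<subseteq> elts a"
    using assms sigma_pi_countably_determined unfolding Borel_semisets_def Borel_def semiset_def by blast
  obtain t where t: "range t \<subseteq> \<iota> ` NN" "converges t (lower_cut \<iota> A)"
    using ex_converges_segment[OF segment_lower_segment countable_lower_segment[OF A]] lower_cut_eq by metis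
  obtain u where u: "range u \<subseteq> \<iota> ` NN" "converges u (upper_cut \<iota> A)"
    using ex_converges_segment[OF segment_upper_segment countable_upper_segment[OF A]] upper_cut_eq by metis
  have "lower_segment A \<subseteq> upper_segment A"
  proof
    fix n assume "n \<in> lower_segment A"
    then obtain v where v: "n \<in> NN" "elts v \<subseteq> A" "strictly_subvalent n v"
      unfolding lower_segment_def by blast
    then have "strictly_subvalent n w" if "A \<subseteq> elts w" for w
      using strictly_subvalent_mono[of n v n w] that by blast
    then show "n \<in> upper_segment A" using v unfolding upper_segment_def by blast
  qed
  then have sub: "lower_cut \<iota> A \<subseteq> upper_cut \<iota> A" "upper_cut \<iota> A \<subseteq> {0..}"
    unfolding lower_cut_eq upper_cut_eq cut_of_segment_def by auto
  define w where "w = along_std (\<lambda>k. if even k then t k else u k)"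
  have w: "w (std k) = (if even k then t k else u k)" for k
    unfolding w_def by (rule along_std)
  have "w i \<in> \<iota> ` NN" if i: "i \<in> FN" for i
  proof -
    obtain k where "i = std k" using i unfolding FN_eq_range_std by blast
    moreover have "t k \<in> \<iota> ` NN" "u k \<in> \<iota> ` NN" using t(1) u(1) by blast+
    ultimately show ?thesis using w[of k] by simp
  qed
  then show ?thesis
    unfolding approximating_sequence_def using interleave_cuts[OF t(2) u(2) sub w]
    by (intro exI[of _ w]) simp
qed

lemma ex_BAF: "\<exists>F. BAF \<iota> F"
proof -
  have "\<forall>A. \<exists>c. A \<in> Borel_semisets \<longrightarrow> approximating_sequence \<iota> c A"
    using ex_approximating_sequence by blast
  then show ?thesis unfolding BAF_def by metis
qed

text \<open>
  Only the value at \<open>B\<close> of some Borel approximating function is changed.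
\<close>

lemma ex_BAF_prescribed:
  assumes "has_cut \<iota> B C" "range b \<subseteq> \<iota> ` NN" "converges b C"
  obtains F where "BAF \<iota> F" "\<And>k. F B (std k) = b k"
proof -
  obtain F where F: "BAF \<iota> F" using ex_BAF by blast
  have "C \<subseteq> {0..}" using assms(1) unfolding has_cut_def lower_cut_def by auto
  moreover have "(\<lambda>k. along_std b (std k)) = b" by (simp add: along_std)
  ultimately have "liminf_cut (along_std b) = C" "limsup_cut (along_std b) = C"
    using converges_cuts[of "along_std b" C] assms(3) by simp_all
  moreover have "along_std b i \<in> \<iota> ` NN" for i using assms(2) unfolding along_std_def by blast
  ultimately have "approximating_sequence \<iota> (along_std b) B"
    using assms(1) unfolding approximating_sequence_def has_cut_def by simp
  then have "BAF \<iota> (F(B := along_std b))" using F unfolding BAF_def by simp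
  then show ?thesis using that[of "F(B := along_std b)"] by (simp add: along_std)
qed

end

section \<open>Limits of ratios\<close>

context ast_rationals begin

lemma BQ_iff: "x \<in> BQ \<iota> \<longleftrightarrow> (\<exists>n::nat. \<bar>x\<bar> \<le> of_nat n)"
  unfolding BQ_def FN_eq_range_std by (simp add: iota_std)

lemma rat_doteq_iff:
  "rat_doteq \<iota> p q \<longleftrightarrow>
     (p \<in> BQ \<iota> \<and> q \<in> BQ \<iota> \<and> (\<forall>n::nat. 0 < n \<longrightarrow> \<bar>p - q\<bar> < 1 / of_nat n)) \<or>
     (\<forall>n::nat. of_nat n < p \<and> of_nat n < q) \<or> (\<forall>n::nat. p < - of_nat n \<and> q < - of_nat n)"
  unfolding rat_doteq_def FN_eq_range_std by (simp add: iota_std)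

lemma FQ_iff:
  "q \<in> FQ \<iota> \<longleftrightarrow> (\<exists>a b::nat. b \<noteq> 0 \<and> (q = of_nat a / of_nat b \<or> q = - (of_nat a / of_nat b)))"
  unfolding FQ_def FN_eq_range_std by (simp add: iota_std)

lemma FQ_intros: "of_nat n \<in> FQ \<iota>" "- of_nat n \<in> FQ \<iota>" "1 / of_nat n \<in> FQ \<iota>"
proof -
  have "of_nat n = (of_nat n / of_nat 1 :: 'q)" by simp
  then show *: "of_nat n \<in> FQ \<iota>" "- of_nat n \<in> FQ \<iota>" unfolding FQ_iff by (metis one_neq_zero)+
  show "1 / of_nat n \<in> FQ \<iota>"
  proof (cases "n = 0")
    case True
    then show ?thesis using * by simp
  next
    case False
    have "1 / of_nat n = (of_nat 1 / of_nat n :: 'q)" by simp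
    then show ?thesis unfolding FQ_iff using False by metis
  qed
qed

lemma FQ_bounds:
  assumes "q \<in> FQ \<iota>"
  shows "\<exists>n::nat. \<bar>q\<bar> \<le> of_nat n" and "q \<noteq> 0 \<Longrightarrow> \<exists>n::nat. 0 < n \<and> 1 / of_nat n \<le> \<bar>q\<bar>"
proof -
  obtain a b :: nat where b0: "b \<noteq> 0" and "q = of_nat a / of_nat b \<or> q = - (of_nat a / of_nat b)"
    using assms unfolding FQ_iff by blast
  then have q: "\<bar>q\<bar> = of_nat a / of_nat b" by auto
  have b: "(1::'q) \<le> of_nat b" using b0 by (cases b) simp_all
  have "\<bar>q\<bar> \<le> of_nat a / 1" unfolding q using b by (intro divide_left_mono) simp_all
  then show "\<exists>n::nat. \<bar>q\<bar> \<le> of_nat n" by auto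
  assume "q \<noteq> 0"
  then have "a \<noteq> 0" using q by (cases "a = 0") simp_all
  then have "(1::'q) \<le> of_nat a" by (cases a) simp_all
  then have "1 / of_nat b \<le> \<bar>q\<bar>" unfolding q using b by (intro divide_right_mono) simp_all
  then show "\<exists>n::nat. 0 < n \<and> 1 / of_nat n \<le> \<bar>q\<bar>" using b0 by blast
qed

lemma lim_mon_iff:
  "lim_mon \<iota> a x \<longleftrightarrow>
     (\<forall>n::nat. 0 < n \<longrightarrow> (\<forall>\<^sub>F k in sequentially. \<bar>a (std k) - x\<bar> < 1 / of_nat n)) \<or>
     ((\<forall>n::nat. of_nat n < x) \<and> (\<forall>n::nat. \<forall>\<^sub>F k in sequentially. of_nat n < a (std k))) \<or>
     ((\<forall>n::nat. x < - of_nat n) \<and> (\<forall>n::nat. \<forall>\<^sub>F k in sequentially. a (std k) < - of_nat n))"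
proof -
  have 1: "(\<forall>q\<in>FQ \<iota>. q \<noteq> 0 \<longrightarrow> (\<forall>\<^sub>F k in sequentially. \<bar>a (std k) - x\<bar> < \<bar>q\<bar>)) \<longleftrightarrow>
      (\<forall>n::nat. 0 < n \<longrightarrow> (\<forall>\<^sub>F k in sequentially. \<bar>a (std k) - x\<bar> < 1 / of_nat n))" (is "?L \<longleftrightarrow> ?R")
  proof
    assume L: ?L
    show ?R
    proof (intro allI impI)
      fix n :: nat assume "0 < n"
      then show "\<forall>\<^sub>F k in sequentially. \<bar>a (std k) - x\<bar> < 1 / of_nat n"
        using L[rule_format, OF FQ_intros(3)[of n]] by simp
    qed
  next
    assume R: ?R
    show ?L
    proof (intro ballI impI)
      fix q assume "q \<in> FQ \<iota>" "q \<noteq> 0"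
      then obtain n :: nat where n: "0 < n" "1 / of_nat n \<le> \<bar>q\<bar>" using FQ_bounds(2) by blast
      from R n(1) have "\<forall>\<^sub>F k in sequentially. \<bar>a (std k) - x\<bar> < 1 / of_nat n" by blast
      then show "\<forall>\<^sub>F k in sequentially. \<bar>a (std k) - x\<bar> < \<bar>q\<bar>"
        by eventually_elim (use n(2) in linarith)
    qed
  qed
  have le: "\<exists>n::nat. q \<le> of_nat n \<and> - of_nat n \<le> q" if "q \<in> FQ \<iota>" for q
    using FQ_bounds(1)[OF that] by (auto simp: abs_le_iff minus_le_iff)
  have 2: "(\<forall>q\<in>FQ \<iota>. q < y) \<longleftrightarrow> (\<forall>n::nat. of_nat n < y)" for y
    using le FQ_intros(1) by (meson le_less_trans)
  have 3: "(\<forall>q\<in>FQ \<iota>. y < q) \<longleftrightarrow> (\<forall>n::nat. y < - of_nat n)" for y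
    using le FQ_intros(2) by (meson less_le_trans)
  have 4: "(\<forall>q\<in>FQ \<iota>. \<forall>\<^sub>F k in sequentially. q < a (std k)) \<longleftrightarrow>
      (\<forall>n::nat. \<forall>\<^sub>F k in sequentially. of_nat n < a (std k))"
  proof (intro iffI allI ballI)
    fix q assume R: "\<forall>n::nat. \<forall>\<^sub>F k in sequentially. of_nat n < a (std k)" and "q \<in> FQ \<iota>"
    then obtain n :: nat where n: "q \<le> of_nat n" using le by blast
    from R have "\<forall>\<^sub>F k in sequentially. of_nat n < a (std k)" by blast
    then show "\<forall>\<^sub>F k in sequentially. q < a (std k)" by eventually_elim (use n in simp)
  qed (use FQ_intros(1) in blast)
  have 5: "(\<forall>q\<in>FQ \<iota>. \<forall>\<^sub>F k in sequentially. a (std k) < q) \<longleftrightarrow>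
      (\<forall>n::nat. \<forall>\<^sub>F k in sequentially. a (std k) < - of_nat n)"
  proof (intro iffI allI ballI)
    fix q assume R: "\<forall>n::nat. \<forall>\<^sub>F k in sequentially. a (std k) < - of_nat n" and "q \<in> FQ \<iota>"
    then obtain n :: nat where n: "- of_nat n \<le> q" using le by blast
    from R have "\<forall>\<^sub>F k in sequentially. a (std k) < - of_nat n" by blast
    then show "\<forall>\<^sub>F k in sequentially. a (std k) < q" by eventually_elim (use n in simp)
  qed (use FQ_intros(2) in blast)
  show ?thesis unfolding lim_mon_def ex_FN_after_iff 1 2 3 4 5 ..
qed

lemma inverse_of_nat_half: "0 < n \<Longrightarrow> 1 / of_nat (2 * n) + 1 / of_nat (2 * n) = (1 / of_nat n :: 'q)"
  by (simp add: field_simps)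

text \<open>
  If \<open>p\<close> is infinite, then so is \<open>q\<close>, with the same sign.
\<close>

lemma rat_doteq_close:
  assumes c: "\<And>n::nat. 0 < n \<Longrightarrow> \<bar>p - q\<bar> < 1 / of_nat n"
  shows "rat_doteq \<iota> p q"
proof -
  have c1: "\<bar>p - q\<bar> < 1" using c[of 1] by simp
  have bound: "\<exists>m::nat. \<bar>v\<bar> \<le> of_nat m" if "\<bar>u - v\<bar> < 1" "\<bar>u\<bar> \<le> of_nat n" for u v :: 'q and n
    by (rule exI[of _ "Suc n"]) (use that in \<open>simp; linarith\<close>)
  show ?thesis
  proof (cases "p \<in> BQ \<iota>")
    case True
    then have "q \<in> BQ \<iota>" unfolding BQ_iff using bound[OF c1] by blast
    then show ?thesis unfolding rat_doteq_iff using True c by blast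
  next
    case False
    have *: "of_nat n < \<bar>p\<bar>" for n :: nat using False unfolding BQ_iff by (auto simp: not_le)
    show ?thesis
    proof (cases "0 \<le> p")
      case True
      have "of_nat n < p \<and> of_nat n < q" for n :: nat
        using *[of "Suc n"] c1 True by (simp; linarith)
      then show ?thesis unfolding rat_doteq_iff by blast
    next
      case False
      have "p < - of_nat n \<and> q < - of_nat n" for n :: nat
        using *[of "Suc n"] c1 False by (simp; linarith)
      then show ?thesis unfolding rat_doteq_iff by blast
    qed
  qed
qed

lemma rat_doteq_sym: "rat_doteq \<iota> p q \<Longrightarrow> rat_doteq \<iota> q p"
  unfolding rat_doteq_iff by (auto simp: abs_minus_commute)

lemma rat_doteq_trans:
  assumes "rat_doteq \<iota> p q" and "rat_doteq \<iota> q r"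
  shows "rat_doteq \<iota> p r"
proof -
  have nb: "q \<notin> BQ \<iota>" if "(\<forall>n::nat. of_nat n < q) \<or> (\<forall>n::nat. q < - of_nat n)"
    using that unfolding BQ_iff by (auto simp: abs_le_iff not_le minus_le_iff intro: less_imp_le) (meson leD less_minus_iff)+
  have pm: "\<not> ((\<forall>n::nat. of_nat n < q) \<and> (\<forall>n::nat. q < - of_nat n))"
    by (metis less_asym of_nat_0 neg_0_less_iff_less minus_zero)
  show ?thesis
  proof (cases "q \<in> BQ \<iota>")
    case True
    then have pq: "\<And>n::nat. 0 < n \<Longrightarrow> \<bar>p - q\<bar> < 1 / of_nat n"
      and qr: "\<And>n::nat. 0 < n \<Longrightarrow> \<bar>q - r\<bar> < 1 / of_nat n"
      using assms nb unfolding rat_doteq_iff by blast+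
    show ?thesis
    proof (rule rat_doteq_close)
      fix n :: nat assume n: "0 < n"
      show "\<bar>p - r\<bar> < 1 / of_nat n"
        using pq[of "2 * n"] qr[of "2 * n"] inverse_of_nat_half[OF n] n by linarith
    qed
  next
    case False
    then show ?thesis using assms pm unfolding rat_doteq_iff by blast
  qed
qed

lemma mon_eqI: "rat_doteq \<iota> p q \<Longrightarrow> mon \<iota> p = mon \<iota> q"
  unfolding mon_def using rat_doteq_sym rat_doteq_trans by blast

text \<open>
  The limit determines its monad, which makes the description in \<open>kalina_measure\<close> proper.
\<close>

lemma lim_mon_unique:
  assumes x: "lim_mon \<iota> a x" and y: "lim_mon \<iota> a y"
  shows "rat_doteq \<iota> x y"
proof -
  let ?near = "\<lambda>x. \<forall>n::nat. 0 < n \<longrightarrow> (\<forall>\<^sub>F k in sequentially. \<bar>a (std k) - x\<bar> < 1 / of_nat n)"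
  let ?top = "\<forall>n::nat. \<forall>\<^sub>F k in sequentially. of_nat n < a (std k)"
  let ?bot = "\<forall>n::nat. \<forall>\<^sub>F k in sequentially. a (std k) < - of_nat n"
  have ev: P if "\<forall>\<^sub>F k in sequentially. P" for P
    using that by (simp add: eventually_const_iff)
  have near_near: "rat_doteq \<iota> x y" if x: "?near x" and y: "?near y" for x y
  proof (rule rat_doteq_close)
    fix n :: nat assume n: "0 < n"
    then have "0 < 2 * n" by simp
    then have "\<forall>\<^sub>F k in sequentially. \<bar>a (std k) - x\<bar> < 1 / of_nat (2 * n)"
      "\<forall>\<^sub>F k in sequentially. \<bar>a (std k) - y\<bar> < 1 / of_nat (2 * n)"
      using x y by blast+
    then have "\<forall>\<^sub>F k in sequentially. \<bar>x - y\<bar> < 1 / of_nat n"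
    proof eventually_elim
      case (elim k)
      then show ?case using inverse_of_nat_half[OF n] by linarith
    qed
    then show "\<bar>x - y\<bar> < 1 / of_nat n" by (rule ev)
  qed
  have near_top: "of_nat n < x" if x: "?near x" and ?top for x and n :: nat
  proof -
    have "\<forall>\<^sub>F k in sequentially. \<bar>a (std k) - x\<bar> < 1"
      using x[rule_format, of 1] by simp
    moreover have "\<forall>\<^sub>F k in sequentially. of_nat (Suc n) < a (std k)" using \<open>?top\<close> by blast
    ultimately have "\<forall>\<^sub>F k in sequentially. of_nat n < x"
    proof eventually_elim
      case (elim k)
      then show ?case by (simp; linarith)
    qed
    then show ?thesis by (rule ev)
  qed
  have near_bot: "x < - of_nat n" if x: "?near x" and ?bot for x and n :: nat
  proof -
    have "\<forall>\<^sub>F k in sequentially. \<bar>a (std k) - x\<bar> < 1"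
      using x[rule_format, of 1] by simp
    moreover have "\<forall>\<^sub>F k in sequentially. a (std k) < - of_nat (Suc n)" using \<open>?bot\<close> by blast
    ultimately have "\<forall>\<^sub>F k in sequentially. x < - of_nat n"
    proof eventually_elim
      case (elim k)
      then show ?case by (simp; linarith)
    qed
    then show ?thesis by (rule ev)
  qed
  have top_bot: False if ?top ?bot
  proof -
    have "\<forall>\<^sub>F k in sequentially. of_nat 0 < a (std k)" "\<forall>\<^sub>F k in sequentially. a (std k) < - of_nat 0"
      using that by blast+
    then have "\<forall>\<^sub>F k in sequentially. False" by eventually_elim simp
    then show False by (rule ev)
  qed
  show ?thesis
    using x[unfolded lim_mon_iff] y[unfolded lim_mon_iff] near_near[of x y] near_top[of x] near_top[of y]
      near_bot[of x] near_bot[of y] top_bot unfolding rat_doteq_iff[of x y] by metis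
qed

lemma kalina_measure_eq:
  assumes x: "lim_mon \<iota> (\<lambda>i. F B i / s i) x"
  shows "kalina_measure \<iota> s F B = mon \<iota> x"
  unfolding kalina_measure_def
proof (rule the_equality)
  show "\<exists>y. mon \<iota> x = mon \<iota> y \<and> lim_mon \<iota> (\<lambda>i. F B i / s i) y" using x by blast
  fix r assume "\<exists>y. r = mon \<iota> y \<and> lim_mon \<iota> (\<lambda>i. F B i / s i) y"
  then obtain y where "r = mon \<iota> y" "lim_mon \<iota> (\<lambda>i. F B i / s i) y" by blast
  then show "r = mon \<iota> x" using mon_eqI[OF lim_mon_unique[OF _ x]] by simp
qed

lemma mem_inv_FN_cut: "y \<in> inv_FN_cut \<iota> \<longleftrightarrow> 0 \<le> y \<and> (\<forall>n::nat. 0 < n \<longrightarrow> y < 1 / of_nat n)"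
proof -
  have "y \<in> inv_FN_cut \<iota> \<longleftrightarrow> (\<forall>n\<in>range std. 0 < \<iota> n \<longrightarrow> y \<in> {0..<1 / \<iota> n})"
    unfolding inv_FN_cut_def FN_eq_range_std by blast
  also have "\<dots> \<longleftrightarrow> (\<forall>n::nat. 0 < n \<longrightarrow> 0 \<le> y \<and> y < 1 / of_nat n)"
    by (simp add: iota_std)
  finally show ?thesis by (metis zero_less_one)
qed

lemma mem_FN_cut: "y \<in> FN_cut \<iota> \<longleftrightarrow> 0 \<le> y \<and> (\<exists>n::nat. y < of_nat n)"
  unfolding FN_cut_def FN_eq_range_std by (auto simp: iota_std)

text \<open>
  Every element of the upper limit is less than \<open>x + 1 / n\<close>, while the elements subtracted in
  \<open>\<ominus>\<close> come as close to \<open>x\<close> as \<open>x - 1 / n\<close>.  If \<open>x - 1 / n\<close> is negative, the lower limit may be empty;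
  then the minimum \<open>0\<close> of its complement, which \<open>\<ominus>\<close> takes into account, is such an element.
\<close>

lemma cut_doteq_near:
  fixes c :: "'v \<Rightarrow> 'q"
  assumes near: "\<And>n::nat. 0 < n \<Longrightarrow> \<forall>\<^sub>F k in sequentially. \<bar>c (std k) - x\<bar> < 1 / of_nat n"
  shows "cut_doteq \<iota> (liminf_cut c) (limsup_cut c)"
proof -
  let ?L = "liminf_cut c" and ?U = "limsup_cut c"
  let ?min = "\<lambda>A. A \<union> {m\<in>{0..} - A. \<forall>y\<in>{0..} - A. m \<le> y}"
  have LU: "?L \<subseteq> ?U"
    unfolding subset_iff liminf_cut_iff limsup_cut_iff
    using eventually_frequently[OF trivial_limit_sequentially] by blast
  have up: "y < x + 1 / of_nat n" if y: "y \<in> ?U" and n: "0 < n" for y and n :: nat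
  proof -
    have "\<exists>\<^sub>F k in sequentially. y < c (std k)" using y by (simp add: limsup_cut_iff)
    from frequently_eventually_frequently[OF this near[OF n]]
    have "\<exists>k. y < c (std k) \<and> \<bar>c (std k) - x\<bar> < 1 / of_nat n" by (rule frequently_ex)
    then show ?thesis by (auto simp: abs_less_iff)
  qed
  have down: "\<exists>b\<in>?min A. x - 1 / of_nat n \<le> b" if A: "?L \<subseteq> A" "A = {} \<or> 0 \<in> A" and n: "0 < n" for A and n :: nat
  proof (cases "0 \<le> x - 1 / of_nat n")
    case True
    have "\<forall>\<^sub>F k in sequentially. x - 1 / of_nat n < c (std k)"
      using near[OF n] by eventually_elim (auto simp: abs_less_iff)
    then have "x - 1 / of_nat n \<in> ?L" using True by (simp add: liminf_cut_iff)
    then show ?thesis using A(1) by blast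
  next
    case False
    have "0 \<in> ?min A" using A(2) by auto
    then show ?thesis using False by (intro bexI[of _ 0]) auto
  qed
  have small: "y \<in> inv_FN_cut \<iota>" if y: "0 \<le> y" "\<forall>b\<in>?min A. y + b \<in> ?U"
    and A: "?L \<subseteq> A" "A = {} \<or> 0 \<in> A" for y A
    unfolding mem_inv_FN_cut
  proof (intro conjI allI impI y(1))
    fix n :: nat assume n: "0 < n"
    then have n2: "0 < 2 * n" by simp
    obtain b where b: "b \<in> ?min A" "x - 1 / of_nat (2 * n) \<le> b" using down[OF A n2] by (rule bexE)
    have "y + b < x + 1 / of_nat (2 * n)" using up[OF _ n2] y(2) b(1) by blast
    then show "y < 1 / of_nat n" using b(2) inverse_of_nat_half[OF n] by linarith
  qed
  have "0 \<in> ?L" if "y \<in> ?L" for y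
    using that unfolding liminf_cut_iff by (auto elim: eventually_mono)
  then have L0: "?L = {} \<or> 0 \<in> ?L" by blast
  have "0 \<in> ?U" if "y \<in> ?U" for y
    using that unfolding limsup_cut_iff by (auto elim: frequently_elim1)
  then have U0: "?U = {} \<or> 0 \<in> ?U" by blast
  have "?L \<ominus> ?U \<subseteq> inv_FN_cut \<iota>"
  proof
    fix y assume "y \<in> ?L \<ominus> ?U"
    then have "0 \<le> y" "\<forall>b\<in>?min ?U. y + b \<in> ?U" using LU unfolding internal_diff_def by blast+
    then show "y \<in> inv_FN_cut \<iota>" by (rule small[OF _ _ LU U0])
  qed
  moreover have "?U \<ominus> ?L \<subseteq> inv_FN_cut \<iota>"
  proof
    fix y assume "y \<in> ?U \<ominus> ?L"
    then have "0 \<le> y" "\<forall>b\<in>?min ?L. y + b \<in> ?U" unfolding internal_diff_def by blast+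
    then show "y \<in> inv_FN_cut \<iota>" by (rule small[OF _ _ subset_refl L0])
  qed
  ultimately show ?thesis unfolding cut_doteq_def by blast
qed

lemma cut_doteq_infinite:
  fixes c :: "'v \<Rightarrow> 'q"
  assumes "\<And>n::nat. \<forall>\<^sub>F k in sequentially. of_nat n < c (std k)"
  shows "cut_doteq \<iota> (liminf_cut c) (limsup_cut c)"
proof -
  have "y \<in> liminf_cut c \<inter> limsup_cut c" if y: "y \<in> FN_cut \<iota>" for y
  proof -
    obtain n :: nat where n: "0 \<le> y" "y < of_nat n" using y unfolding mem_FN_cut by blast
    have *: "\<forall>\<^sub>F k in sequentially. y < c (std k)"
      using assms[of n] by eventually_elim (use n in simp)
    then show ?thesis
      using n eventually_frequently[OF trivial_limit_sequentially *]
      by (simp add: liminf_cut_iff limsup_cut_iff)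
  qed
  then show ?thesis unfolding cut_doteq_def by blast
qed

text \<open>
  The limits are \<open>Q\<langle>1\<rangle>\<close> and \<open>Q\<langle>2\<rangle>\<close>, whose difference contains the noninfinitesimal \<open>1 / 2\<close>.
\<close>

lemma not_cut_doteq_alternating:
  fixes c :: "'v \<Rightarrow> 'q"
  assumes c: "\<forall>\<^sub>F k in sequentially. c (std k) = (if even k then 1 else 2)"
  shows "\<not> cut_doteq \<iota> (liminf_cut c) (limsup_cut c)"
proof -
  let ?w = "along_std (\<lambda>k. if even k then 1 else 2 :: 'q)"
  have eq: "\<forall>\<^sub>F k in sequentially. c (std k) = ?w (std k)"
    using c by eventually_elim (simp add: along_std)
  have e1: "(\<forall>\<^sub>F k in sequentially. y < c (std k)) \<longleftrightarrow> (\<forall>\<^sub>F k in sequentially. y < ?w (std k))" for y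
    by (rule eventually_cong[OF eq]) simp
  have e2: "(\<exists>\<^sub>F k in sequentially. y < c (std k)) \<longleftrightarrow> (\<exists>\<^sub>F k in sequentially. y < ?w (std k))" for y
    by (rule frequently_cong[OF eq]) simp
  have "liminf_cut c = liminf_cut ?w" "limsup_cut c = limsup_cut ?w"
    by (auto simp: liminf_cut_iff limsup_cut_iff e1 e2)
  moreover have "liminf_cut ?w = {0..<1}" "limsup_cut ?w = {0..<2}"
    by (rule interleave_cuts[OF converges_const converges_const]; auto simp: along_std)+
  ultimately have L: "liminf_cut c = {0..<1}" and U: "limsup_cut c = {0..<2}" by simp_all
  have "1 / 2 \<in> {0..<2::'q} \<ominus> {0..<1}"
    unfolding internal_diff_def
  proof (intro CollectI conjI ballI)
    fix b :: 'q assume "b \<in> {0..<1} \<union> {m\<in>{0..} - {0..<1}. \<forall>y\<in>{0..} - {0..<1}. m \<le> y}"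
    then have "0 \<le> b" "b \<le> 1" by auto
    then show "1 / 2 + b \<in> {0..<2}" by auto
  qed simp
  moreover have "1 / 2 \<notin> inv_FN_cut \<iota>"
  proof
    assume "1 / 2 \<in> inv_FN_cut \<iota>"
    then have "\<forall>n::nat. 0 < n \<longrightarrow> 1 / 2 < (1 / of_nat n :: 'q)" unfolding mem_inv_FN_cut ..
    from this[rule_format, of 2] show False by simp
  qed
  moreover have "1 \<in> FN_cut \<iota>" unfolding mem_FN_cut by (auto intro: exI[of _ 2])
  ultimately show ?thesis unfolding cut_doteq_def L U by auto
qed

section \<open>Sequences converging to an additive cut\<close>

text \<open>
  Take for \<open>h k\<close> the largest \<open>m \<le> k\<close> such that \<open>P m\<close> holds from \<open>k\<close> on.
\<close>

lemma diagonal_index: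
  fixes P :: "nat \<Rightarrow> nat \<Rightarrow> bool"
  assumes "\<And>m. \<forall>\<^sub>F k in sequentially. P m k"
  obtains h :: "nat \<Rightarrow> nat" where "\<And>n. \<forall>\<^sub>F k in sequentially. n \<le> h k" "\<forall>\<^sub>F k in sequentially. P (h k) k"
proof -
  obtain J where J: "\<And>m k. J m \<le> k \<Longrightarrow> P m k"
    using assms unfolding eventually_sequentially by metis
  define h where "h k = Max {m. m \<le> k \<and> J m \<le> k}" for k
  have fin: "finite {m. m \<le> k \<and> J m \<le> k}" for k by simp
  have "n \<le> h k" if "max n (J n) \<le> k" for n k
    unfolding h_def using that by (intro Max_ge[OF fin]) simp
  then have "\<forall>\<^sub>F k in sequentially. n \<le> h k" for n unfolding eventually_sequentially by blast
  moreover have "P (h k) k" if "J 0 \<le> k" for k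
  proof -
    have "h k \<in> {m. m \<le> k \<and> J m \<le> k}"
      unfolding h_def by (rule Max_in[OF fin]) (use that in auto)
    then show ?thesis using J by simp
  qed
  then have "\<forall>\<^sub>F k in sequentially. P (h k) k" unfolding eventually_sequentially by blast
  ultimately show ?thesis using that by blast
qed

text \<open>
  The properties of nonempty additive lower cuts on which the constructions rest.  By
  \<open>1 \<in> C\<close> such a cut contains all finite numbers.
\<close>

definition segment_semigroup :: "'q set \<Rightarrow> bool" where
  "segment_semigroup C \<longleftrightarrow> C \<subseteq> {0..} \<and> 1 \<in> C \<and> (\<forall>y\<in>C. \<forall>x. 0 \<le> x \<and> x \<le> y \<longrightarrow> x \<in> C) \<and>
     (\<forall>x\<in>C. \<forall>y\<in>C. x + y \<in> C)"

context
  fixes C :: "'q set"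
  assumes C: "segment_semigroup C"
begin

lemma C_down: "y \<in> C \<Longrightarrow> 0 \<le> x \<Longrightarrow> x \<le> y \<Longrightarrow> x \<in> C"
  and C_add: "x \<in> C \<Longrightarrow> y \<in> C \<Longrightarrow> x + y \<in> C"
  and C_nonneg: "x \<in> C \<Longrightarrow> 0 \<le> x"
  and C_1: "1 \<in> C"
  using C unfolding segment_semigroup_def by auto

lemma C_mult: "y \<in> C \<Longrightarrow> of_nat n * y \<in> C"
proof (induction n)
  case 0
  then show ?case using C_down[of y 0] C_nonneg by simp
next
  case (Suc n)
  then show ?case using C_add by (simp add: distrib_right)
qed

lemma C_of_nat: "of_nat n \<in> C"
  using C_mult[OF C_1, of n] by simp

lemma not_C_divide: "y \<notin> C \<Longrightarrow> y / of_nat n \<notin> C" if "0 < n"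
  using C_mult[of "y / of_nat n" n] that by auto

lemma C_less: "x \<in> C \<Longrightarrow> y \<notin> C \<Longrightarrow> 0 \<le> y \<Longrightarrow> x < y"
  using C_down by (meson not_le)

lemma converges_floor:
  assumes t: "converges t C" and b: "\<And>k. b k \<le> t k" "\<And>k. t k < b k + 1"
  shows "converges b C"
  unfolding converges_def
proof (intro conjI ballI allI impI)
  fix y assume "y \<in> C"
  then have "y + 1 \<in> C" using C_add C_1 by blast
  then have "\<forall>\<^sub>F k in sequentially. y + 1 < t k" using t unfolding converges_def by blast
  then show "\<forall>\<^sub>F k in sequentially. y < b k" by eventually_elim (use b(2) in \<open>meson add_less_cancel_right less_trans\<close>)
next
  fix y :: 'q assume "0 \<le> y" "y \<notin> C"
  then have "\<forall>\<^sub>F k in sequentially. t k \<le> y" using t unfolding converges_def by blast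
  then show "\<forall>\<^sub>F k in sequentially. b k \<le> y" by eventually_elim (use b(1) in \<open>meson order_trans\<close>)
qed

text \<open>
  If the terms are eventually outside \<open>C\<close>, then so are the quotients by arbitrary finite numbers.
  Otherwise the terms in \<open>C\<close> are cofinal in \<open>C\<close>; for each such term, even its finite multiples are
  eventually exceeded by \<open>t k\<close>, and a diagonal sequence of denominators is slow enough.
\<close>

lemma converges_divide_slowly:
  assumes t: "converges t C" "\<And>k. 0 \<le> t k"
  obtains h :: "nat \<Rightarrow> nat" where "\<And>n. \<forall>\<^sub>F k in sequentially. n \<le> h k"
    "converges (\<lambda>k. t k / of_nat (Suc (h k))) C"
proof -
  have upper: "\<forall>\<^sub>F k in sequentially. t k / of_nat (Suc (h k)) \<le> y" if y: "0 \<le> y" "y \<notin> C" for y and h :: "nat \<Rightarrow> nat"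
  proof -
    have "\<forall>\<^sub>F k in sequentially. t k \<le> y" using t y unfolding converges_def by blast
    then show ?thesis
    proof eventually_elim
      case (elim k)
      have "(1::'q) \<le> of_nat (Suc (h k))" by simp
      then have "t k / of_nat (Suc (h k)) \<le> t k / 1"
        using t(2)[of k] by (intro divide_left_mono) (simp_all del: of_nat_Suc)
      then show ?case using elim by simp
    qed
  qed
  show ?thesis
  proof (cases "\<forall>\<^sub>F k in sequentially. t k \<notin> C")
    case True
    have "\<forall>\<^sub>F k in sequentially. y < t k / of_nat (Suc k)" if y: "y \<in> C" for y
      using True
    proof eventually_elim
      case (elim k)
      have "of_nat (Suc k) * y < t k" by (rule C_less[OF C_mult[OF y] elim t(2)])
      then show ?case by (simp add: pos_less_divide_eq mult.commute del: of_nat_Suc)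
    qed
    then have "converges (\<lambda>k. t k / of_nat (Suc k)) C" unfolding converges_def using upper[of _ "\<lambda>k. k"] by blast
    then show ?thesis using that[of "\<lambda>k. k"] eventually_ge_at_top by blast
  next
    case False
    then have "\<exists>\<^sub>F k in sequentially. t k \<in> C" unfolding frequently_def by simp
    then have "\<forall>m. \<exists>k\<ge>m. t k \<in> C" unfolding frequently_sequentially .
    then obtain i where i: "\<And>m. m \<le> i m" "\<And>m. t (i m) \<in> C" by metis
    have "\<forall>\<^sub>F k in sequentially. of_nat (Suc m) * t (i m) < t k" for m
      using t C_mult[OF i(2)] unfolding converges_def by blast
    from diagonal_index[of "\<lambda>m k. of_nat (Suc m) * t (i m) < t k", OF this]
    obtain h where h: "\<And>n. \<forall>\<^sub>F k in sequentially. n \<le> h k"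
      "\<forall>\<^sub>F k in sequentially. of_nat (Suc (h k)) * t (i (h k)) < t k" by blast
    have "\<forall>\<^sub>F k in sequentially. y < t k / of_nat (Suc (h k))" if y: "y \<in> C" for y
    proof -
      obtain N where N: "\<And>k. N \<le> k \<Longrightarrow> y < t k"
        using t y unfolding converges_def eventually_sequentially by blast
      show ?thesis
        using h(1)[of N] h(2)
      proof eventually_elim
        case (elim k)
        have "y < t (i (h k))" using N i(1) elim(1) by (meson order_trans)
        also have "\<dots> < t k / of_nat (Suc (h k))"
          using elim(2) by (simp add: pos_less_divide_eq mult.commute del: of_nat_Suc)
        finally show ?case .
      qed
    qed
    then have "converges (\<lambda>k. t k / of_nat (Suc (h k))) C" unfolding converges_def using upper by blast
    then show ?thesis using that h(1) by blast
  qed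
qed

text \<open>
  The mirror image of the preceding argument: if the terms are outside \<open>C\<close> infinitely often,
  those terms are coinitial in the complement of \<open>C\<close>, and eventually \<open>t k\<close> is below their finite
  fractions.
\<close>

lemma converges_multiply_slowly:
  assumes t: "converges t C" "\<And>k. 0 \<le> t k"
  obtains h :: "nat \<Rightarrow> nat" where "\<And>n. \<forall>\<^sub>F k in sequentially. n \<le> h k"
    "converges (\<lambda>k. of_nat (Suc (h k)) * t k) C"
proof -
  have lower: "\<forall>\<^sub>F k in sequentially. y < of_nat (Suc (h k)) * t k" if y: "y \<in> C" for y and h :: "nat \<Rightarrow> nat"
  proof -
    have "\<forall>\<^sub>F k in sequentially. y < t k" using t y unfolding converges_def by blast
    then show ?thesis
    proof eventually_elim
      case (elim k)
      have "1 * t k \<le> of_nat (Suc (h k)) * t k" using t(2)[of k] by (intro mult_right_mono) simp_all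
      then show ?case using elim by simp
    qed
  qed
  show ?thesis
  proof (cases "\<forall>\<^sub>F k in sequentially. t k \<in> C")
    case True
    have "\<forall>\<^sub>F k in sequentially. of_nat (Suc k) * t k \<le> y" if y: "0 \<le> y" "y \<notin> C" for y
      using True
    proof eventually_elim
      case (elim k)
      show ?case using C_less[OF C_mult[OF elim] y(2,1)] by (rule less_imp_le)
    qed
    then have "converges (\<lambda>k. of_nat (Suc k) * t k) C" unfolding converges_def using lower[of _ "\<lambda>k. k"] by blast
    then show ?thesis using that[of "\<lambda>k. k"] eventually_ge_at_top by blast
  next
    case False
    then have "\<exists>\<^sub>F k in sequentially. t k \<notin> C" unfolding frequently_def by simp
    then have "\<forall>m. \<exists>k\<ge>m. t k \<notin> C" unfolding frequently_sequentially .
    then obtain i where i: "\<And>m. m \<le> i m" "\<And>m. t (i m) \<notin> C" by metis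
    have "\<forall>\<^sub>F k in sequentially. t k \<le> t (i m) / of_nat (Suc m)" for m
    proof -
      have "t (i m) / of_nat (Suc m) \<notin> C" using i(2) by (intro not_C_divide) simp_all
      moreover have "0 \<le> t (i m) / of_nat (Suc m)" using t(2) by (simp del: of_nat_Suc)
      ultimately show ?thesis using t unfolding converges_def by blast
    qed
    from diagonal_index[of "\<lambda>m k. t k \<le> t (i m) / of_nat (Suc m)", OF this]
    obtain h where h: "\<And>n. \<forall>\<^sub>F k in sequentially. n \<le> h k"
      "\<forall>\<^sub>F k in sequentially. t k \<le> t (i (h k)) / of_nat (Suc (h k))" by blast
    have "\<forall>\<^sub>F k in sequentially. of_nat (Suc (h k)) * t k \<le> y" if y: "0 \<le> y" "y \<notin> C" for y
    proof -
      obtain N where N: "\<And>k. N \<le> k \<Longrightarrow> t k \<le> y"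
        using t y unfolding converges_def eventually_sequentially by blast
      show ?thesis
        using h(1)[of N] h(2)
      proof eventually_elim
        case (elim k)
        have "of_nat (Suc (h k)) * t k \<le> t (i (h k))"
          using elim(2) by (simp add: pos_le_divide_eq mult.commute del: of_nat_Suc)
        also have "\<dots> \<le> y" using N i(1) elim(1) by (meson order_trans)
        finally show ?case .
      qed
    qed
    then have "converges (\<lambda>k. of_nat (Suc (h k)) * t k) C" unfolding converges_def using lower by blast
    then show ?thesis using that h(1) by blast
  qed
qed

lemma converges_scale:
  assumes t: "converges t C" "\<And>k. 0 \<le> t k" and x: "0 < n" "1 / of_nat n \<le> x" "x \<le> of_nat m"
  shows "converges (\<lambda>k. x * t k) C"
  unfolding converges_def
proof (intro conjI ballI allI impI)
  fix y assume "y \<in> C"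
  then have "\<forall>\<^sub>F k in sequentially. of_nat n * y < t k" using t C_mult unfolding converges_def by blast
  then show "\<forall>\<^sub>F k in sequentially. y < x * t k"
  proof eventually_elim
    case (elim k)
    have "y < 1 / of_nat n * t k" using elim x(1) by (simp add: pos_less_divide_eq mult.commute)
    also have "\<dots> \<le> x * t k" using x(2) t(2) by (rule mult_right_mono)
    finally show ?case .
  qed
next
  fix y :: 'q assume y: "0 \<le> y" "y \<notin> C"
  have "0 < x" using x(1,2) by (meson less_le_trans of_nat_0_less_iff zero_less_divide_1_iff)
  then have m: "0 < m" using x(3) by (cases m) simp_all
  then have "y / of_nat m \<notin> C" "0 \<le> y / of_nat m" using not_C_divide y by simp_all
  then have "\<forall>\<^sub>F k in sequentially. t k \<le> y / of_nat m" using t unfolding converges_def by blast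
  then show "\<forall>\<^sub>F k in sequentially. x * t k \<le> y"
  proof eventually_elim
    case (elim k)
    have "x * t k \<le> of_nat m * t k" using x(3) t(2) by (rule mult_right_mono)
    also have "\<dots> \<le> y" using elim m by (simp add: pos_le_divide_eq mult.commute)
    finally show ?case .
  qed
qed

end

end

section \<open>Prescribing the measure of a semiset\<close>

context ast_rationals begin

lemma iota_ge_1: "n \<in> NN \<Longrightarrow> 0 < \<iota> n \<Longrightarrow> 1 \<le> \<iota> n"
proof -
  assume n: "n \<in> NN" "0 < \<iota> n"
  from n(1) show ?thesis
  proof (cases rule: NN_cases)
    case 1
    then show ?thesis using n(2) by (simp add: iota_0)
  next
    case (2 m)
    then show ?thesis using iota_nonneg[of m] by (simp add: iota_succ)
  qed
qed

text \<open>
  A lower cut with a positive element contains \<open>Q\<langle>1\<rangle>\<close>, hence \<open>1 / 2\<close> and, by additivity, \<open>1\<close>.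
\<close>

lemma additive_cut_segment_semigroup:
  assumes add: "additive_cut C" and "C \<noteq> {}" and B: "lower_cut \<iota> B = C"
  shows "segment_semigroup C"
proof -
  have C: "C \<subseteq> {0..}" "\<And>x. x \<in> C \<Longrightarrow> {0..x} \<subseteq> C" "\<And>x. x \<in> C \<Longrightarrow> \<exists>y\<in>C. x < y"
    using add unfolding additive_cut_def is_cut_def by blast+
  have sum: "x + y \<in> C" if xy: "x \<in> C" "y \<in> C" for x y
  proof -
    obtain z where z: "z \<in> C" "x < z" using C(3) xy(1) by blast
    have "0 \<le> x" "0 \<le> y" "0 \<le> z" using xy z C(1) by auto
    then have "0 \<le> x + y" "x + y < z + y" "z \<in> C \<inter> {0..}" "y \<in> C \<inter> {0..}"
      using z xy(2) by simp_all
    then have "x + y \<in> internal_sum C C" unfolding internal_sum_def by blast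
    then show ?thesis using add unfolding additive_cut_def by simp
  qed
  obtain x where x: "x \<in> C" using \<open>C \<noteq> {}\<close> by blast
  then obtain y where "y \<in> C" "x < y" using C(3) by blast
  then obtain n u where n: "n \<in> NN" "elts u \<subseteq> B" "strictly_subvalent n u" "0 < \<iota> n"
    using x C(1) unfolding B[symmetric] lower_cut_def by force
  have "1 / 2 < \<iota> n" using iota_ge_1[OF n(1,4)] by simp
  then have "1 / 2 \<in> C" unfolding B[symmetric] lower_cut_def using n by auto
  then have "1 \<in> C" using sum[of "1 / 2" "1 / 2"] by simp
  moreover have "x \<in> C" if "y \<in> C" "0 \<le> x" "x \<le> y" for x y
    using C(2)[OF that(1)] that(2,3) by auto
  ultimately show ?thesis unfolding segment_semigroup_def using C(1) sum by blast
qed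

lemma ex_infinite: "\<exists>x::'q. \<forall>n::nat. of_nat n < x"
proof -
  obtain m :: 'v where m: "m \<in> NN" "m \<notin> FN" using ex_NN_not_FN by blast
  have "of_nat k < \<iota> m" for k
    using iota_less[OF std_NN m(1), of k] not_FN_greater[OF m, of k] by (simp add: iota_std)
  then show ?thesis by blast
qed

lemma mon_infinite:
  assumes "\<And>n::nat. of_nat n < x"
  shows "mon \<iota> x = ast_infinity \<iota>"
proof -
  have "x \<notin> BQ \<iota>" unfolding BQ_iff using assms by (metis abs_ge_self leD le_less_trans)
  moreover have "\<not> (\<forall>n::nat. x < - of_nat n)"
    using assms[of 0] by (metis less_asym neg_0_equal_iff_equal of_nat_0)
  ultimately show ?thesis
    unfolding mon_def ast_infinity_def rat_doteq_iff FN_eq_range_std using assms by (auto simp: iota_std)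
qed

lemma mon_le_0D:
  assumes "mon_le (mon \<iota> 0) (mon \<iota> x)" and "0 < n"
  shows "- (1 / of_nat n) < x"
proof -
  obtain p q where p: "rat_doteq \<iota> p 0" and q: "rat_doteq \<iota> q x" and pq: "p \<le> q"
    using assms(1) unfolding mon_le_def mon_def by blast
  have n2: "0 < 2 * n" using assms(2) by simp
  have "\<not> (\<forall>n::nat. (of_nat n :: 'q) < 0)" "\<not> (\<forall>n::nat. (0::'q) < - of_nat n)"
    by (auto intro: exI[of _ 0])
  then have "\<forall>n::nat. 0 < n \<longrightarrow> \<bar>p - 0\<bar> < 1 / of_nat n"
    using p unfolding rat_doteq_iff by blast
  from this[rule_format, OF n2] have p': "\<bar>p\<bar> < 1 / of_nat (2 * n)" by simp
  from q consider "\<forall>n::nat. 0 < n \<longrightarrow> \<bar>q - x\<bar> < 1 / of_nat n" | "\<forall>n::nat. of_nat n < x"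
    | "\<forall>n::nat. q < - of_nat n" unfolding rat_doteq_iff by blast
  then show ?thesis
  proof cases
    case 1
    then have "\<bar>q - x\<bar> < 1 / of_nat (2 * n)" using n2 by blast
    then show ?thesis using p' pq inverse_of_nat_half[OF assms(2)] by linarith
  next
    case 2
    have "0 \<le> 1 / (of_nat n :: 'q)" by simp
    moreover have "0 < x" using spec[OF 2, of 0] by simp
    ultimately show ?thesis by linarith
  next
    case 3
    have "1 / of_nat (2 * n) \<le> (1::'q)" using n2 by (simp add: divide_le_eq del: of_nat_mult)
    then show ?thesis using spec[OF 3, of 1] p' pq by (simp; linarith)
  qed
qed

context
  fixes s :: "'v \<Rightarrow> 'q" and B :: "'v set" and C :: "'q set"
  assumes B: "B \<in> Borel_semisets" and cut_B: "has_cut \<iota> B C" and C: "segment_semigroup C"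
    and s: "\<And>k. s (std k) \<in> \<iota> ` NN" "converges (\<lambda>k. s (std k)) C"
begin

lemma s_nonneg: "0 \<le> s (std k)"
  using s(1)[of k] iota_nonneg by auto

lemma s_infinite: "\<forall>\<^sub>F k in sequentially. of_nat n < s (std k)"
  using s(2) C_of_nat[OF C] unfolding converges_def by blast

text \<open>
  The constructions below only have to provide a sequence \<open>b\<close> with the right cut and the right
  ratio to \<open>s\<close>.
\<close>

lemma realise_near:
  assumes b: "range b \<subseteq> \<iota> ` NN" "converges b C"
    and near: "\<And>n::nat. 0 < n \<Longrightarrow> \<forall>\<^sub>F k in sequentially. \<bar>b k / s (std k) - x\<bar> < 1 / of_nat n"
  shows "\<exists>F. BAF \<iota> F \<and> B \<in> observable \<iota> s F \<and> kalina_measure \<iota> s F B = mon \<iota> x"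
proof -
  obtain F where F: "BAF \<iota> F" "\<And>k. F B (std k) = b k" using ex_BAF_prescribed[OF cut_B b] by blast
  have *: "\<forall>\<^sub>F k in sequentially. \<bar>F B (std k) / s (std k) - x\<bar> < 1 / of_nat n" if "0 < n" for n :: nat
    unfolding F(2) by (rule near[OF that])
  have "B \<in> observable \<iota> s F"
    unfolding observable_def using B cut_doteq_near[of "\<lambda>i. F B i / s i", OF *] by blast
  moreover have "lim_mon \<iota> (\<lambda>i. F B i / s i) x" unfolding lim_mon_iff using * by blast
  ultimately show ?thesis using F(1) kalina_measure_eq by blast
qed

lemma realise_infinite:
  assumes b: "range b \<subseteq> \<iota> ` NN" "converges b C"
    and inf: "\<And>n::nat. \<forall>\<^sub>F k in sequentially. of_nat n < b k / s (std k)"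
  shows "\<exists>F. BAF \<iota> F \<and> B \<in> observable \<iota> s F \<and> kalina_measure \<iota> s F B = ast_infinity \<iota>"
proof -
  obtain F where F: "BAF \<iota> F" "\<And>k. F B (std k) = b k" using ex_BAF_prescribed[OF cut_B b] by blast
  have *: "\<forall>\<^sub>F k in sequentially. of_nat n < F B (std k) / s (std k)" for n :: nat
    unfolding F(2) by (rule inf)
  obtain x :: 'q where x: "\<And>n::nat. of_nat n < x" using ex_infinite by blast
  have "B \<in> observable \<iota> s F"
    unfolding observable_def using B cut_doteq_infinite[of "\<lambda>i. F B i / s i", OF *] by blast
  moreover have "lim_mon \<iota> (\<lambda>i. F B i / s i) x" unfolding lim_mon_iff using * x by blast
  ultimately show ?thesis using F(1) kalina_measure_eq mon_infinite[OF x] by metis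
qed

lemma ex_floor_sequence:
  assumes "\<And>k. 0 \<le> t k" "converges t C"
  shows "\<exists>b. range b \<subseteq> \<iota> ` NN \<and> converges b C \<and> (\<forall>k. b k \<le> t k \<and> t k < b k + 1)"
proof -
  have "\<exists>q. q \<in> \<iota> ` NN \<and> q \<le> t k \<and> t k < q + 1" for k
    using iota_floor[OF assms(1)[of k]] by blast
  then obtain b where b: "\<And>k. b k \<in> \<iota> ` NN" "\<And>k. b k \<le> t k" "\<And>k. t k < b k + 1" by metis
  have "range b \<subseteq> \<iota> ` NN" using b(1) by blast
  moreover have "converges b C" by (rule converges_floor[OF C assms(2) b(2,3)])
  ultimately show ?thesis using b(2,3) by (intro exI[of _ b]) simp
qed

lemma realise_positive:
  assumes n: "0 < n" "1 / of_nat n \<le> x" and m: "x \<le> of_nat m"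
  shows "\<exists>F. BAF \<iota> F \<and> B \<in> observable \<iota> s F \<and> kalina_measure \<iota> s F B = mon \<iota> x"
proof -
  have "0 < x" using n by (meson less_le_trans of_nat_0_less_iff zero_less_divide_1_iff)
  then have nn: "0 \<le> x * s (std k)" for k using s_nonneg by simp
  obtain b where b: "range b \<subseteq> \<iota> ` NN" "converges b C"
      and b_le: "\<forall>k. b k \<le> x * s (std k) \<and> x * s (std k) < b k + 1"
    using ex_floor_sequence[OF nn converges_scale[OF C s(2) s_nonneg n m]] by (elim exE conjE)
  show ?thesis
  proof (rule realise_near[OF b])
    fix n :: nat assume n: "0 < n"
    show "\<forall>\<^sub>F k in sequentially. \<bar>b k / s (std k) - x\<bar> < 1 / of_nat n"
      using s_infinite[of n]
    proof eventually_elim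
      case (elim k)
      have pos: "0 < s (std k)" using elim n by (meson less_trans of_nat_0_less_iff)
      have "b k / s (std k) \<le> x" using spec[OF b_le, of k] pos by (simp add: pos_divide_le_eq)
      moreover have "x - b k / s (std k) \<le> 1 / s (std k)"
      proof -
        have "x - b k / s (std k) = (x * s (std k) - b k) / s (std k)"
          using pos by (simp add: diff_divide_distrib)
        then show ?thesis using spec[OF b_le, of k] pos by (simp add: divide_right_mono)
      qed
      moreover have "1 / s (std k) < 1 / of_nat n"
        using elim n pos by (intro divide_strict_left_mono) simp_all
      ultimately show ?case by linarith
    qed
  qed
qed

lemma realise_zero:
  "\<exists>F. BAF \<iota> F \<and> B \<in> observable \<iota> s F \<and> kalina_measure \<iota> s F B = mon \<iota> 0"
proof -
  obtain h where h: "\<And>n. \<forall>\<^sub>F k in sequentially. n \<le> h k"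
      "converges (\<lambda>k. s (std k) / of_nat (Suc (h k))) C"
    using converges_divide_slowly[OF C s(2) s_nonneg] by blast
  have nn: "0 \<le> s (std k) / of_nat (Suc (h k))" for k using s_nonneg by (simp del: of_nat_Suc)
  obtain b where b: "range b \<subseteq> \<iota> ` NN" "converges b C"
      and b_le: "\<forall>k. b k \<le> s (std k) / of_nat (Suc (h k)) \<and> s (std k) / of_nat (Suc (h k)) < b k + 1"
    using ex_floor_sequence[OF nn h(2)] by (elim exE conjE)
  show ?thesis
  proof (rule realise_near[OF b])
    fix n :: nat assume n: "0 < n"
    show "\<forall>\<^sub>F k in sequentially. \<bar>b k / s (std k) - 0\<bar> < 1 / of_nat n"
      using s_infinite[of 0] h(1)[of n]
    proof eventually_elim
      case (elim k)
      have pos: "0 < s (std k)" using elim(1) by simp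
      have "b k \<in> \<iota> ` NN" using b(1) by blast
      then have "0 \<le> b k" using iota_nonneg by auto
      then have "0 \<le> b k / s (std k)" using pos by simp
      moreover have "b k / s (std k) \<le> s (std k) / of_nat (Suc (h k)) / s (std k)"
        using spec[OF b_le, of k] pos by (intro divide_right_mono) simp_all
      moreover have "s (std k) / of_nat (Suc (h k)) / s (std k) = 1 / of_nat (Suc (h k))"
        using pos by simp
      moreover have "1 / of_nat (Suc (h k)) < 1 / (of_nat n :: 'q)"
        using elim(2) n by (intro divide_strict_left_mono) (simp_all del: of_nat_Suc)
      ultimately show ?case by simp
    qed
  qed
qed

lemma realise_infinity:
  "\<exists>F. BAF \<iota> F \<and> B \<in> observable \<iota> s F \<and> kalina_measure \<iota> s F B = ast_infinity \<iota>"
proof -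
  obtain h where h: "\<And>n. \<forall>\<^sub>F k in sequentially. n \<le> h k"
      "converges (\<lambda>k. of_nat (Suc (h k)) * s (std k)) C"
    using converges_multiply_slowly[OF C s(2) s_nonneg] by blast
  have "of_nat (Suc (h k)) * s (std k) \<in> \<iota> ` NN" for k
  proof -
    obtain n where n: "n \<in> NN" "s (std k) = \<iota> n" using s(1) by blast
    then have "of_nat (Suc (h k)) * s (std k) = \<iota> (nat_mult (std (Suc (h k))) n)"
      using iota_mult[OF std_NN n(1)] iota_std by metis
    then show ?thesis using nat_mult_NN by blast
  qed
  then have b: "range (\<lambda>k. of_nat (Suc (h k)) * s (std k)) \<subseteq> \<iota> ` NN" by blast
  show ?thesis
  proof (rule realise_infinite[OF b h(2)])
    fix n :: nat
    show "\<forall>\<^sub>F k in sequentially. of_nat n < of_nat (Suc (h k)) * s (std k) / s (std k)"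
      using s_infinite[of 0] h(1)[of n]
    proof eventually_elim
      case (elim k)
      then have "of_nat (Suc (h k)) * s (std k) / s (std k) = of_nat (Suc (h k))" by simp
      moreover have "(of_nat n :: 'q) < of_nat (Suc (h k))" using elim(2) by (simp del: of_nat_Suc)
      ultimately show ?case by simp
    qed
  qed
qed

lemma ex_not_observable: "\<exists>G. BAF \<iota> G \<and> B \<notin> observable \<iota> s G"
proof -
  let ?b = "\<lambda>k. if even k then s (std k) else 2 * s (std k)"
  have "2 * s (std k) \<in> \<iota> ` NN" for k
  proof -
    obtain n where n: "n \<in> NN" "s (std k) = \<iota> n" using s(1) by blast
    then have "2 * s (std k) = \<iota> (nat_add n n)" using iota_add[OF n(1) n(1)] by simp
    then show ?thesis using nat_add_NN by blast
  qed
  then have "range ?b \<subseteq> \<iota> ` NN" using s(1) by auto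
  moreover have "converges ?b C"
  proof -
    have 2: "converges (\<lambda>k. 2 * s (std k)) C"
      by (rule converges_scale[OF C s(2) s_nonneg, of 1 2 2]) simp_all
    show ?thesis
      unfolding converges_def
    proof (intro conjI ballI allI impI)
      fix y assume "y \<in> C"
      then have "\<forall>\<^sub>F k in sequentially. y < s (std k)" "\<forall>\<^sub>F k in sequentially. y < 2 * s (std k)"
        using s(2) 2 unfolding converges_def by blast+
      then show "\<forall>\<^sub>F k in sequentially. y < ?b k" by eventually_elim simp
    next
      fix y :: 'q assume "0 \<le> y" "y \<notin> C"
      then have "\<forall>\<^sub>F k in sequentially. s (std k) \<le> y" "\<forall>\<^sub>F k in sequentially. 2 * s (std k) \<le> y"
        using s(2) 2 unfolding converges_def by blast+
      then show "\<forall>\<^sub>F k in sequentially. ?b k \<le> y" by eventually_elim simp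
    qed
  qed
  ultimately obtain G where G: "BAF \<iota> G" "\<And>k. G B (std k) = ?b k"
    using ex_BAF_prescribed[OF cut_B, of ?b] by blast
  have "\<forall>\<^sub>F k in sequentially. G B (std k) / s (std k) = (if even k then 1 else 2)"
    using s_infinite[of 0] by eventually_elim (simp add: G(2))
  from not_cut_doteq_alternating[of "\<lambda>i. G B i / s i", OF this]
  have "B \<notin> observable \<iota> s G" unfolding observable_def by blast
  then show ?thesis using G(1) by blast
qed

lemma realise_real:
  assumes r: "r \<in> ast_reals \<iota> \<union> {ast_infinity \<iota>}" and nonneg: "mon_le (mon \<iota> 0) r"
  shows "\<exists>F. BAF \<iota> F \<and> B \<in> observable \<iota> s F \<and> kalina_measure \<iota> s F B = r"
proof (cases "r = ast_infinity \<iota>")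
  case True
  then show ?thesis using realise_infinity by simp
next
  case False
  then obtain x where x: "x \<in> BQ \<iota>" "r = mon \<iota> x" using r unfolding ast_reals_def by blast
  show ?thesis
  proof (cases "\<exists>n::nat. 0 < n \<and> 1 / of_nat n \<le> x")
    case True
    then obtain n :: nat where n: "0 < n" "1 / of_nat n \<le> x" by blast
    obtain m :: nat where "x \<le> of_nat m" using x(1) unfolding BQ_iff abs_le_iff by blast
    then show ?thesis unfolding x(2) by (rule realise_positive[OF n])
  next
    case False
    have "\<bar>x - 0\<bar> < 1 / of_nat n" if "0 < n" for n :: nat
    proof -
      have "x < 1 / of_nat n" using False that by (meson not_le)
      moreover have "- (1 / of_nat n) < x" by (rule mon_le_0D[OF nonneg[unfolded x(2)] that])
      ultimately show ?thesis by linarith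
    qed
    then have "mon \<iota> x = mon \<iota> 0" by (intro mon_eqI rat_doteq_close)
    then show ?thesis unfolding x(2) using realise_zero by simp
  qed
qed

end

end

theorem theorem31:
  fixes \<iota> :: "'v::ast \<Rightarrow> 'q::linordered_field"
    and s :: "'v \<Rightarrow> 'q"
    and B :: "'v set"
  assumes rationals: "rationals \<iota>"
    and s: "\<exists>A\<in>Borel_semisets. (\<exists>C. additive_cut C \<and> has_cut \<iota> A C) \<and>
              approximating_sequence \<iota> s A"
    and B: "B \<in> Borel_semisets"
    and cut_B: "has_cut \<iota> B (liminf_cut s)"
    and additive: "additive_cut (liminf_cut s)"
    and nonempty: "liminf_cut s \<noteq> {}"
  shows "(\<forall>r \<in> ast_reals \<iota> \<union> {ast_infinity \<iota>}.
            mon_le (mon \<iota> 0) r \<and> mon_le r (ast_infinity \<iota>) \<longrightarrow>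
            (\<exists>F. BAF \<iota> F \<and> B \<in> observable \<iota> s F \<and> kalina_measure \<iota> s F B = r)) \<and>
         (\<exists>G. BAF \<iota> G \<and> B \<notin> observable \<iota> s G)"
proof -
  interpret ast_rationals \<iota> by unfold_locales (rule rationals)
  obtain A where A: "\<exists>C. has_cut \<iota> A C" "approximating_sequence \<iota> s A" using s by blast
  then have "limsup_cut s = liminf_cut s"
    unfolding approximating_sequence_def has_cut_def by auto
  then have conv: "converges (\<lambda>k. s (std k)) (liminf_cut s)" by (intro cuts_converges refl)
  have sN: "s (std k) \<in> \<iota> ` NN" for k
    using A(2) FN_eq_range_std unfolding approximating_sequence_def by blast
  have "lower_cut \<iota> B = liminf_cut s" using cut_B unfolding has_cut_def by blast
  then have C: "segment_semigroup (liminf_cut s)"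
    by (rule additive_cut_segment_semigroup[OF additive nonempty])
  note hyps = B cut_B C sN conv
  show ?thesis
    using realise_real[OF hyps] ex_not_observable[OF hyps] by blast
qed

end
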